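(* Let $F:\mathbb{R}^n\rightrightarrows\mathbb{R}^n$ be a set-valued mapping, $(\bar x,\bar y)\in\mathrm{gph}\,F$, with $\mathrm{gph}\,F$ locally closed around $(\bar x,\bar y)$, and assume that $F$ is locally maximally hypomonotone at $(\bar x,\bar y)$. Then the following two statements are equivalent: (i) $F$ is SCD regular around $(\bar x,\bar y)$ and for every $L\in\mathcal{S}F(\bar x,\bar y)$ the matrix $C_L$ is positive semidefinite (i.e. $\langle C_Lp,p\rangle\ge0$ for all $p\in\mathbb{R}^n$; symmetry is not required). (ii) $F$ is strongly metrically regular around $(\bar x,\bar y)$ and $$\liminf_{(x^1,y^1),(x^2,y^2)\to(\bar x,\bar y),\ (x^1,y^1),(x^2,y^2)\in\mathrm{gph}\,F}\ \frac{\langle x^1-x^2,y^1-y^2\rangle}{\|x^1-x^2\|\,\|y^1-y^2\|}\ \ge\ 0$$ with the convention $0/0:=0$.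
   Context: Norms are Euclidean. $\mathrm{gph}\,F=\{(x,y)\mid y\in F(x)\}$. For a set $A$ and $\bar z\in A$, the tangent cone $T_A(\bar z)$ is the set of all $w$ for which there are $t_k\downarrow0$, $w_k\to w$ with $\bar z+t_kw_k\in A$ for all $k$. Monotonicity. $T:\mathbb{R}^n\rightrightarrows\mathbb{R}^n$ is monotone if $\langle y_1-y_2,x_1-x_2\rangle\ge0$ for all $(x_i,y_i)\in\mathrm{gph}\,T$, $i=1,2$. $F$ is locally maximally monotone at $(x,y)\in\mathrm{gph}\,F$ if there is an open neighborhood $X\times Y$ of $(x,y)$ such that $\langle y_1-y_2,x_1-x_2\rangle\ge0$ for all $(x_i,y_i)\in\mathrm{gph}\,F\cap(X\times Y)$, $i=1,2$, and $\mathrm{gph}\,F\cap(X\times Y)=\mathrm{gph}\,T\cap(X\times Y)$ for every monotone $T$ with $\mathrm{gph}\,F\cap(X\times Y)\subseteq\mathrm{gph}\,T$. $F$ is locally maximally hypomonotone at $(x,y)$ if $\gamma I+F$ is locally maximally monotone at $(x,\gamma x+y)$ for some $\gamma\ge0$. Subspaces. $\mathcal{Z}_n$ is the set of $n$-dimensional linear subspaces of $\mathbb{R}^{2n}=\mathbb{R}^n\times\mathbb{R}^n$ with metric $d_{\mathcal{Z}}(L_1,L_2)=\|P_1-P_2\|$, $P_i$ the orthogonal projection onto $L_i$. $L^*:=\{(-v^*,u^* )\mid(u^*,v^* )\in L^\perp\}$. $\mathcal{Z}_n^{\rm reg}$ is the set of all $L\in\mathcal{Z}_n$ such that $(y^*,0)\in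 L\Rightarrow y^*=0$. Each $L\in\mathcal{Z}_n^{\rm reg}$ can be written as $L=\{(C_Lp,p)\mid p\in\mathbb{R}^n\}$ with a unique $n\times n$ matrix $C_L$; moreover $L\in\mathcal{Z}_n^{\rm reg}$ iff $L^*\in\mathcal{Z}_n^{\rm reg}$. SCD notions. $\mathcal{O}_F$ is the set of $(x,y)\in\mathrm{gph}\,F$ with $T_{\mathrm{gph}\,F}(x,y)\in\mathcal{Z}_n$. For $(x,y)\in\mathrm{gph}\,F$, $\mathcal{S}F(x,y)$ (resp. $\mathcal{S}^*F(x,y)$) is the set of all $L\in\mathcal{Z}_n$ for which there is a sequence $(x_k,y_k)\to(x,y)$ in $\mathcal{O}_F$ with $d_{\mathcal{Z}}(L,T_{\mathrm{gph}\,F}(x_k,y_k))\to0$ (resp. $d_{\mathcal{Z}}(L,T_{\mathrm{gph}\,F}(x_k,y_k)^* )\to0$); thus $\mathcal{S}^*F(x,y)=\{L^*\mid L\in\mathcal{S}F(x,y)\}$. $F$ has the SCD property at $(x,y)$ if $\mathcal{S}^*F(x,y)\neq\emptyset$, and around $(x,y)$ if it has it at all points of $\mathrm{gph}\,F$ in some neighborhood of $(x,y)$. $F$ is SCD regular around $(x,y)$ if it has the SCD property around $(x,y)$ and $\mathcal{S}^*F(x,y)\subseteq\mathcal{Z}_n^{\rm reg}$. Metric regularity. $F$ is strongly metrically regular around $(\bar x,\bar y)$ if there are $\kappa\ge0$ and neighborhoods $X$ of $\bar x$, $Y$ of $\bar y$ with $\mathrm{dist}(x,F^{-1}(y))\le\kappa\,\mathrm{dist}(y,F(x))$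 for all $(x,y)\in X\times Y$, and there are open neighborhoods $Y'$ of $\bar y$, $X'$ of $\bar x$ and a mapping $h:Y'\to\mathbb{R}^n$ with $h(\bar y)=\bar x$ and $\mathrm{gph}\,F\cap(X'\times Y')=\{(h(y),y)\mid y\in Y'\}$. *)

theory Defs
  imports "HOL-Analysis.Analysis"
begin

section \<open>Set-valued mappings\<close>

definition gph :: "('a \<Rightarrow> 'b set) \<Rightarrow> ('a \<times> 'b) set" where
  "gph F = {(x, y). y \<in> F x}"

definition inverse_map :: "('a \<Rightarrow> 'b set) \<Rightarrow> 'b \<Rightarrow> 'a set" where
  "inverse_map F y = {x. y \<in> F x}"

definition locally_closed_around :: "'a::topological_space set \<Rightarrow> 'a \<Rightarrow> bool" where
  "locally_closed_around A z \<longleftrightarrow> (\<exists>V. closed V \<and> z \<in> interior V \<and> closed (A \<inter> V))"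

text \<open>The notation \<open>t\<^sub>k \<down> 0\<close> means that \<open>t\<^sub>k\<close> is positive and tends to zero; \<open>t\<close> need not be
  monotone (passing to a subsequence shows that requiring this would not change the cone).\<close>

definition tangent_cone :: "'a::real_normed_vector set \<Rightarrow> 'a \<Rightarrow> 'a set" where
  "tangent_cone A z = {w. \<exists>(t :: nat \<Rightarrow> real) (v :: nat \<Rightarrow> 'a).
     (\<forall>k. t k > 0) \<and> t \<longlonglongrightarrow> 0 \<and> v \<longlonglongrightarrow> w \<and> (\<forall>k. z + t k *\<^sub>R v k \<in> A)}"


section \<open>Monotonicity\<close>

definition monotone_graph :: "('a::real_inner \<times> 'a) set \<Rightarrow> bool" where
  "monotone_graph G \<longleftrightarrow> (\<forall>(x1, y1) \<in> G. \<forall>(x2, y2) \<in> G. (y1 - y2) \<bullet> (x1 - x2) \<ge> 0)"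

definition locally_max_monotone :: "('a::real_inner \<Rightarrow> 'a set) \<Rightarrow> 'a \<Rightarrow> 'a \<Rightarrow> bool" where
  "locally_max_monotone F x y \<longleftrightarrow> (\<exists>X Y. open X \<and> open Y \<and> x \<in> X \<and> y \<in> Y \<and>
     monotone_graph (gph F \<inter> (X \<times> Y)) \<and>
     (\<forall>T. monotone_graph (gph T) \<and> gph F \<inter> (X \<times> Y) \<subseteq> gph T \<longrightarrow>
          gph F \<inter> (X \<times> Y) = gph T \<inter> (X \<times> Y)))"

definition locally_max_hypomonotone :: "('a::real_inner \<Rightarrow> 'a set) \<Rightarrow> 'a \<Rightarrow> 'a \<Rightarrow> bool" where
  "locally_max_hypomonotone F x y \<longleftrightarrow> (\<exists>\<gamma>::real. \<gamma> \<ge> 0 \<and>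
     locally_max_monotone (\<lambda>u. (\<lambda>v. \<gamma> *\<^sub>R u + v) ` F u) x (\<gamma> *\<^sub>R x + y))"


section \<open>Subspaces\<close>

definition Z_sub :: "((real^'n) \<times> (real^'n)) set set" where
  "Z_sub = {L. subspace L \<and> dim L = CARD('n)}"

definition orth_proj :: "'a::euclidean_space set \<Rightarrow> 'a \<Rightarrow> 'a" where
  "orth_proj L z = (THE p. p \<in> L \<and> z - p \<in> L\<^sup>\<bottom>)"

definition d_Z :: "'a::euclidean_space set \<Rightarrow> 'a set \<Rightarrow> real" where
  "d_Z L1 L2 = onorm (\<lambda>z. orth_proj L1 z - orth_proj L2 z)"

definition adj_sub :: "((real^'n) \<times> (real^'n)) set \<Rightarrow> ((real^'n) \<times> (real^'n)) set" where
  "adj_sub L = {(- v, u) | u v. (u, v) \<in> L\<^sup>\<bottom>}"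

definition Z_reg :: "((real^'n) \<times> (real^'n)) set set" where
  "Z_reg = {L \<in> Z_sub. \<forall>y. (y, 0) \<in> L \<longrightarrow> y = 0}"

text \<open>Meaningful for \<open>L \<in> Z_reg\<close>, where such a matrix exists and is unique.\<close>

definition C_mat :: "((real^'n) \<times> (real^'n)) set \<Rightarrow> real^'n^'n" where
  "C_mat L = (THE C. L = {(C *v p, p) | p. True})"

text \<open>Symmetry is not part of this notion.\<close>

definition pos_semidef :: "real^'n^'n \<Rightarrow> bool" where
  "pos_semidef C \<longleftrightarrow> (\<forall>p. (C *v p) \<bullet> p \<ge> 0)"


section \<open>SCD notions\<close>

definition O_set :: "(real^'n \<Rightarrow> (real^'n) set) \<Rightarrow> ((real^'n) \<times> (real^'n)) set" where
  "O_set F = {z \<in> gph F. tangent_cone (gph F) z \<in> Z_sub}"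

definition SF :: "(real^'n \<Rightarrow> (real^'n) set) \<Rightarrow> (real^'n) \<times> (real^'n)
    \<Rightarrow> ((real^'n) \<times> (real^'n)) set set" where
  "SF F z = {L \<in> Z_sub. \<exists>s :: nat \<Rightarrow> (real^'n) \<times> (real^'n). (\<forall>k. s k \<in> O_set F) \<and> s \<longlonglongrightarrow> z \<and>
     (\<lambda>k. d_Z L (tangent_cone (gph F) (s k))) \<longlonglongrightarrow> 0}"

definition SF_adj :: "(real^'n \<Rightarrow> (real^'n) set) \<Rightarrow> (real^'n) \<times> (real^'n)
    \<Rightarrow> ((real^'n) \<times> (real^'n)) set set" where
  "SF_adj F z = {L \<in> Z_sub. \<exists>s :: nat \<Rightarrow> (real^'n) \<times> (real^'n). (\<forall>k. s k \<in> O_set F) \<and> s \<longlonglongrightarrow> z \<and>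
     (\<lambda>k. d_Z L (adj_sub (tangent_cone (gph F) (s k)))) \<longlonglongrightarrow> 0}"

definition SCD_at :: "(real^'n \<Rightarrow> (real^'n) set) \<Rightarrow> (real^'n) \<times> (real^'n) \<Rightarrow> bool" where
  "SCD_at F z \<longleftrightarrow> SF_adj F z \<noteq> {}"

definition SCD_around :: "(real^'n \<Rightarrow> (real^'n) set) \<Rightarrow> (real^'n) \<times> (real^'n) \<Rightarrow> bool" where
  "SCD_around F z \<longleftrightarrow> (\<exists>W. open W \<and> z \<in> W \<and> (\<forall>w \<in> gph F \<inter> W. SCD_at F w))"

definition SCD_regular_around :: "(real^'n \<Rightarrow> (real^'n) set) \<Rightarrow> (real^'n) \<times> (real^'n) \<Rightarrow> bool" where
  "SCD_regular_around F z \<longleftrightarrow> SCD_around F z \<and> SF_adj F z \<subseteq> Z_reg"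


section \<open>Metric regularity\<close>

text \<open>Unlike the library's \<^const>\<open>infdist\<close>, the distance to the empty set is infinite. In the
  definition below the product \<open>0 * \<infinity> = 0\<close> of extended reals is harmless: if the inequality
  holds with \<open>\<kappa> = 0\<close>, under either reading of that product, then it holds with \<open>\<kappa> = 1\<close>.\<close>

definition edist_set :: "'a::metric_space \<Rightarrow> 'a set \<Rightarrow> ereal" where
  "edist_set x A = (INF a \<in> A. ereal (dist x a))"

definition metrically_regular_around ::
    "('a::metric_space \<Rightarrow> 'b::metric_space set) \<Rightarrow> 'a \<Rightarrow> 'b \<Rightarrow> bool" where
  "metrically_regular_around F xb yb \<longleftrightarrow> (\<exists>(\<kappa>::real) X Y. \<kappa> \<ge> 0 \<and> open X \<and> open Y \<and> xb \<in> X \<and> yb \<in> Y \<and>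
     (\<forall>x \<in> X. \<forall>y \<in> Y. edist_set x (inverse_map F y) \<le> ereal \<kappa> * edist_set y (F x)))"

definition strongly_metrically_regular_around ::
    "('a::metric_space \<Rightarrow> 'b::metric_space set) \<Rightarrow> 'a \<Rightarrow> 'b \<Rightarrow> bool" where
  "strongly_metrically_regular_around F xb yb \<longleftrightarrow> metrically_regular_around F xb yb \<and>
     (\<exists>X' Y' (h :: 'b \<Rightarrow> 'a). open X' \<and> open Y' \<and> xb \<in> X' \<and> yb \<in> Y' \<and> h yb = xb \<and>
        gph F \<inter> (X' \<times> Y') = {(h y, y) | y. y \<in> Y'})"


section \<open>The limes inferior of the normalized inner products\<close>

text \<open>Whenever the denominator vanishes so does the numerator, and \<open>0 / 0 = 0\<close> in HOL is the
  intended convention. As usual in variational analysis, the limit point itself is not excluded;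
  it contributes the value \<open>0\<close>, so this is irrelevant for the comparison with \<open>0\<close>.\<close>

definition liminf_quotient :: "('a::real_inner \<Rightarrow> 'a set) \<Rightarrow> 'a \<times> 'a \<Rightarrow> ereal" where
  "liminf_quotient F z =
     Liminf (inf (nhds (z, z)) (principal (gph F \<times> gph F)))
       (\<lambda>((x1, y1), (x2, y2)). ereal (((x1 - x2) \<bullet> (y1 - y2)) / (norm (x1 - x2) * norm (y1 - y2))))"

end

theory Submission
  imports Defs
begin

text \<open>By a local form of Minty's theorem, near the reference point \<open>gph F\<close> is the image of a ball under
  \<open>z \<mapsto> (J z, z - c J z)\<close>, where \<open>c = 1 + \<gamma>\<close> and the resolvent \<open>J\<close> of \<open>\<gamma> I + F\<close> is firmly nonexpansive.
  By Rademacher's theorem \<open>J\<close> is differentiable almost everywhere, and where it is differentiable with derivative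
  \<open>A\<close> the tangent cone of \<open>gph F\<close> is the subspace of all \<open>(A w, B w)\<close> with \<open>B = I - c A\<close>.

  Condition (i) says that \<open>B\<close> is invertible and \<open>\<langle>A w, B w\<rangle> \<ge> 0\<close> for all limits of such derivatives. By compactness
  \<open>\<langle>A w, B w\<rangle> \<ge> - \<epsilon> |w|\<^sup>2\<close> and \<open>\<langle>B w, w\<rangle> \<ge> \<mu> |w|\<^sup>2\<close> near the reference point. Both inequalities are concave in \<open>A\<close>,
  so integration along segments yields \<open>\<langle>dx, dy\<rangle> \<ge> - \<epsilon> |dz|\<^sup>2\<close> and strong monotonicity of \<open>z \<mapsto> z - c J z\<close>,
  which imply (ii). Conversely, (ii) bounds differences of points of the graph, and these bounds pass to tangent cones and
  then to their limits.\<close>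

subsection \<open>Rademacher's theorem\<close>

text \<open>Local maximality is available only in a product neighbourhood. Existence of
  \<open>J z\<close> therefore rests on the Debrunner-Flor extension property of arbitrary monotone
  graphs, and maximality serves to show that the new point already belongs to the graph. The
  constant \<open>c\<close> comes from z = x + (\<open>\<gamma>\<close> x + y): the linear map (x,
  y) -> c x + y is a left inverse of the chart, so graph points, tangent vectors and sequences are
  all pulled back by one linear map. The main obstacle is that derivatives exist only almost
  everywhere, so the segment joining two given points may lie wholly in the exceptional null set.
  The mean value inequality therefore averages over a tube of parallel segments. It handles one
  scalar component of \<open>J\<close> at a time, so each estimate must be made linear in the
  derivative: the concave form in (i) is replaced by its tangent at the increment of
  \<open>J\<close>, and strong monotonicity is stated through
  \<open>\<langle>B w, w\<rangle>\<close> instead of \<open>|B w|\<close>. Limits of derivatives are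
  governed by compactness, since firm nonexpansiveness bounds every derivative of \<open>J\<close>
  by 1.\<close>

text \<open>The short intervals on which \<open>G\<close> has slope at most \<open>p\<close> form a
  Vitali cover of \<open>A\<close>. A disjoint subfamily exhausts \<open>A\<close> up to a null set,
  which the Lipschitz map sends to a null set. Each chosen interval has an image of length at most
  \<open>p\<close> times its own, and all of them lie in an open set hardly larger than
  \<open>A\<close>.\<close>

lemma emeasure_image_le_slope:
  fixes G :: "real \<Rightarrow> real"
  assumes mono: "strict_mono G" and lip: "C-lipschitz_on UNIV G" and p: "0 \<le> p"
    and A: "A \<in> sets lebesgue" and GA: "G ` A \<in> sets lebesgue"
    and slope: "\<And>x d. x \<in> A \<Longrightarrow> 0 < d \<Longrightarrow> \<exists>y. y \<noteq> x \<and> \<bar>y - x\<bar> < d \<and> \<bar>G y - G x\<bar> \<le> p * \<bar>y - x\<bar>"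
  shows "emeasure lebesgue (G ` A) \<le> ennreal p * emeasure lebesgue A"
proof -
  have cont: "continuous_on S G" for S
    using lip lipschitz_on_continuous_on lipschitz_on_subset by blast
  have key: "emeasure lebesgue (G ` A) \<le> ennreal p * (emeasure lebesgue A + ennreal e)" if "e > 0" for e :: real
  proof -
    obtain U where U: "open U" "A \<subseteq> U" "U - A \<in> lmeasurable" "emeasure lebesgue (U - A) < ennreal e"
      using sets_lebesgue_outer_open[OF A \<open>e > 0\<close>] by blast
    \<comment> \<open>Intervals are encoded by their endpoints; \<open>a\<close> and
      \<open>r\<close> turn them into midpoint and radius because the covering theorem speaks of
      balls.\<close>
    define K where "K = {(x, y). x < y \<and> {x..y} \<subseteq> U \<and> G y - G x \<le> p * (y - x)}"
    define a :: "real \<times> real \<Rightarrow> real" where "a = (\<lambda>(x, y). (x + y) / 2)"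
    define r :: "real \<times> real \<Rightarrow> real" where "r = (\<lambda>(x, y). (y - x) / 2)"
    have cb: "cball (a i) (r i) = {fst i..snd i}" for i
      by (auto simp: a_def r_def cball_eq_atLeastAtMost split: prod.split) (simp_all add: field_simps)
    have "\<exists>i. i \<in> K \<and> x \<in> cball (a i) (r i) \<and> r i < d" if xA: "x \<in> A" and "d > 0" for x d
    proof -
      obtain e' where e': "e' > 0" "ball x e' \<subseteq> U"
        using U xA openE by blast
      obtain y where y: "y \<noteq> x" "\<bar>y - x\<bar> < min d e'" "\<bar>G y - G x\<bar> \<le> p * \<bar>y - x\<bar>"
        using slope[OF xA, of "min d e'"] \<open>d > 0\<close> e' by auto
      have sub: "{min x y..max x y} \<subseteq> U"
        using e'(2) y(2) by (auto simp: subset_eq dist_real_def)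
      have G: "G (max x y) - G (min x y) \<le> p * (max x y - min x y)"
        using y(3) by (auto simp: max_def min_def abs_if split: if_splits)
      have "(min x y, max x y) \<in> K"
        using sub G y(1) by (auto simp: K_def)
      moreover have "x \<in> cball (a (min x y, max x y)) (r (min x y, max x y))"
        by (simp add: cb)
      moreover have "r (min x y, max x y) < d"
        using y(2) by (auto simp: r_def)
      ultimately show ?thesis by blast
    qed
    note cov = this
    have rpos: "0 < r i" if "i \<in> K" for i
      using that by (auto simp: K_def r_def)
    obtain D where D: "countable D" "D \<subseteq> K"
      "pairwise (\<lambda>i j. disjnt (cball (a i) (r i)) (cball (a j) (r j))) D"
      "negligible (A - (\<Union>i \<in> D. cball (a i) (r i)))"
      by (rule Vitali_covering_theorem_cballs[of K r A a, OF rpos cov]) blast+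
    define I where "I i = {fst i..snd i}" for i :: "real \<times> real"
    have Idisj: "disjoint_family_on I D"
      using D(3) unfolding pairwise_def disjoint_family_on_def disjnt_def cb I_def by blast
    have GI: "G ` I i \<in> sets borel" for i
      by (intro borel_closed compact_imp_closed compact_continuous_image cont) (simp add: I_def)
    have GIdisj: "disjoint_family_on (\<lambda>i. G ` I i) D"
      using Idisj strict_mono_imp_inj_on[OF mono]
      unfolding disjoint_family_on_def by (metis image_Int image_empty)
    define N where "N = A - (\<Union>i \<in> D. I i)"
    have N: "negligible N"
      using D(4) by (simp add: N_def I_def cb)
    have GN: "negligible (G ` N)"
    proof (rule negligible_locally_Lipschitz_image[OF _ N])
      show "\<exists>T B. open T \<and> x \<in> T \<and> (\<forall>y\<in>N \<inter> T. norm (G y - G x) \<le> B * norm (y - x))" for x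
        using lipschitz_onD[OF lip] by (intro exI[of _ UNIV] exI[of _ C]) (auto simp: dist_norm)
    qed simp
    have GIl: "G ` I i \<in> sets lebesgue" for i
      using GI by simp
    have meas: "(\<Union>i\<in>D. G ` I i) \<in> sets lebesgue" "G ` N \<in> sets lebesgue"
      using sets.countable_UN'[OF D(1), of "\<lambda>i. G ` I i" lebesgue] GIl GN
      by (simp_all add: negligible_iff_null_sets null_setsD2 image_subset_iff)
    have "A \<subseteq> (\<Union>i\<in>D. I i) \<union> N"
      unfolding N_def by blast
    then have "G ` A \<subseteq> (\<Union>i\<in>D. G ` I i) \<union> G ` N"
      by blast
    then have "emeasure lebesgue (G ` A) \<le> emeasure lebesgue ((\<Union>i\<in>D. G ` I i) \<union> G ` N)"
      by (rule emeasure_mono) (intro sets.Un meas)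
    also have "\<dots> \<le> emeasure lebesgue (\<Union>i\<in>D. G ` I i) + emeasure lebesgue (G ` N)"
      by (rule emeasure_subadditive[OF meas])
    also have "emeasure lebesgue (G ` N) = 0"
      using GN by (auto simp: negligible_iff_null_sets)
    also have "emeasure lebesgue (\<Union>i\<in>D. G ` I i) = (\<integral>\<^sup>+i. emeasure lebesgue (G ` I i) \<partial>count_space D)"
      by (rule emeasure_UN_countable[OF GIl D(1) GIdisj])
    also have "\<dots> \<le> (\<integral>\<^sup>+i. ennreal p * emeasure lebesgue (I i) \<partial>count_space D)"
    proof (rule nn_integral_mono)
      fix i assume "i \<in> space (count_space D)"
      then have i: "fst i < snd i" "G (snd i) - G (fst i) \<le> p * (snd i - fst i)"
        using D(2) by (auto simp: K_def)
      have "emeasure lebesgue (G ` I i) \<le> emeasure lebesgue {G (fst i)..G (snd i)}"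
        using mono by (intro emeasure_mono) (auto simp: I_def strict_mono_less_eq)
      also have "\<dots> = ennreal (G (snd i) - G (fst i))"
        using mono i(1) by (simp add: strict_mono_less_eq)
      also have "\<dots> \<le> ennreal (p * (snd i - fst i))"
        using i(2) by (rule ennreal_leI)
      also have "\<dots> = ennreal p * emeasure lebesgue (I i)"
        using i(1) p by (simp add: I_def ennreal_mult)
      finally show "emeasure lebesgue (G ` I i) \<le> ennreal p * emeasure lebesgue (I i)" .
    qed
    also have "\<dots> = ennreal p * (\<integral>\<^sup>+i. emeasure lebesgue (I i) \<partial>count_space D)"
      by (rule nn_integral_cmult) simp
    also have "(\<integral>\<^sup>+i. emeasure lebesgue (I i) \<partial>count_space D) = emeasure lebesgue (\<Union>i\<in>D. I i)"
      by (rule emeasure_UN_countable[OF _ D(1) Idisj, symmetric]) (simp add: I_def)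
    also have "ennreal p * \<dots> \<le> ennreal p * emeasure lebesgue U"
    proof (intro mult_left_mono emeasure_mono)
      show "(\<Union>i\<in>D. I i) \<subseteq> U"
        using D(2) by (force simp: K_def I_def)
    qed (use U(1) in auto)
    also have "emeasure lebesgue U = emeasure lebesgue A + emeasure lebesgue (U - A)"
    proof -
      have "emeasure lebesgue A + emeasure lebesgue (U - A) = emeasure lebesgue (A \<union> (U - A))"
        using U(3) A by (intro plus_emeasure) (auto simp: fmeasurableD)
      moreover have "A \<union> (U - A) = U" using U(2) by blast
      ultimately show ?thesis by (simp only:)
    qed
    also have "ennreal p * \<dots> \<le> ennreal p * (emeasure lebesgue A + ennreal e)"
      using U(4) by (intro mult_left_mono add_left_mono) auto
    finally show ?thesis by simp
  qed
  show ?thesis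
  proof (rule ennreal_le_epsilon)
    fix e :: real assume "e > 0"
    \<comment> \<open>The denominator \<open>p + 1\<close> also covers the case where
      \<open>p\<close> is 0.\<close>
    have "ennreal p * ennreal (e / (p + 1)) \<le> ennreal e"
      using p \<open>e > 0\<close> by (simp add: ennreal_mult[symmetric] field_simps)
    moreover have "emeasure lebesgue (G ` A) \<le> ennreal p * (emeasure lebesgue A + ennreal (e / (p + 1)))"
      using key[of "e / (p + 1)"] p \<open>e > 0\<close> by simp
    ultimately show "emeasure lebesgue (G ` A) \<le> ennreal p * emeasure lebesgue A + ennreal e"
      by (metis (no_types, lifting) add_left_mono distrib_left order_trans)
  qed
qed

text \<open>This is a condition on a two-sided upper Dini derivative, phrased by frequency so that
  no limes superior has to be formed. Applied to \<open>- f\<close> and \<open>- p\<close> it says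
  that the quotients of \<open>f\<close> are frequently below \<open>p\<close>. If a Lipschitz
  \<open>f\<close> has no derivative at x along \<open>v\<close>, then x lies in both sets for some
  rationals p < q.\<close>

definition freq_slope_gt :: "('a::real_normed_vector \<Rightarrow> real) \<Rightarrow> 'a \<Rightarrow> real \<Rightarrow> 'a set" where
  "freq_slope_gt f v q = {x. \<forall>d>0. \<exists>t. t \<noteq> 0 \<and> \<bar>t\<bar> < d \<and> (f (x + t *\<^sub>R v) - f x) / t > q}"

text \<open>For a fixed step \<open>t\<close> the condition is open in x, and an uncountable union
  over small \<open>t\<close> stays open; the set is thus a countable intersection of open
  sets.\<close>

lemma borel_freq_slope_gt:
  fixes f :: "'a::real_normed_vector \<Rightarrow> real"
  assumes cont: "continuous_on UNIV f"
  shows "freq_slope_gt f v q \<in> sets borel"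
proof -
  define T where "T n = {t::real. t \<noteq> 0 \<and> \<bar>t\<bar> < inverse (Suc n)}" for n
  define S where "S n = (\<Union>t\<in>T n. {x. (f (x + t *\<^sub>R v) - f x) / t > q})" for n
  have "open {x. (f (x + t *\<^sub>R v) - f x) / t > q}" for t
    by (rule open_Collect_less)
      (cases "t = 0"; auto intro!: continuous_intros continuous_on_compose2[OF cont])+
  then have "open (S n)" for n
    unfolding S_def by blast
  moreover have "freq_slope_gt f v q = (\<Inter>n. S n)"
  proof (intro equalityI subsetI)
    fix x assume x: "x \<in> (\<Inter>n. S n)"
    show "x \<in> freq_slope_gt f v q"
      unfolding freq_slope_gt_def
    proof (intro CollectI allI impI)
      fix d :: real assume "d > 0"
      then obtain n where "inverse (Suc n) < d"
        using reals_Archimedean by blast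
      moreover have "x \<in> S n" using x by blast
      ultimately show "\<exists>t. t \<noteq> 0 \<and> \<bar>t\<bar> < d \<and> (f (x + t *\<^sub>R v) - f x) / t > q"
        unfolding S_def T_def by force
    qed
  qed (auto simp: freq_slope_gt_def S_def T_def)
  ultimately show ?thesis by auto
qed

lemma negligible_freq_slopes_real:
  fixes g :: "real \<Rightarrow> real"
  assumes lip: "L-lipschitz_on UNIV g" and "p < q"
  shows "negligible (freq_slope_gt g 1 q \<inter> freq_slope_gt (\<lambda>x. - g x) 1 (- p))"
    (is "negligible ?A")
proof -
  have contg: "continuous_on UNIV g"
    using lip by (rule lipschitz_on_continuous_on)
  have L: "L \<ge> 0" using lip by (rule lipschitz_on_nonneg)
  have gL: "\<bar>g x - g y\<bar> \<le> L * \<bar>x - y\<bar>" for x y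
    using lipschitz_onD[OF lip, of x y] by (simp add: dist_real_def)
  \<comment> \<open>The added slope \<open>L + 1\<close> outweighs the Lipschitz constant by 1, so
    \<open>G\<close> expands distances. It is a strictly increasing bijection with a 1-Lipschitz
    inverse, and all slopes are shifted by the same amount.\<close>
  define G where "G t = g t + (L + 1) * t" for t
  have Ginc: "y - x \<le> G y - G x" if "x \<le> y" for x y
    using gL[of y x] that by (simp add: G_def algebra_simps)
  have Gabs: "\<bar>y - x\<bar> \<le> \<bar>G y - G x\<bar>" for x y
    using Ginc[of x y] Ginc[of y x] by linarith
  have Glip': "\<bar>G y - G x\<bar> \<le> (2 * L + 1) * \<bar>y - x\<bar>" for x y
  proof -
    have "\<bar>G y - G x\<bar> = \<bar>(g y - g x) + (L + 1) * (y - x)\<bar>"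
      by (simp add: G_def algebra_simps)
    also have "\<dots> \<le> L * \<bar>y - x\<bar> + (L + 1) * \<bar>y - x\<bar>"
      using gL[of y x] L by (intro order_trans[OF abs_triangle_ineq] add_mono) (auto simp: abs_mult)
    finally show ?thesis by (simp add: algebra_simps)
  qed
  have mono: "strict_mono G"
    unfolding strict_mono_def using Ginc by (smt (verit))
  have Glip: "(2 * L + 1)-lipschitz_on UNIV G"
    using Glip' L by (intro lipschitz_onI) (auto simp: dist_real_def)
  have contG: "continuous_on UNIV G"
    using Glip by (rule lipschitz_on_continuous_on)
  have surj: "surj G"
    unfolding surj_def
  proof
    fix y
    define b where "b = \<bar>y - G 0\<bar>"
    have "G (- b) \<le> y" "y \<le> G b"
      using Ginc[of "-b" 0] Ginc[of 0 b] by (auto simp: b_def)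
    then show "\<exists>x. y = G x"
      using IVT'[of G "-b" y b] contG by (auto simp: b_def intro: continuous_on_subset)
  qed
  define H where "H = inv G"
  have GH [simp]: "G (H y) = y" for y
    unfolding H_def using surj by (rule surj_f_inv_f)
  have HG [simp]: "H (G x) = x" for x
    unfolding H_def using strict_mono_imp_inj_on[OF mono] by (rule inv_f_f)
  have Hmono: "strict_mono H"
    unfolding strict_mono_def using mono by (metis GH strict_mono_less)
  have Hlip: "1-lipschitz_on UNIV H"
    using Gabs[of "H x" "H y" for x y] by (intro lipschitz_onI) (auto simp: dist_real_def abs_minus_commute)
  have contH: "continuous_on UNIV H"
    using Hlip by (rule lipschitz_on_continuous_on)
  define p' where "p' = p + (L + 1)"
  define q' where "q' = q + (L + 1)"
  have slope: "(G (x + t) - G x) / t = (g (x + t) - g x) / t + (L + 1)" if "t \<noteq> 0" for x t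
    using that by (simp add: G_def field_simps)
  have low: "\<exists>y. y \<noteq> x \<and> \<bar>y - x\<bar> < d \<and> \<bar>G y - G x\<bar> \<le> p' * \<bar>y - x\<bar>" if xd: "x \<in> ?A" "d > 0" for x d
  proof -
    obtain t where t: "t \<noteq> 0" "\<bar>t\<bar> < d" "(- g (x + t) - - g x) / t > - p"
      using xd unfolding freq_slope_gt_def by auto
    have "(- g (x + t) - - g x) / t = - ((g (x + t) - g x) / t)"
      by (simp add: divide_simps)
    with t have t: "t \<noteq> 0" "\<bar>t\<bar> < d" "(g (x + t) - g x) / t < p"
      by linarith+
    have "(G (x + t) - G x) / t \<ge> 0"
      using t(1) mono by (cases "t > 0") (auto simp: strict_mono_less_eq zero_le_divide_iff)
    then have "\<bar>G (x + t) - G x\<bar> = (G (x + t) - G x) / t * \<bar>t\<bar>"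
      using t(1) by (metis abs_divide abs_of_nonneg abs_zero nonzero_divide_eq_eq abs_0_eq)
    also have "\<dots> \<le> p' * \<bar>t\<bar>"
      using t slope[OF t(1)] by (intro mult_right_mono) (auto simp: p'_def)
    finally show ?thesis using t by (intro exI[of _ "x + t"]) auto
  qed
  have high: "\<exists>y. y \<noteq> x \<and> \<bar>y - x\<bar> < d \<and> q' * \<bar>y - x\<bar> \<le> \<bar>G y - G x\<bar>" if xd: "x \<in> ?A" "d > 0" for x d
  proof -
    obtain t where t: "t \<noteq> 0" "\<bar>t\<bar> < d" "(g (x + t) - g x) / t > q"
      using xd unfolding freq_slope_gt_def by auto
    have "q' * \<bar>t\<bar> \<le> \<bar>(G (x + t) - G x) / t\<bar> * \<bar>t\<bar>"
      using t slope[OF t(1)] by (intro mult_right_mono) (auto simp: q'_def)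
    also have "\<dots> = \<bar>G (x + t) - G x\<bar>"
      using t(1) by (simp add: abs_divide)
    finally show ?thesis using t by (intro exI[of _ "x + t"]) auto
  qed
  have "negligible (?A \<inter> cbox a b)" for a b
  \<comment> \<open>A point of the set supplies a pair with slope at most p', while every slope of
    \<open>G\<close> is at least 1; hence p' is positive and division by q' is legitimate.\<close>
  proof (cases "?A = {}")
    case False
    then obtain x where "x \<in> ?A" by blast
    then obtain y where "y \<noteq> x" "\<bar>G y - G x\<bar> \<le> p' * \<bar>y - x\<bar>"
      using low[of x 1] by auto
    then have "0 < p' * \<bar>y - x\<bar>"
      using Gabs[of y x] by auto
    then have "p' > 0"
      using \<open>y \<noteq> x\<close> by (simp add: zero_less_mult_iff)
    moreover have "p' < q'" using \<open>p < q\<close> by (simp add: p'_def q'_def)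
    ultimately have "q' > 0" by simp
    define B where "B = ?A \<inter> cbox a b"
    have Bb: "B \<in> sets borel"
      unfolding B_def
      by (intro sets.Int borel_freq_slope_gt) (auto intro!: contg continuous_intros)
    have GBeq: "G ` B = H -` B"
      by (auto simp: image_iff) (metis GH)
    have GBb: "G ` B \<in> sets borel"
      using measurable_sets[OF borel_measurable_continuous_onI[OF contH] Bb] by (simp add: GBeq)
    have HGB: "H ` (G ` B) = B"
      by (simp add: image_image)
    have 1: "emeasure lebesgue (G ` B) \<le> ennreal p' * emeasure lebesgue B"
      using low \<open>p' > 0\<close> Bb GBb
      by (intro emeasure_image_le_slope[OF mono Glip]) (auto simp: B_def)
    have 2: "emeasure lebesgue (H ` (G ` B)) \<le> ennreal (1 / q') * emeasure lebesgue (G ` B)"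
    proof (intro emeasure_image_le_slope[OF Hmono Hlip])
      fix y d :: real assume "y \<in> G ` B" "0 < d"
      then obtain x where x: "x \<in> ?A" "y = G x" by (auto simp: B_def)
      have "d / (2 * L + 1) > 0" using \<open>0 < d\<close> L by simp
      from high[OF x(1) this] obtain x' where x': "x' \<noteq> x" "\<bar>x' - x\<bar> < d / (2 * L + 1)"
        "q' * \<bar>x' - x\<bar> \<le> \<bar>G x' - G x\<bar>" by blast
      have "\<bar>G x' - G x\<bar> < d"
        using Glip'[of x' x] x'(2) L by (simp add: field_simps)
      moreover have "G x' \<noteq> G x" using x'(1) HG by metis
      moreover have "\<bar>x' - x\<bar> \<le> 1 / q' * \<bar>G x' - G x\<bar>"
        using x'(3) \<open>q' > 0\<close> by (simp add: field_simps)
      ultimately show "\<exists>z. z \<noteq> y \<and> \<bar>z - y\<bar> < d \<and> \<bar>H z - H y\<bar> \<le> 1 / q' * \<bar>z - y\<bar>"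
        using x(2) by (intro exI[of _ "G x'"]) auto
    qed (use \<open>q' > 0\<close> Bb GBb HGB in auto)
    have lm: "B \<in> lmeasurable"
      using Bb by (intro bounded_set_imp_lmeasurable bounded_subset[OF bounded_cbox[of a b]]) (auto simp: B_def)
    define m where "m = measure lebesgue B"
    have em: "emeasure lebesgue B = ennreal m"
      using lm by (simp add: m_def emeasure_eq_measure2)
    have "m \<ge> 0" by (simp add: m_def)
    have "ennreal m \<le> ennreal (1 / q') * (ennreal p' * ennreal m)"
      using 2 1 unfolding HGB em by (meson mult_left_mono order_trans zero_le)
    also have "\<dots> = ennreal (p' / q' * m)"
      using \<open>q' > 0\<close> \<open>p' > 0\<close> \<open>m \<ge> 0\<close> by (simp add: ennreal_mult[symmetric])
    finally have "m \<le> p' / q' * m"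
      using \<open>q' > 0\<close> \<open>p' > 0\<close> \<open>m \<ge> 0\<close> by (subst (asm) ennreal_le_iff) auto
    then have "(q' - p') * m \<le> 0"
      using \<open>q' > 0\<close> by (simp add: field_simps)
    then have "m = 0"
      using \<open>p' < q'\<close> \<open>m \<ge> 0\<close> by (auto simp: mult_le_0_iff)
    then show ?thesis
      using lm unfolding B_def[symmetric] m_def by (simp only: negligible_iff_measure)
  qed simp
  then show ?thesis
    by (subst negligible_on_intervals) blast
qed

section \<open>Directional derivatives almost everywhere\<close>

text \<open>Each line in direction \<open>v\<close> meets the set in a null set by the
  one-dimensional case. Translation invariance and Fubini then apply without choosing coordinates
  adapted to \<open>v\<close>.\<close>

lemma null_freq_slopes:
  fixes f :: "'a::euclidean_space \<Rightarrow> real"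
  assumes lip: "L-lipschitz_on UNIV f" and "p < q"
  shows "freq_slope_gt f v q \<inter> freq_slope_gt (\<lambda>x. - f x) v (- p) \<in> null_sets lborel"
proof -
  define A where "A = freq_slope_gt f v q \<inter> freq_slope_gt (\<lambda>x. - f x) v (- p)"
  have contf: "continuous_on UNIV f"
    using lip by (rule lipschitz_on_continuous_on)
  have A [measurable]: "A \<in> sets borel"
    unfolding A_def by (intro sets.Int borel_freq_slope_gt) (auto intro!: contf continuous_intros)
  have line: "emeasure lborel {t. x + t *\<^sub>R v \<in> A} = 0" for x
  proof -
    define g where "g t = f (x + t *\<^sub>R v)" for t
    have "(L * norm v)-lipschitz_on UNIV g"
    proof (rule lipschitz_onI)
      show "dist (g s) (g t) \<le> L * norm v * dist s t" for s t
        using lipschitz_onD[OF lip, of "x + s *\<^sub>R v" "x + t *\<^sub>R v"]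
        by (simp add: g_def dist_norm scaleR_diff_left[symmetric] mult_ac)
    qed (use lipschitz_on_nonneg[OF lip] in auto)
    from negligible_freq_slopes_real[OF this \<open>p < q\<close>]
    have "negligible (freq_slope_gt g 1 q \<inter> freq_slope_gt (\<lambda>x. - g x) 1 (- p))" .
    also have "freq_slope_gt g 1 q \<inter> freq_slope_gt (\<lambda>x. - g x) 1 (- p) = {t. x + t *\<^sub>R v \<in> A}"
      by (auto simp: A_def freq_slope_gt_def g_def scaleR_add_left add.assoc)
    finally have "{t. x + t *\<^sub>R v \<in> A} \<in> null_sets lebesgue"
      by (simp add: negligible_iff_null_sets)
    then show ?thesis by (simp add: null_sets_def)
  qed
  \<comment> \<open>The unit interval has length 1, so the measure of \<open>A\<close> can be
    written as an average over its translates by t v, 0 <= t <= 1. Exchanging the integrals leaves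
    measures of line sections.\<close>
  have "emeasure lborel A = (\<integral>\<^sup>+t. emeasure lborel A * indicator {0..1::real} t \<partial>lborel)"
    by (simp add: nn_integral_cmult)
  also have "\<dots> = (\<integral>\<^sup>+t. (\<integral>\<^sup>+x. indicator A (x + t *\<^sub>R v) * indicator {0..1::real} t \<partial>lborel) \<partial>lborel)"
  proof (rule nn_integral_cong)
    fix t :: real
    have "(\<integral>\<^sup>+x. indicator A (x + t *\<^sub>R v) \<partial>lborel) = (\<integral>\<^sup>+x. indicator A x \<partial>distr lborel borel ((+) (t *\<^sub>R v)))"
      by (subst nn_integral_distr) (auto simp: add.commute)
    also have "\<dots> = emeasure lborel A"
      by (simp add: lborel_distr_plus)
    finally show "emeasure lborel A * indicator {0..1::real} t = (\<integral>\<^sup>+x. indicator A (x + t *\<^sub>R v) * indicator {0..1::real} t \<partial>lborel)"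
      by (subst nn_integral_multc) auto
  qed
  also have "\<dots> = (\<integral>\<^sup>+x. (\<integral>\<^sup>+t. indicator A (x + t *\<^sub>R v) * indicator {0..1::real} t \<partial>lborel) \<partial>lborel)"
    by (rule lborel_pair.Fubini') measurable
  also have "\<dots> = (\<integral>\<^sup>+x. 0 \<partial>(lborel :: 'a measure))"
  proof (rule nn_integral_cong)
    fix x
    have "(\<integral>\<^sup>+t. indicator A (x + t *\<^sub>R v) * indicator {0..1::real} t \<partial>lborel)
        \<le> (\<integral>\<^sup>+t. indicator {t. x + t *\<^sub>R v \<in> A} t \<partial>lborel)"
      by (intro nn_integral_mono) (auto split: split_indicator)
    also have "\<dots> = emeasure lborel {t. x + t *\<^sub>R v \<in> A}"
      by (intro nn_integral_indicator) measurable
    finally show "(\<integral>\<^sup>+t. indicator A (x + t *\<^sub>R v) * indicator {0..1::real} t \<partial>lborel) = 0"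
      by (simp add: line)
  qed
  finally show ?thesis
    unfolding A_def[symmetric] by (simp add: null_sets_def)
qed

definition dir_quot :: "('a::real_normed_vector \<Rightarrow> real) \<Rightarrow> 'a \<Rightarrow> 'a \<Rightarrow> real \<Rightarrow> real" where
  "dir_quot f x v t = (f (x + t *\<^sub>R v) - f x) / t"

lemma abs_dir_quot_le:
  assumes lip: "L-lipschitz_on UNIV f"
  shows "\<bar>dir_quot f x v t\<bar> \<le> L * norm v"
proof (cases "t = 0")
  case False
  have "\<bar>f (x + t *\<^sub>R v) - f x\<bar> \<le> L * norm v * \<bar>t\<bar>"
    using lipschitz_onD[OF lip, of "x + t *\<^sub>R v" x] by (simp add: dist_norm algebra_simps)
  with False show ?thesis by (simp add: dir_quot_def field_simps)
qed (use lipschitz_on_nonneg[OF lip] in \<open>simp add: dir_quot_def\<close>)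

lemma freq_slope_gt_iff: "x \<in> freq_slope_gt f v q \<longleftrightarrow> (\<exists>\<^sub>F t in at 0. dir_quot f x v t > q)"
  by (auto simp: freq_slope_gt_def frequently_def eventually_at dir_quot_def)

lemma freq_slope_gt_minus_iff: 
  "x \<in> freq_slope_gt (\<lambda>x. - f x) v (- p) \<longleftrightarrow> (\<exists>\<^sub>F t in at 0. dir_quot f x v t < p)"
proof -
  have "dir_quot (\<lambda>x. - f x) x v t = - dir_quot f x v t" for t
    by (simp add: dir_quot_def divide_simps)
  then show ?thesis by (simp add: freq_slope_gt_iff)
qed

text \<open>The limit is the limes superior, written as \<open>Sup Q\<close> and finite by the
  Lipschitz bound. The hypothesis forbids the quotients from dropping frequently below a rational p'
  once they frequently exceed some rational q' > p'.\<close>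

lemma dir_quot_tendsto:
  fixes f :: "'a::real_normed_vector \<Rightarrow> real"
  assumes lip: "L-lipschitz_on UNIV f"
    and x: "\<And>p q. p \<in> \<rat> \<Longrightarrow> q \<in> \<rat> \<Longrightarrow> p < q \<Longrightarrow>
      x \<notin> freq_slope_gt f v q \<inter> freq_slope_gt (\<lambda>x. - f x) v (- p)"
  shows "\<exists>l. (dir_quot f x v \<longlongrightarrow> l) (at 0)"
proof -
  define F where "F = dir_quot f x v"
  define Q where "Q = {q. \<exists>\<^sub>F t in at 0. F t > q}"
  define M where "M = L * norm v"
  have FM: "\<bar>F t\<bar> \<le> M" for t
    unfolding F_def M_def using lip by (rule abs_dir_quot_le)
  have "- M - 1 < F t" for t
    using FM[of t] by linarith
  then have "- M - 1 \<in> Q"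
    by (auto simp: Q_def intro!: eventually_frequently)
  have Qb: "q \<le> M" if q: "q \<in> Q" for q
  proof (rule ccontr)
    assume "\<not> q \<le> M"
    then have "\<not> F t > q" for t using FM[of t] by linarith
    with q show False by (simp add: Q_def)
  qed
  then have bdd: "bdd_above Q" by (rule bdd_aboveI)
  have "(F \<longlongrightarrow> Sup Q) (at 0)"
  proof (rule tendstoI)
    fix e :: real assume "e > 0"
    have "Sup Q + e / 2 \<notin> Q"
      using cSup_upper[OF _ bdd, of "Sup Q + e / 2"] \<open>e > 0\<close> by auto
    then have up: "\<forall>\<^sub>F t in at 0. \<not> F t > Sup Q + e / 2"
      by (simp add: Q_def frequently_def)
    obtain q where q: "q \<in> Q" "q > Sup Q - e / 4"
      using less_cSup_iff[OF _ bdd, of "Sup Q - e / 4"] \<open>- M - 1 \<in> Q\<close> \<open>e > 0\<close> by auto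
    \<comment> \<open>Two rationals are placed just below \<open>Sup Q\<close>: \<open>q'\<close> is
      frequently exceeded, so the quotients are eventually at least \<open>p'\<close>, which is
      within e/2 of \<open>Sup Q\<close>.\<close>
    obtain p' where p': "p' \<in> \<rat>" "Sup Q - e / 2 < p'" "p' < Sup Q - e / 4"
      using Rats_dense_in_real[of "Sup Q - e / 2" "Sup Q - e / 4"] \<open>e > 0\<close> by auto
    obtain q' where q': "q' \<in> \<rat>" "p' < q'" "q' < Sup Q - e / 4"
      using Rats_dense_in_real[OF p'(3)] by auto
    have "\<exists>\<^sub>F t in at 0. F t > q'"
      using q(1) unfolding Q_def mem_Collect_eq
      by (rule frequently_elim1) (use q(2) q'(3) in linarith)
    then have "\<not> (\<exists>\<^sub>F t in at 0. F t < p')"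
      using x[OF p'(1) q'(1,2)] unfolding Int_iff freq_slope_gt_minus_iff
      unfolding freq_slope_gt_iff F_def by blast
    then have "\<forall>\<^sub>F t in at 0. \<not> F t < p'"
      by (simp add: frequently_def)
    with up show "\<forall>\<^sub>F t in at 0. dist (F t) (Sup Q) < e"
      by eventually_elim (use p'(2) \<open>e > 0\<close> in \<open>simp add: dist_real_def abs_if\<close>)
  qed
  then show ?thesis unfolding F_def by blast
qed

lemma AE_dir_quot_tendsto:
  fixes f :: "'a::euclidean_space \<Rightarrow> real"
  assumes lip: "L-lipschitz_on UNIV f"
  shows "AE x in lborel. \<exists>l. (dir_quot f x v \<longlongrightarrow> l) (at 0)"
proof -
  define N where "N = (\<Union>p\<in>\<rat>. \<Union>q\<in>{q\<in>\<rat>. p < q}. freq_slope_gt f v q \<inter> freq_slope_gt (\<lambda>x. - f x) v (- p))"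
  have "countable {q\<in>\<rat>. (p::real) < q}" for p
    by (rule countable_subset[OF _ countable_rat]) auto
  then have "N \<in> null_sets lborel"
    unfolding N_def using countable_rat null_freq_slopes[OF lip]
    by (intro null_sets_UN') auto
  then show ?thesis
  proof (rule AE_I')
    show "{x \<in> space lborel. \<not> (\<exists>l. (dir_quot f x v \<longlongrightarrow> l) (at 0))} \<subseteq> N"
    proof (intro subsetI CollectI, rule ccontr)
      fix x assume x: "x \<in> {x \<in> space lborel. \<not> (\<exists>l. (dir_quot f x v \<longlongrightarrow> l) (at 0))}" "x \<notin> N"
      have "\<exists>l. (dir_quot f x v \<longlongrightarrow> l) (at 0)"
        by (rule dir_quot_tendsto[OF lip]) (use x(2) in \<open>auto simp: N_def\<close>)
      with x(1) show False by simp
    qed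
  qed
qed

section \<open>Linearity of the directional derivative\<close>

lemma integral_lborel_translation:
  fixes f :: "'a::euclidean_space \<Rightarrow> real"
  assumes [measurable]: "f \<in> borel_measurable borel"
  shows "(\<integral>x. f (c + x) \<partial>lborel) = (\<integral>x. f x \<partial>lborel)"
proof -
  have "(\<integral>x. f x \<partial>lborel) = (\<integral>x. f x \<partial>distr lborel borel ((+) c))"
    by (simp add: lborel_distr_plus)
  also have "\<dots> = (\<integral>x. f (c + x) \<partial>lborel)"
    by (subst integral_distr) auto
  finally show ?thesis by simp
qed

lemma integrable_lborel_translation:
  fixes f :: "'a::euclidean_space \<Rightarrow> real"
  assumes "integrable lborel f"
  shows "integrable lborel (\<lambda>x. f (c + x))"
proof -
  have "integrable (distr lborel borel ((+) c)) f"
    using assms by (simp add: lborel_distr_plus)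
  then show ?thesis
    by (subst (asm) integrable_distr_eq) (use assms in auto)
qed

lemma integrable_indicator_compact:
  "compact B \<Longrightarrow> integrable lborel (indicator B :: 'a::euclidean_space \<Rightarrow> real)"
  using emeasure_compact_finite[of B] by (intro integrable_real_indicator) (auto simp: borel_compact)

text \<open>Pointwise convergence of the translated indicators may fail on the boundary of
  \<open>B\<close>. Their positive excess over the indicator of \<open>B\<close> does converge: it
  is 0 on \<open>B\<close>, and vanishes eventually off \<open>B\<close> since \<open>B\<close> is
  closed.\<close>

lemma compact_translation_tendsto:
  fixes B :: "'a::euclidean_space set" and s :: "nat \<Rightarrow> 'a"
  assumes B: "compact B" and s: "s \<longlonglongrightarrow> 0"
  shows "(\<lambda>k. \<integral>x. \<bar>indicator B (s k + x) - indicator B x\<bar> \<partial>lborel :: real) \<longlonglongrightarrow> 0"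
proof -
  have [measurable]: "B \<in> sets borel" using B by (rule borel_compact)
  define d where "d k x = (indicator B (s k + x) - indicator B x :: real)" for k x
  have i1: "integrable lborel (indicator B :: 'a \<Rightarrow> real)"
    using B by (rule integrable_indicator_compact)
  have i2: "integrable lborel (\<lambda>x. indicator B (s k + x) :: real)" for k
    using integrable_lborel_translation[OF i1] .
  have id: "integrable lborel (d k)" for k
    unfolding d_def using i1 i2 by (rule Bochner_Integration.integrable_diff[rotated])
  have zero: "(\<integral>x. d k x \<partial>lborel) = 0" for k
    unfolding d_def by (subst Bochner_Integration.integral_diff[OF i2 i1])
      (simp add: integral_lborel_translation[of "indicator B"])
  \<comment> \<open>The difference has integral 0, so its positive and negative parts have equal
    mass and only the well-behaved positive part must be estimated.\<close>
  have eq: "(\<integral>x. \<bar>d k x\<bar> \<partial>lborel) = 2 * (\<integral>x. max (d k x) 0 \<partial>lborel)" for k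
  proof -
    have im: "integrable lborel (\<lambda>x. max (d k x) 0)"
      using id by (intro integrable_max) auto
    have "(\<integral>x. \<bar>d k x\<bar> \<partial>lborel) = (\<integral>x. 2 * max (d k x) 0 - d k x \<partial>lborel)"
      by (intro Bochner_Integration.integral_cong) auto
    also have "\<dots> = 2 * (\<integral>x. max (d k x) 0 \<partial>lborel)"
      using im id zero by simp
    finally show ?thesis .
  qed
  obtain R where R: "\<And>x. x \<in> B \<Longrightarrow> norm x \<le> R"
    using compact_imp_bounded[OF B] by (auto simp: bounded_iff)
  obtain R' where R': "\<And>k. norm (s k) \<le> R'"
    using s convergent_imp_Bseq[of s] by (auto simp: convergent_def Bseq_def)
  define C where "C = cball (0::'a) (R + R')"
  have C: "compact C" by (simp add: C_def)
  have "(\<lambda>k. \<integral>x. max (d k x) 0 \<partial>lborel) \<longlonglongrightarrow> (\<integral>x. 0 \<partial>(lborel :: 'a measure))"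
  proof (rule integral_dominated_convergence[where w = "indicator C"])
    show "AE x in lborel. (\<lambda>k. max (d k x) 0) \<longlonglongrightarrow> 0"
    proof (rule AE_I2)
      fix x :: 'a
      show "(\<lambda>k. max (d k x) 0) \<longlonglongrightarrow> 0"
      proof (cases "x \<in> B")
        case True
        then show ?thesis by (auto simp: d_def max_def indicator_def)
      next
        case False
        have "(\<lambda>k. s k + x) \<longlonglongrightarrow> 0 + x"
          by (intro tendsto_intros s)
        then have "\<forall>\<^sub>F k in sequentially. s k + x \<in> - B"
          using False compact_imp_closed[OF B] by (intro topological_tendstoD) auto
        then have "\<forall>\<^sub>F k in sequentially. max (d k x) 0 = 0"
          by eventually_elim (auto simp: d_def)
        then show ?thesis by (rule tendsto_eventually)
      qed
    qed
    show "AE x in lborel. norm (max (d k x) 0) \<le> indicator C x" for k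
    proof (rule AE_I2)
      fix x :: 'a
      show "norm (max (d k x) 0) \<le> indicator C x"
      proof (cases "s k + x \<in> B")
        case True
        have "norm x \<le> norm (s k + x) + norm (s k)"
          using norm_triangle_ineq4[of "s k + x" "s k"] by simp
        also have "\<dots> \<le> R + R'"
          using True R R'[of k] by (intro add_mono) auto
        finally show ?thesis using True by (auto simp: C_def d_def indicator_def)
      qed (auto simp: d_def indicator_def)
    qed
    show "integrable lborel (indicator C :: 'a \<Rightarrow> real)"
      by (rule integrable_indicator_compact[OF C])
  qed (auto simp: d_def)
  then have "(\<lambda>k. 2 * (\<integral>x. max (d k x) 0 \<partial>lborel)) \<longlonglongrightarrow> 2 * 0"
    by (intro tendsto_mult_left) simp
  then show ?thesis
    by (simp add: eq[symmetric]) (simp add: d_def)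
qed

text \<open>The additivity defect at step s is an increment along s v of the bounded quotient in
  direction \<open>w\<close>. Tested against the indicator of a compact set, this increment is moved
  onto the indicator and tends to 0. The limit defect \<open>H\<close> thus integrates to 0 over
  every compact set and vanishes almost everywhere.\<close>

lemma AE_dir_quot_add:
  fixes f :: "'a::euclidean_space \<Rightarrow> real"
  assumes lip: "L-lipschitz_on UNIV f"
  shows "AE x in lborel. \<forall>a b c. (dir_quot f x v \<longlongrightarrow> a) (at 0) \<and> (dir_quot f x w \<longlongrightarrow> b) (at 0) \<and>
    (dir_quot f x (v + w) \<longlongrightarrow> c) (at 0) \<longrightarrow> c = a + b"
proof -
  define s where "s k = inverse (real (Suc k))" for k
  have s0: "s \<longlonglongrightarrow> 0" "s k \<noteq> 0" for k
    unfolding s_def using LIMSEQ_inverse_real_of_nat by auto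
  have contf: "continuous_on UNIV f"
    using lip by (rule lipschitz_on_continuous_on)
  have [measurable]: "f \<in> borel_measurable borel"
    using contf by (rule borel_measurable_continuous_onI)
  have mq [measurable]: "(\<lambda>x. dir_quot f x u (s k)) \<in> borel_measurable borel" for u k
    unfolding dir_quot_def by measurable
  define h where "h k x = dir_quot f x (v + w) (s k) - dir_quot f x v (s k) - dir_quot f x w (s k)" for k x
  \<comment> \<open>\<open>lim\<close> makes \<open>H\<close> measurable and defined everywhere; it
    is the true limit of the defects only almost everywhere.\<close>
  define H where "H x = lim (\<lambda>k. h k x)" for x
  have [measurable]: "h k \<in> borel_measurable borel" for k
    unfolding h_def by measurable
  have Hm [measurable]: "H \<in> borel_measurable borel"
    unfolding H_def by (intro borel_measurable_lim_metric) measurable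
  define M where "M = L * norm (v + w) + L * norm v + L * norm w"
  have hM: "\<bar>h k x\<bar> \<le> M" for k x
    using abs_dir_quot_le[OF lip, of x "v + w" "s k"] abs_dir_quot_le[OF lip, of x v "s k"]
      abs_dir_quot_le[OF lip, of x w "s k"]
    unfolding h_def M_def by linarith
  have hlim: "AE x in lborel. (\<lambda>k. h k x) \<longlonglongrightarrow> H x"
    using AE_dir_quot_tendsto[OF lip, of "v + w"] AE_dir_quot_tendsto[OF lip, of v]
      AE_dir_quot_tendsto[OF lip, of w]
  proof eventually_elim
    case (elim x)
    have seq: "convergent (\<lambda>k. dir_quot f x u (s k))"
      if ex: "\<exists>l. (dir_quot f x u \<longlongrightarrow> l) (at 0)" for u
    proof -
      obtain l where "(dir_quot f x u \<longlongrightarrow> l) (at 0)" using ex by blast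
      moreover have "filterlim s (at 0) sequentially"
        using s0 by (auto simp: filterlim_at)
      ultimately show ?thesis
        unfolding convergent_def by (blast intro: filterlim_compose)
    qed
    have "convergent (\<lambda>k. h k x)"
      unfolding h_def by (intro convergent_diff seq elim)
    then show ?case
      unfolding H_def by (rule convergent_LIMSEQ_iff[THEN iffD1])
  qed
  have int0: "(\<integral>x. indicator B x * H x \<partial>lborel) = 0" if B: "compact B" for B :: "'a set"
  proof -
    have [measurable]: "B \<in> sets borel" using B by (rule borel_compact)
    have iB: "integrable lborel (indicator B :: 'a \<Rightarrow> real)"
      using B by (rule integrable_indicator_compact)
    have "(\<lambda>k. \<integral>x. indicator B x * h k x \<partial>lborel) \<longlonglongrightarrow> (\<integral>x. indicator B x * H x \<partial>lborel)"
    proof (rule integral_dominated_convergence[where w = "\<lambda>x. M * indicator B x"])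
      show "integrable lborel (\<lambda>x. M * indicator B x)"
        using iB by simp
      show "AE x in lborel. (\<lambda>k. indicator B x * h k x) \<longlonglongrightarrow> indicator B x * H x"
        using hlim by eventually_elim (intro tendsto_intros)
      show "AE x in lborel. norm (indicator B x * h k x) \<le> M * indicator B x" for k
        using hM by (auto simp: indicator_def)
    qed auto
    moreover have "(\<lambda>k. \<integral>x. indicator B x * h k x \<partial>lborel) \<longlonglongrightarrow> 0"
    proof (rule tendsto_rabs_zero_cancel, rule tendsto_sandwich)
      define m where "m k = (\<integral>x. \<bar>indicator B (- s k *\<^sub>R v + x) - indicator B x\<bar> \<partial>lborel :: real)" for k
      define N where "N = L * norm w"
      show "\<forall>\<^sub>F k in sequentially. 0 \<le> \<bar>\<integral>x. indicator B x * h k x \<partial>lborel\<bar>"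
        by simp
      show "(\<lambda>_. 0::real) \<longlonglongrightarrow> 0" by simp
      have "(\<lambda>k. - s k *\<^sub>R v) \<longlonglongrightarrow> - 0 *\<^sub>R v"
        by (intro tendsto_intros s0)
      then have "m \<longlonglongrightarrow> 0"
        unfolding m_def using compact_translation_tendsto[OF B, of "\<lambda>k. - s k *\<^sub>R v"] by simp
      then have "(\<lambda>k. N * m k) \<longlonglongrightarrow> N * 0"
        by (intro tendsto_intros)
      then show "(\<lambda>k. N * m k) \<longlonglongrightarrow> 0" by simp
      show "\<forall>\<^sub>F k in sequentially. \<bar>\<integral>x. indicator B x * h k x \<partial>lborel\<bar> \<le> N * m k"
      proof (rule always_eventually, rule allI)
        fix k
        define \<phi> where "\<phi> x = dir_quot f x w (s k)" for x
        have [measurable]: "\<phi> \<in> borel_measurable borel"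
          unfolding \<phi>_def by measurable
        have \<phi>N: "\<bar>\<phi> x\<bar> \<le> N" for x
          unfolding \<phi>_def N_def using lip by (rule abs_dir_quot_le)
        have i\<phi>: "integrable lborel (\<lambda>x. g x * \<phi> x)" if "integrable lborel g" for g :: "'a \<Rightarrow> real"
          by (rule Bochner_Integration.integrable_bound[of lborel "\<lambda>x. N * g x"])
            (use that \<phi>N in \<open>auto simp: abs_mult mult.commute[of "\<bar>g _\<bar>"] intro!: AE_I2 mult_right_mono order_trans[OF \<phi>N abs_ge_self]\<close>)
        \<comment> \<open>The values of f at x cancel, and what remains is the quotient along
          \<open>w\<close> at the shifted base point minus the one at x.\<close>
        have h\<phi>: "h k x = \<phi> (s k *\<^sub>R v + x) - \<phi> x" for x
          using s0(2)[of k] by (simp add: h_def \<phi>_def dir_quot_def diff_divide_distrib scaleR_add_right add_ac)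
        have i1: "integrable lborel (\<lambda>x. indicator B (- s k *\<^sub>R v + x) * \<phi> x)"
          by (rule i\<phi>, rule integrable_lborel_translation, rule iB)
        have i2: "integrable lborel (\<lambda>x. indicator B x * \<phi> x)"
          by (rule i\<phi>, rule iB)
        have tr: "(\<integral>x. indicator B x * \<phi> (s k *\<^sub>R v + x) \<partial>lborel) = (\<integral>x. indicator B (- s k *\<^sub>R v + x) * \<phi> x \<partial>lborel)"
          using integral_lborel_translation[of "\<lambda>x. indicator B (- s k *\<^sub>R v + x) * \<phi> x" "s k *\<^sub>R v"] by simp
        have i3: "integrable lborel (\<lambda>x. indicator B x * \<phi> (s k *\<^sub>R v + x))"
          using integrable_lborel_translation[OF i1, of "s k *\<^sub>R v"] by simp
        have "(\<integral>x. indicator B x * h k x \<partial>lborel) = (\<integral>x. indicator B x * \<phi> (s k *\<^sub>R v + x) - indicator B x * \<phi> x \<partial>lborel)"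
          by (simp add: h\<phi> right_diff_distrib)
        also have "\<dots> = (\<integral>x. indicator B (- s k *\<^sub>R v + x) * \<phi> x \<partial>lborel) - (\<integral>x. indicator B x * \<phi> x \<partial>lborel)"
          by (subst Bochner_Integration.integral_diff[OF i3 i2]) (simp only: tr)
        also have "\<dots> = (\<integral>x. (indicator B (- s k *\<^sub>R v + x) - indicator B x) * \<phi> x \<partial>lborel)"
          by (subst Bochner_Integration.integral_diff[OF i1 i2, symmetric]) (simp add: left_diff_distrib)
        also have "\<bar>\<dots>\<bar> \<le> (\<integral>x. N * \<bar>indicator B (- s k *\<^sub>R v + x) - indicator B x\<bar> \<partial>lborel)"
        proof (rule integral_abs_bound[THEN order_trans], rule integral_mono)
          have id: "integrable lborel (\<lambda>x. indicator B (- s k *\<^sub>R v + x) - indicator B x :: real)"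
            by (intro Bochner_Integration.integrable_diff integrable_lborel_translation iB)
          then show "integrable lborel (\<lambda>x. N * \<bar>indicator B (- s k *\<^sub>R v + x) - indicator B x\<bar>)"
            by (intro integrable_mult_right integrable_abs)
          show "integrable lborel (\<lambda>x. \<bar>(indicator B (- s k *\<^sub>R v + x) - indicator B x) * \<phi> x\<bar>)"
            by (intro integrable_abs i\<phi> id)
          show "\<bar>(indicator B (- s k *\<^sub>R v + x) - indicator B x) * \<phi> x\<bar> \<le> N * \<bar>indicator B (- s k *\<^sub>R v + x) - indicator B x\<bar>" for x
            using \<phi>N[of x] by (simp add: abs_mult mult.commute mult_right_mono)
        qed
        also have "\<dots> = N * m k"
          by (simp add: m_def)
        finally show "\<bar>\<integral>x. indicator B x * h k x \<partial>lborel\<bar> \<le> N * m k" .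
      qed
    qed
    ultimately show ?thesis by (rule LIMSEQ_unique)
  qed
  \<comment> \<open>The factor \<open>c\<close> lets one argument exclude both signs of
    \<open>H\<close>; it is used with 1 and -1.\<close>
  have null: "{x. c * H x > 0} \<in> null_sets lborel" if "c \<noteq> 0" for c
  proof -
    have "negligible ({x. c * H x > 0} \<inter> cbox a b)" for a b
    proof (rule ccontr)
      define S where "S = {x. c * H x > 0} \<inter> cbox a b"
      have Sb: "S \<in> sets borel"
        unfolding S_def by measurable
      then have Sl: "S \<in> sets lebesgue" by simp
      assume "\<not> negligible ({x. c * H x > 0} \<inter> cbox a b)"
      then have pos: "emeasure lebesgue S \<noteq> 0"
        using Sl by (auto simp: S_def[symmetric] negligible_iff_null_sets null_sets_def)
      have "bounded S"
        using bounded_subset[OF bounded_cbox[of a b]] by (auto simp: S_def)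
      then have fin: "emeasure lebesgue S \<noteq> \<infinity>"
        using emeasure_bounded_finite[of S] Sb by simp
      \<comment> \<open>With the whole measure of \<open>S\<close> as tolerance, the closed set
        \<open>T\<close> inside \<open>S\<close> must have positive measure. On \<open>T\<close>,
        however, c H is positive with integral 0.\<close>
      define e where "e = enn2real (emeasure lebesgue S)"
      have e: "emeasure lebesgue S = ennreal e" "e > 0"
        using pos fin by (auto simp: e_def enn2real_positive_iff less_top zero_less_iff_neq_zero)
      obtain T where T: "closed T" "T \<subseteq> S" "S - T \<in> lmeasurable" "emeasure lebesgue (S - T) < ennreal e"
        using sets_lebesgue_inner_closed[OF Sl e(2)] by blast
      have T2: "compact T"
        using T(1,2) bounded_subset[OF bounded_cbox[of a b]] by (auto simp: S_def compact_eq_bounded_closed)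
      have [measurable]: "T \<in> sets borel" using T(1) by simp
      have "(\<integral>x. c * (indicator T x * H x) \<partial>lborel) = 0"
        using int0[OF T2] by simp
      moreover have "integrable lborel (\<lambda>x. c * (indicator T x * H x))"
      proof (rule Bochner_Integration.integrable_bound[of lborel "\<lambda>x. \<bar>c\<bar> * M * indicator T x"])
        show "integrable lborel (\<lambda>x. \<bar>c\<bar> * M * indicator T x)"
          using integrable_indicator_compact[OF T2] by simp
        show "AE x in lborel. norm (c * (indicator T x * H x)) \<le> norm (\<bar>c\<bar> * M * indicator T x)"
          using hlim
        proof eventually_elim
          case (elim x)
          have "\<bar>H x\<bar> \<le> M"
            using tendsto_rabs[OF elim] hM by (intro LIMSEQ_le_const2) auto
          then show ?case
            by (auto simp: indicator_def abs_mult intro!: mult_left_mono)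
        qed
      qed measurable
      moreover have "AE x in lborel. 0 \<le> c * (indicator T x * H x)"
        using T(2) by (auto simp: S_def indicator_def intro!: AE_I2)
      ultimately have "AE x in lborel. c * (indicator T x * H x) = 0"
        by (subst (asm) integral_nonneg_eq_0_iff_AE) auto
      then have "AE x in lborel. x \<notin> T"
        by eventually_elim (use T(2) in \<open>auto simp: S_def indicator_def\<close>)
      then have "emeasure lborel T = 0"
        by (subst (asm) AE_iff_measurable[of T]) auto
      then have "emeasure lebesgue T = 0" by simp
      moreover have "emeasure lebesgue S = emeasure lebesgue T + emeasure lebesgue (S - T)"
      proof -
        have "emeasure lebesgue T + emeasure lebesgue (S - T) = emeasure lebesgue (T \<union> (S - T))"
          using T(3) by (intro plus_emeasure) (auto simp: fmeasurableD)
        moreover have "T \<union> (S - T) = S" using T(2) by blast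
        ultimately show ?thesis by (simp only:)
      qed
      ultimately show False using T(4) e by simp
    qed
    then have "negligible {x. c * H x > 0}"
      by (subst negligible_on_intervals) blast
    moreover have "{x. c * H x > 0} \<in> sets borel" by measurable
    ultimately show ?thesis
      by (simp add: negligible_iff_null_sets null_sets_def)
  qed
  have "AE x in lborel. x \<notin> {x. 1 * H x > 0}" "AE x in lborel. x \<notin> {x. - 1 * H x > 0}"
    using AE_not_in[OF null[of 1]] AE_not_in[OF null[of "- 1"]] by simp_all
  with hlim show ?thesis
  proof eventually_elim
    case (elim x)
    have H0: "H x = 0" using elim(2,3) by simp
    show ?case
    proof (intro allI impI)
      fix a b c
      assume l: "(dir_quot f x v \<longlongrightarrow> a) (at 0) \<and> (dir_quot f x w \<longlongrightarrow> b) (at 0) \<and>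
        (dir_quot f x (v + w) \<longlongrightarrow> c) (at 0)"
      have "filterlim s (at 0) sequentially"
        using s0 by (auto simp: filterlim_at)
      then have "(\<lambda>k. h k x) \<longlonglongrightarrow> c - a - b"
        unfolding h_def using l by (intro tendsto_diff) (blast intro: filterlim_compose)+
      then have "c - a - b = 0"
        using elim(1) H0 LIMSEQ_unique by force
      then show "c = a + b" by simp
    qed
  qed
qed

lemma dir_quot_scaleR_tendsto:
  assumes "(dir_quot f x v \<longlongrightarrow> l) (at 0)"
  shows "(dir_quot f x (c *\<^sub>R v) \<longlongrightarrow> c * l) (at 0)"
proof (cases "c = 0")
  case True
  have "dir_quot f x 0 = (\<lambda>_. 0)" by (simp add: dir_quot_def fun_eq_iff)
  with True show ?thesis by simp
next
  case False
  have "filterlim (\<lambda>t. c * t) (at 0) (at (0::real))"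
    using False by (auto simp: filterlim_at eventually_at_filter intro!: tendsto_eq_intros)
  then have "((\<lambda>t. c * dir_quot f x v (c * t)) \<longlongrightarrow> c * l) (at 0)"
    by (intro tendsto_mult_left filterlim_compose[OF assms])
  moreover have "c * dir_quot f x v (c * t) = dir_quot f x (c *\<^sub>R v) t" for t
    using False by (simp add: dir_quot_def mult.commute[of c])
  ultimately show ?thesis by simp
qed

text \<open>Where a partial derivative is missing, \<open>Lim\<close> gives an unspecified value.
  For Lipschitz functions this concerns a null set only.\<close>

definition dir_grad :: "('a::euclidean_space \<Rightarrow> real) \<Rightarrow> 'a \<Rightarrow> 'a" where
  "dir_grad f x = (\<Sum>b\<in>Basis. Lim (at 0) (dir_quot f x b) *\<^sub>R b)"

text \<open>The direction is built up one coordinate at a time from homogeneity and almost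
  everywhere additivity, so only finitely many null sets are discarded.\<close>

lemma AE_dir_quot_tendsto_dir_grad:
  fixes f :: "'a::euclidean_space \<Rightarrow> real"
  assumes lip: "L-lipschitz_on UNIV f"
  shows "AE x in lborel. (dir_quot f x v \<longlongrightarrow> v \<bullet> dir_grad f x) (at 0)"
proof -
  define D where "D b x = Lim (at 0) (dir_quot f x b)" for b x
  have D: "AE x in lborel. (dir_quot f x b \<longlongrightarrow> D b x) (at 0)" for b
    using AE_dir_quot_tendsto[OF lip, of b]
    by eventually_elim (metis D_def tendsto_Lim at_neq_bot)
  have "AE x in lborel. (dir_quot f x (\<Sum>b\<in>S. (v \<bullet> b) *\<^sub>R b) \<longlongrightarrow> (\<Sum>b\<in>S. (v \<bullet> b) * D b x)) (at 0)"
    if "S \<subseteq> Basis" for S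
    using finite_subset[OF that finite_Basis]
  proof (induction S rule: finite_induct)
    case (insert b S)
    define w where "w = (\<Sum>b\<in>S. (v \<bullet> b) *\<^sub>R b)"
    show ?case
      using insert.IH D[of b] AE_dir_quot_add[OF lip, of "(v \<bullet> b) *\<^sub>R b" w]
        AE_dir_quot_tendsto[OF lip, of "(v \<bullet> b) *\<^sub>R b + w"]
    proof eventually_elim
      case (elim x)
      obtain l where l: "(dir_quot f x ((v \<bullet> b) *\<^sub>R b + w) \<longlongrightarrow> l) (at 0)"
        using elim(4) by blast
      have "l = (v \<bullet> b) * D b x + (\<Sum>b\<in>S. (v \<bullet> b) * D b x)"
        using elim(3) l dir_quot_scaleR_tendsto[OF elim(2), of "v \<bullet> b"] elim(1)
        unfolding w_def by blast
      then show ?case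
        using l insert.hyps by (simp add: w_def)
    qed
  qed (simp add: dir_quot_def)
  from this[of Basis] show ?thesis
    by (simp add: dir_grad_def D_def inner_sum_right mult.commute euclidean_representation)
qed

section \<open>From directional derivatives to differentiability\<close>

text \<open>The unit sphere is covered by finitely many small balls around directions in
  \<open>V\<close>, for which the convergence is uniform; the Lipschitz bound transfers it to all
  other directions.\<close>

lemma has_derivative_if_dense_dir:
  fixes f :: "'a::euclidean_space \<Rightarrow> real"
  assumes lip: "L-lipschitz_on UNIV f"
    and dense: "\<And>X. open X \<Longrightarrow> X \<noteq> {} \<Longrightarrow> \<exists>d\<in>V. d \<in> X"
    and lim: "\<And>v. v \<in> V \<Longrightarrow> (dir_quot f x v \<longlongrightarrow> v \<bullet> a) (at 0)"
  shows "(f has_derivative (\<lambda>v. v \<bullet> a)) (at x)"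
  unfolding has_derivative_at_alt
proof (intro conjI allI impI)
  show "bounded_linear (\<lambda>v. v \<bullet> a)" by (rule bounded_linear_inner_left)
  fix e :: real assume "e > 0"
  have L: "L \<ge> 0" using lip by (rule lipschitz_on_nonneg)
  \<comment> \<open>The three summands pay for replacing the direction inside \<open>f\<close>, for
    the error of the quotient, and for replacing the direction in the linear part.\<close>
  define \<eta> where "\<eta> = e / (L + 1 + norm a)"
  have \<eta>: "\<eta> > 0" "\<eta> * (L + 1 + norm a) = e"
    using \<open>e > 0\<close> L by (auto simp: \<eta>_def add_nonneg_pos add_pos_nonneg)
      (smt (verit) norm_ge_zero nonzero_divide_eq_eq)
  have cover: "sphere 0 1 \<subseteq> (\<Union>d\<in>V. ball d \<eta>)"
  proof
    fix u :: 'a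
    obtain d where "d \<in> V" "d \<in> ball u \<eta>"
      using dense[of "ball u \<eta>"] \<eta>(1) by auto
    then show "u \<in> (\<Union>d\<in>V. ball d \<eta>)"
      by (auto simp: dist_commute)
  qed
  obtain E where E: "E \<subseteq> V" "finite E" "sphere 0 1 \<subseteq> (\<Union>d\<in>E. ball d \<eta>)"
    using compactE_image[OF compact_sphere[of 0 1], of V "\<lambda>d. ball d \<eta>"] cover by (metis open_ball)
  have "\<forall>\<^sub>F t in at 0. \<forall>d\<in>E. dist (dir_quot f x d t) (d \<bullet> a) < \<eta>"
    using E lim \<eta>(1) by (intro eventually_ball_finite ballI tendstoD) auto
  then obtain \<delta> where \<delta>: "\<delta> > 0"
    "\<And>t d. t \<noteq> 0 \<Longrightarrow> \<bar>t\<bar> < \<delta> \<Longrightarrow> d \<in> E \<Longrightarrow> dist (dir_quot f x d t) (d \<bullet> a) < \<eta>"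
    by (auto simp: eventually_at)
  show "\<exists>d>0. \<forall>y. norm (y - x) < d \<longrightarrow> norm (f y - f x - (y - x) \<bullet> a) \<le> e * norm (y - x)"
  proof (intro exI conjI allI impI)
    fix y assume y: "norm (y - x) < \<delta>"
    show "norm (f y - f x - (y - x) \<bullet> a) \<le> e * norm (y - x)"
    proof (cases "y = x")
      case False
      define t where "t = norm (y - x)"
      have t: "t > 0" using False by (simp add: t_def)
      define u where "u = (y - x) /\<^sub>R t"
      have yx: "y = x + t *\<^sub>R u" using t by (simp add: u_def)
      have "u \<in> sphere 0 1" using False by (simp add: u_def t_def)
      then obtain d where d: "d \<in> E" "dist d u < \<eta>" using E(3) by auto
      have "\<bar>f (x + t *\<^sub>R u) - f (x + t *\<^sub>R d)\<bar> \<le> L * (t * norm (u - d))"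
        using lipschitz_onD[OF lip, of "x + t *\<^sub>R u" "x + t *\<^sub>R d"] t
        by (simp add: dist_norm scaleR_diff_right[symmetric])
      also have "\<dots> \<le> L * (t * \<eta>)"
        using d L t by (intro mult_left_mono) (auto simp: dist_norm norm_minus_commute)
      finally have 1: "\<bar>f (x + t *\<^sub>R u) - f (x + t *\<^sub>R d)\<bar> \<le> L * (t * \<eta>)" .
      have "\<bar>(f (x + t *\<^sub>R d) - f x) / t - d \<bullet> a\<bar> < \<eta>"
        using \<delta>(2)[of t d] t y d by (simp add: dist_real_def dir_quot_def t_def)
      then have "t * \<bar>(f (x + t *\<^sub>R d) - f x) / t - d \<bullet> a\<bar> \<le> t * \<eta>"
        using t by (intro mult_left_mono) auto
      moreover have "t * \<bar>(f (x + t *\<^sub>R d) - f x) / t - d \<bullet> a\<bar> = \<bar>t * ((f (x + t *\<^sub>R d) - f x) / t - d \<bullet> a)\<bar>"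
        using t by (simp add: abs_mult)
      moreover have "t * ((f (x + t *\<^sub>R d) - f x) / t - d \<bullet> a) = f (x + t *\<^sub>R d) - f x - t * (d \<bullet> a)"
        using t by (simp add: field_simps)
      ultimately have 2: "\<bar>f (x + t *\<^sub>R d) - f x - t * (d \<bullet> a)\<bar> \<le> t * \<eta>" by simp
      have "\<bar>(d - u) \<bullet> a\<bar> \<le> norm (d - u) * norm a" by (rule Cauchy_Schwarz_ineq2)
      also have "\<dots> \<le> \<eta> * norm a"
        using d by (intro mult_right_mono) (auto simp: dist_norm)
      finally have "t * \<bar>(d - u) \<bullet> a\<bar> \<le> t * (\<eta> * norm a)"
        using t by (intro mult_left_mono) auto
      then have 3: "\<bar>t * (d \<bullet> a) - t * (u \<bullet> a)\<bar> \<le> t * (\<eta> * norm a)"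
        using t by (simp add: abs_mult inner_diff_left right_diff_distrib[symmetric])
      have "\<bar>f y - f x - (y - x) \<bullet> a\<bar> \<le> L * (t * \<eta>) + t * \<eta> + t * (\<eta> * norm a)"
        using 1 2 3 by (simp add: yx)
      also have "\<dots> = \<eta> * (L + 1 + norm a) * t" by (simp add: algebra_simps)
      finally show ?thesis using \<eta>(2) by (simp add: t_def)
    qed simp
  qed (use \<delta> in auto)
qed

text \<open>A countable dense set of directions keeps the exceptional set null while still
  determining the derivative.\<close>

theorem rademacher_real:
  fixes f :: "'a::euclidean_space \<Rightarrow> real"
  assumes lip: "L-lipschitz_on UNIV f"
  shows "AE x in lborel. f differentiable (at x)"
proof -
  obtain V :: "'a set" where V: "countable V" "\<And>X. open X \<Longrightarrow> X \<noteq> {} \<Longrightarrow> \<exists>d\<in>V. d \<in> X"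
    using countable_dense_setE by blast
  have "AE x in lborel. \<forall>v\<in>V. (dir_quot f x v \<longlongrightarrow> v \<bullet> dir_grad f x) (at 0)"
    using V(1) AE_dir_quot_tendsto_dir_grad[OF lip] by (simp add: AE_ball_countable)
  then show ?thesis
    by eventually_elim (use has_derivative_if_dense_dir[OF lip V(2)] in \<open>blast intro: differentiableI\<close>)
qed

theorem rademacher:
  fixes f :: "'a::euclidean_space \<Rightarrow> 'b::euclidean_space"
  assumes lip: "L-lipschitz_on UNIV f"
  shows "AE x in lborel. f differentiable (at x)"
proof -
  have "L-lipschitz_on UNIV (\<lambda>x. f x \<bullet> b)" if "b \<in> Basis" for b
  proof (rule lipschitz_onI)
    fix x y
    have "\<bar>(f x - f y) \<bullet> b\<bar> \<le> norm (f x - f y)"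
      using that Basis_le_norm by blast
    also have "\<dots> \<le> L * dist x y"
      using lipschitz_onD[OF lip, of x y] by (simp add: dist_norm)
    finally show "dist (f x \<bullet> b) (f y \<bullet> b) \<le> L * dist x y"
      by (simp add: dist_real_def inner_diff_left)
  qed (use lipschitz_on_nonneg[OF lip] in auto)
  then have "AE x in lborel. \<forall>b\<in>Basis. (\<lambda>x. f x \<bullet> b) differentiable (at x)"
    by (intro AE_finite_allI rademacher_real) auto
  then show ?thesis
    by eventually_elim (subst differentiable_componentwise_within, blast)
qed

section \<open>A mean value inequality from almost everywhere bounds\<close>

text \<open>If the bound failed at z, it would fail by a fixed margin \<open>\<eta>\<close> for all
  starting points in a ball \<open>B\<close>. Splitting each step by \<open>v\<close> into short
  steps and integrating over \<open>B\<close> puts the total shortfall of the difference quotients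
  above \<open>\<eta>\<close> times the volume of \<open>B\<close>. Dominated convergence makes that
  shortfall vanish.\<close>

lemma lipschitz_mean_value_AE:
  fixes f :: "'a::euclidean_space \<Rightarrow> real"
  assumes lip: "L-lipschitz_on UNIV f" and U: "open U" "convex U" "z \<in> U" "z + v \<in> U"
    and ge: "AE x in lborel. x \<in> U \<longrightarrow> (\<forall>l. (dir_quot f x v \<longlongrightarrow> l) (at 0) \<longrightarrow> c \<le> l)"
  shows "c \<le> f (z + v) - f z"
proof (rule ccontr)
  assume "\<not> c \<le> f (z + v) - f z"
  have contf: "continuous_on UNIV f"
    using lip by (rule lipschitz_on_continuous_on)
  have [measurable]: "f \<in> borel_measurable borel"
    using contf by (rule borel_measurable_continuous_onI)
  define g where "g x = f (x + v) - f x - c" for x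
  define \<eta> where "\<eta> = - g z / 2"
  have "g z < 0"
    using \<open>\<not> c \<le> f (z + v) - f z\<close> by (simp add: g_def)
  then have "\<eta> > 0" "g z < - \<eta>"
    by (auto simp: \<eta>_def)
  have "open {x. g x < - \<eta>}"
    unfolding g_def by (intro open_Collect_less) (auto intro!: continuous_intros continuous_on_compose2[OF contf])
  then obtain r1 where r1: "r1 > 0" "cball z r1 \<subseteq> {x. g x < - \<eta>}"
    using \<open>g z < - \<eta>\<close> open_contains_cball by blast
  define S where "S = closed_segment z (z + v)"
  have S: "compact S" "S \<subseteq> U"
    using U by (auto simp: S_def closed_segment_subset)
  obtain r2 where r2: "r2 > 0" "(\<Union>p\<in>S. ball p r2) \<subseteq> U"
    using compact_subset_open_imp_ball_epsilon_subset[OF S(1) U(1) S(2)] by blast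
  define r where "r = min r1 (r2 / 2)"
  have r: "r > 0" "r \<le> r1" "r < r2" using r1 r2 by (auto simp: r_def)
  define B where "B = cball z r"
  \<comment> \<open>This compact tube contains every segment from x to x + v with x in
    \<open>B\<close>, and the choice of \<open>r\<close> keeps it inside \<open>U\<close>.\<close>
  define C where "C = {x + y |x y. x \<in> S \<and> y \<in> cball 0 r}"
  have C: "compact C"
    unfolding C_def using S(1) by (intro compact_sums) auto
  have CU: "C \<subseteq> U"
    using r2(2) r(3) by (force simp: C_def dist_norm subset_iff)
  have BC: "\<tau> *\<^sub>R v + x \<in> C" if "x \<in> B" "0 \<le> \<tau>" "\<tau> \<le> 1" for x \<tau>
  proof -
    have "\<tau> *\<^sub>R v + x = (z + \<tau> *\<^sub>R v) + (x - z)" by simp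
    moreover have "z + \<tau> *\<^sub>R v = (1 - \<tau>) *\<^sub>R z + \<tau> *\<^sub>R (z + v)" by (simp add: algebra_simps)
    then have "z + \<tau> *\<^sub>R v \<in> S" using that(2,3) unfolding S_def closed_segment_def by blast
    moreover have "x - z \<in> cball 0 r" using that(1) by (simp add: B_def dist_norm norm_minus_commute)
    ultimately show ?thesis unfolding C_def by blast
  qed
  have [measurable]: "C \<in> sets borel" "B \<in> sets borel"
    using C by (auto simp: B_def borel_compact)
  define s where "s k = inverse (real (Suc k))" for k
  have s0: "s \<longlonglongrightarrow> 0" "s k > 0" for k
    unfolding s_def using LIMSEQ_inverse_real_of_nat by auto
  \<comment> \<open>The amount by which the quotient falls short of \<open>c\<close>, and 0 if it
    does not.\<close>
  define e where "e k x = \<bar>min (dir_quot f x v (s k) - c) 0\<bar>" for k x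
  have [measurable]: "e k \<in> borel_measurable borel" for k
    unfolding e_def dir_quot_def by measurable
  define M where "M = L * norm v + \<bar>c\<bar>"
  have eM: "\<bar>e k x\<bar> \<le> M" for k x
    using abs_dir_quot_le[OF lip, of x v "s k"] unfolding e_def M_def by linarith
  define I where "I k = (\<integral>x. indicator C x * e k x \<partial>lborel)" for k
  have dom: "integrable lborel (\<lambda>x. M * indicator C x)"
    using integrable_indicator_compact[OF C] by simp
  have ebound: "norm (indicator C x * e k x) \<le> M * indicator C x" for k x
    using eM by (auto simp: indicator_def)
  have ie: "integrable lborel (\<lambda>x. indicator C x * e k x)" for k
    by (rule Bochner_Integration.integrable_bound[OF dom], measurable)
      (intro AE_I2 order_trans[OF ebound], simp)
  have "I \<longlonglongrightarrow> (\<integral>x. 0 \<partial>(lborel :: 'a measure))"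
    unfolding I_def
  proof (rule integral_dominated_convergence[OF _ _ dom])
    show "AE x in lborel. (\<lambda>k. indicator C x * e k x) \<longlonglongrightarrow> 0"
      using AE_dir_quot_tendsto[OF lip, of v] ge
    proof eventually_elim
      case (elim x)
      show ?case
      proof (cases "x \<in> C")
        case True
        obtain l where l: "(dir_quot f x v \<longlongrightarrow> l) (at 0)" using elim by blast
        have "c \<le> l" using elim(2) l True CU by blast
        have "filterlim s (at 0) sequentially"
          using s0 less_imp_neq[OF s0(2)] by (auto simp: filterlim_at)
        then have "(\<lambda>k. dir_quot f x v (s k)) \<longlonglongrightarrow> l"
          by (rule filterlim_compose[OF l])
        then have "(\<lambda>k. e k x) \<longlonglongrightarrow> \<bar>min (l - c) 0\<bar>"
          unfolding e_def by (intro tendsto_intros)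
        then show ?thesis using \<open>c \<le> l\<close> True by simp
      qed simp
    qed
    show "AE x in lborel. norm (indicator C x * e k x) \<le> M * indicator C x" for k
      using ebound by (intro AE_I2)
  qed auto
  then have I0: "I \<longlonglongrightarrow> 0" by simp
  have "\<eta> * measure lborel B \<le> I k" for k
  proof -
    define n where "n = Suc k"
    have ns: "real n * s k = 1" by (simp add: n_def s_def)
    \<comment> \<open>Telescoping over \<open>n\<close> steps of length 1/n writes
      \<open>g x\<close> as the mean of the quotients minus \<open>c\<close>; each summand is
      bounded below by its negative shortfall. Off \<open>B\<close> the right side is merely
      nonnegative.\<close>
    have pt: "\<eta> * indicator B x \<le> (\<Sum>j<n. s k * (indicator C ((real j * s k) *\<^sub>R v + x) * e k ((real j * s k) *\<^sub>R v + x)))" for x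
    proof (cases "x \<in> B")
      case True
      define y where "y j = (real j * s k) *\<^sub>R v + x" for j
      have yC: "y j \<in> C" if "j < n" for j
      proof -
        have "real j * s k \<le> real n * s k"
          using that s0(2)[of k] by (intro mult_right_mono) auto
        then show ?thesis
          unfolding y_def using s0(2)[of k] by (intro BC[OF True]) (auto simp: ns less_imp_le)
      qed
      have "(\<Sum>j<n. f (y (Suc j)) - f (y j)) = f (y n) - f (y 0)"
        by (rule sum_lessThan_telescope)
      also have "\<dots> = f (x + v) - f x"
        by (simp add: y_def ns add.commute)
      finally have tel: "(\<Sum>j<n. f (y (Suc j)) - f (y j)) = f (x + v) - f x" .
      have step: "f (y (Suc j)) - f (y j) = s k * dir_quot f (y j) v (s k)" for j
      proof -
        have "y (Suc j) = y j + s k *\<^sub>R v"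
          by (simp add: y_def algebra_simps)
        then show ?thesis using s0(2)[of k] by (simp add: dir_quot_def)
      qed
      have "(\<Sum>j<n. s k * (dir_quot f (y j) v (s k) - c)) = f (x + v) - f x - real n * (s k * c)"
        by (simp add: right_diff_distrib sum_subtractf step[symmetric] tel[unfolded sum_subtractf])
      also have "\<dots> = g x"
        using ns by (simp add: g_def mult.assoc[symmetric])
      finally have gx: "g x = (\<Sum>j<n. s k * (dir_quot f (y j) v (s k) - c))" ..
      have "g x < - \<eta>" using subsetD[OF r1(2), of x] True r by (auto simp: B_def)
      then have "\<eta> \<le> (\<Sum>j<n. - (s k * (dir_quot f (y j) v (s k) - c)))"
        by (simp add: gx sum_negf)
      also have "\<dots> \<le> (\<Sum>j<n. s k * (indicator C (y j) * e k (y j)))"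
      proof (rule sum_mono)
        fix j assume "j \<in> {..<n}"
        then have "y j \<in> C" using yC by simp
        moreover have "- (dir_quot f (y j) v (s k) - c) \<le> e k (y j)"
          unfolding e_def by linarith
        then have "s k * - (dir_quot f (y j) v (s k) - c) \<le> s k * e k (y j)"
          using s0(2)[of k] by (intro mult_left_mono) auto
        ultimately show "- (s k * (dir_quot f (y j) v (s k) - c)) \<le> s k * (indicator C (y j) * e k (y j))"
          by (simp add: right_diff_distrib)
      qed
      finally show ?thesis using True by (simp add: y_def)
    next
      case False
      have "0 \<le> e k x" for x by (simp add: e_def)
      then show ?thesis using False s0(2)[of k] by (auto intro!: sum_nonneg)
    qed
    have it: "integrable lborel (\<lambda>x. indicator C (a + x) * e k (a + x))" for a
      using integrable_lborel_translation[OF ie[of k], of a] .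
    have "\<eta> * measure lborel B = (\<integral>x. \<eta> * indicator B x \<partial>lborel)"
      by simp
    also have "\<dots> \<le> (\<integral>x. (\<Sum>j<n. s k * (indicator C ((real j * s k) *\<^sub>R v + x) * e k ((real j * s k) *\<^sub>R v + x))) \<partial>lborel)"
    proof (rule integral_mono)
      show "integrable lborel (\<lambda>x. \<eta> * indicator B x)"
        using integrable_indicator_compact[of B] by (simp add: B_def)
    qed (use pt it in \<open>auto intro!: Bochner_Integration.integrable_sum integrable_mult_right\<close>)
    also have "\<dots> = (\<Sum>j<n. s k * (\<integral>x. indicator C ((real j * s k) *\<^sub>R v + x) * e k ((real j * s k) *\<^sub>R v + x) \<partial>lborel))"
      using it by (subst Bochner_Integration.integral_sum) auto
    \<comment> \<open>Translation invariance makes the \<open>n\<close> integrals equal, and their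
      weights add up to 1.\<close>
    also have "\<dots> = (\<Sum>j<n. s k * I k)"
      unfolding I_def
      by (intro sum.cong refl arg_cong[where f = "\<lambda>y. s k * y"] integral_lborel_translation[of "\<lambda>x. indicator C x * e k x"]) measurable
    also have "\<dots> = I k"
      using ns by (simp add: mult.assoc[symmetric])
    finally show ?thesis .
  qed
  then have "\<eta> * measure lborel B \<le> 0"
    using I0 by (intro LIMSEQ_le_const) auto
  moreover have "measure lborel B > 0"
    using r(1) content_cball_pos[of r z] by (simp add: B_def)
  ultimately show False
    using \<open>\<eta> > 0\<close> by (simp add: mult_le_0_iff)
qed

subsection \<open>Extension of monotone graphs\<close>

text \<open>At a minimiser of the maximum of the quadratics \<open>\<phi> i\<close>, whose signs are
  opposite to the required ones, 0 is a convex combination of the active gradients. Monotonicity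
  averaged twice with these weights forces the minimum to be nonpositive.\<close>

lemma debrunner_flor_finite:
  fixes M :: "('a::euclidean_space \<times> 'a) set"
  assumes fin: "finite M" and mono: "monotone_graph M"
  shows "\<exists>x. \<forall>(u, v)\<in>M. (x - u) \<bullet> (z - x - v) \<ge> 0"
proof (cases "M = {}")
  case False
  define \<phi> where "\<phi> i x = (x - fst i) \<bullet> (x + snd i - z)" for i x
  define \<psi> where "\<psi> x = Max ((\<lambda>i. \<phi> i x) ` M)" for x
  have cont\<phi>: "continuous_on S (\<phi> i)" for i S
    unfolding \<phi>_def by (intro continuous_intros)
  have cont: "continuous_on UNIV \<psi>"
    unfolding \<psi>_def using fin False
  proof (induction M rule: finite_ne_induct)
    case (insert i M)
    then show ?case by (auto intro!: continuous_intros cont\<phi>)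
  qed (simp add: cont\<phi>)
  have \<psi>ge: "\<phi> i x \<le> \<psi> x" if "i \<in> M" for i x
    unfolding \<psi>_def using fin that by (intro Max_ge) auto
  have \<psi>less: "\<psi> x < m" if "\<And>i. i \<in> M \<Longrightarrow> \<phi> i x < m" for x m
    unfolding \<psi>_def using fin False that by (subst Max_less_iff) auto
  obtain i0 where i0: "i0 \<in> M" using False by blast
  define p where "p = norm (fst i0) + norm (snd i0 - z)"
  define q where "q = norm (fst i0) * norm (snd i0 - z)"
  \<comment> \<open>Outside this radius the quadratic of the single index \<open>i0\<close> already
    exceeds the value of \<open>\<psi>\<close> at 0, so a minimiser on the ball is a global
    one.\<close>
  define R where "R = p + q + \<bar>\<psi> 0\<bar> + 1"
  have pq: "p \<ge> 0" "q \<ge> 0" by (auto simp: p_def q_def)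
  have far: "\<psi> x > \<psi> 0" if "norm x > R" for x
  proof -
    have "\<phi> i0 x = norm x ^ 2 + x \<bullet> (snd i0 - z) - fst i0 \<bullet> x - fst i0 \<bullet> (snd i0 - z)"
      by (simp add: \<phi>_def power2_norm_eq_inner algebra_simps inner_commute)
    moreover have "\<bar>x \<bullet> (snd i0 - z)\<bar> \<le> norm x * norm (snd i0 - z)"
      "\<bar>fst i0 \<bullet> x\<bar> \<le> norm (fst i0) * norm x" "\<bar>fst i0 \<bullet> (snd i0 - z)\<bar> \<le> q"
      unfolding q_def by (rule Cauchy_Schwarz_ineq2)+
    ultimately have "\<phi> i0 x \<ge> norm x ^ 2 - norm x * norm (snd i0 - z) - norm (fst i0) * norm x - q"
      by linarith
    then have "\<phi> i0 x \<ge> norm x * (norm x - p) - q"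
      by (simp add: p_def algebra_simps power2_eq_square)
    moreover have "norm x * (norm x - p) \<ge> 1 * (q + \<bar>\<psi> 0\<bar> + 1)"
      using that pq by (intro mult_mono) (auto simp: R_def)
    ultimately show ?thesis
      using \<psi>ge[OF i0, of x] abs_ge_self[of "\<psi> 0"] unfolding mult_1 by linarith
  qed
  have "R \<ge> 0" using pq by (simp add: R_def)
  then obtain x where x: "x \<in> cball 0 R" "\<And>y. y \<in> cball 0 R \<Longrightarrow> \<psi> x \<le> \<psi> y"
    using continuous_attains_inf[of "cball 0 R" \<psi>] continuous_on_subset[OF cont]
    by (metis centre_in_cball compact_cball empty_iff top_greatest)
  have xmin: "\<psi> x \<le> \<psi> y" for y
    using x(2)[of y] x(2)[of 0] far[of y] \<open>R \<ge> 0\<close> by fastforce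
  define \<mu> where "\<mu> = \<psi> x"
  define grad where "grad i = (x + snd i - z) - (fst i - x)" for i
  define I where "I = {i \<in> M. \<phi> i x = \<mu>}"
  have \<phi>move: "\<phi> i (x - t *\<^sub>R a) = \<phi> i x - t * (a \<bullet> grad i) + t\<^sup>2 * (a \<bullet> a)" for i t a
    by (simp add: \<phi>_def grad_def algebra_simps inner_commute power2_eq_square)
  \<comment> \<open>Otherwise a separating vector has positive product with all active gradients. A
    small step against it lowers every active function below \<open>\<mu>\<close>, and the inactive
    ones stay below by continuity.\<close>
  have hull: "0 \<in> convex hull (grad ` I)"
  proof (rule ccontr)
    assume "0 \<notin> convex hull (grad ` I)"
    moreover have "closed (convex hull (grad ` I))"
      using fin by (intro compact_imp_closed compact_convex_hull finite_imp_compact) (auto simp: I_def)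
    ultimately obtain a b where ab: "0 < b" "\<And>y. y \<in> convex hull (grad ` I) \<Longrightarrow> a \<bullet> y > b"
      using separating_hyperplane_closed_0[of "convex hull (grad ` I)"] by auto
    have "\<forall>\<^sub>F t in at_right 0. \<phi> i (x - t *\<^sub>R a) < \<mu>" if "i \<in> M" for i
    proof (cases "i \<in> I")
      case True
      then have ag: "a \<bullet> grad i > b" by (intro ab hull_inc) auto
      have "((\<lambda>t. - (a \<bullet> grad i) + t * (a \<bullet> a)) \<longlongrightarrow> - (a \<bullet> grad i) + 0 * (a \<bullet> a)) (at_right 0)"
        by (intro tendsto_intros)
      moreover have "- (a \<bullet> grad i) + 0 * (a \<bullet> a) < 0" using ab ag by simp
      ultimately have "\<forall>\<^sub>F t in at_right 0. - (a \<bullet> grad i) + t * (a \<bullet> a) < 0"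
        by (rule order_tendstoD)
      moreover have "\<forall>\<^sub>F t in at_right (0::real). t > 0"
        by (rule eventually_at_right_less)
      ultimately show ?thesis
      proof eventually_elim
        case (elim t)
        then have "t * (- (a \<bullet> grad i) + t * (a \<bullet> a)) < 0" by (simp add: mult_pos_neg)
        then show ?case
          using True by (simp add: \<phi>move I_def algebra_simps power2_eq_square)
      qed
    next
      case False
      then have lt: "\<phi> i x < \<mu>" using that \<psi>ge[OF that, of x] by (auto simp: I_def \<mu>_def)
      have "((\<lambda>t. \<phi> i x - t * (a \<bullet> grad i) + t\<^sup>2 * (a \<bullet> a)) \<longlongrightarrow> \<phi> i x - 0 * (a \<bullet> grad i) + 0\<^sup>2 * (a \<bullet> a)) (at_right 0)"
        by (intro tendsto_intros)
      then have "\<forall>\<^sub>F t in at_right 0. \<phi> i x - t * (a \<bullet> grad i) + t\<^sup>2 * (a \<bullet> a) < \<mu>"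
        by (rule order_tendstoD) (use lt in simp)
      then show ?thesis by (simp only: \<phi>move)
    qed
    then have "\<forall>\<^sub>F t in at_right 0. \<forall>i\<in>M. \<phi> i (x - t *\<^sub>R a) < \<mu>"
      using fin by (intro eventually_ball_finite) auto
    then obtain t where "\<forall>i\<in>M. \<phi> i (x - t *\<^sub>R a) < \<mu>"
      using eventually_happens trivial_limit_at_right_real by blast
    then have "\<psi> (x - t *\<^sub>R a) < \<mu>" by (intro \<psi>less) auto
    with xmin show False unfolding \<mu>_def by (meson not_less)
  qed
  have "finite (grad ` I)" using fin by (simp add: I_def)
  with hull obtain w where w: "\<And>g. g \<in> grad ` I \<Longrightarrow> 0 \<le> w g" "sum w (grad ` I) = 1"
    "(\<Sum>g\<in>grad ` I. w g *\<^sub>R g) = 0"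
    by (auto simp: convex_hull_finite)
  define G where "G = grad ` I"
  \<comment> \<open>The hull gives weights on gradients, not on indices; one active index is
    selected for each gradient.\<close>
  define \<iota> where "\<iota> g = (SOME i. i \<in> I \<and> grad i = g)" for g
  have \<iota>: "\<iota> g \<in> I" "grad (\<iota> g) = g" if "g \<in> G" for g
    using someI_ex[of "\<lambda>i. i \<in> I \<and> grad i = g"] that unfolding \<iota>_def G_def by blast+
  define a where "a g = fst (\<iota> g) - x" for g
  define b where "b g = x + snd (\<iota> g) - z" for g
  define A where "A = (\<Sum>g\<in>G. w g *\<^sub>R a g)"
  define B where "B = (\<Sum>g\<in>G. w g *\<^sub>R b g)"
  have ab: "a g \<bullet> b g = - \<mu>" if "g \<in> G" for g
  proof -
    have "\<phi> (\<iota> g) x = \<mu>" using \<iota>(1)[OF that] by (simp add: I_def)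
    moreover have "\<phi> (\<iota> g) x = - (a g \<bullet> b g)" by (simp add: \<phi>_def a_def b_def algebra_simps)
    ultimately show ?thesis by simp
  qed
  have "B - A = (\<Sum>g\<in>G. w g *\<^sub>R g)"
    unfolding A_def B_def sum_subtractf[symmetric]
    using \<iota>(2) by (intro sum.cong) (auto simp: a_def b_def grad_def scaleR_diff_right[symmetric])
  then have BA: "B = A" using w(3) by (simp add: G_def)
  \<comment> \<open>Active indices have product \<open>- \<mu>\<close> between \<open>a\<close> and
    \<open>b\<close>, and differences of the \<open>a\<close> and \<open>b\<close> are differences
    in \<open>M\<close>. Averaging monotonicity over h leaves this bound; a second average over g
    gives \<open>\<mu>\<close> <= -|A|^2 because A = B.\<close>
  have one: "0 \<le> - 2 * \<mu> - a g \<bullet> A - A \<bullet> b g" if g: "g \<in> G" for g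
  proof -
    have "0 \<le> (a g - a h) \<bullet> (b g - b h)" if h: "h \<in> G" for h
      using mono \<iota>(1)[OF g] \<iota>(1)[OF h] unfolding monotone_graph_def
      by (fastforce simp: I_def a_def b_def inner_commute split: prod.splits)
    then have "0 \<le> (\<Sum>h\<in>G. w h * ((a g - a h) \<bullet> (b g - b h)))"
      using w(1) by (intro sum_nonneg mult_nonneg_nonneg) (auto simp: G_def)
    also have "\<dots> = (\<Sum>h\<in>G. w h * (- 2 * \<mu>) - a g \<bullet> (w h *\<^sub>R b h) - (w h *\<^sub>R a h) \<bullet> b g)"
      using ab g by (intro sum.cong) (auto simp: algebra_simps)
    also have "\<dots> = - 2 * \<mu> - a g \<bullet> B - A \<bullet> b g"
      using w(2) unfolding A_def B_def
      by (simp add: sum_subtractf inner_sum_left inner_sum_right sum_distrib_right[symmetric] sum_negf G_def[symmetric])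
    finally show ?thesis by (simp add: BA)
  qed
  have "0 \<le> (\<Sum>g\<in>G. w g * (- 2 * \<mu> - a g \<bullet> A - A \<bullet> b g))"
    using w(1) one by (intro sum_nonneg mult_nonneg_nonneg) (auto simp: G_def)
  also have "\<dots> = (\<Sum>g\<in>G. w g * (- 2 * \<mu>) - (w g *\<^sub>R a g) \<bullet> A - A \<bullet> (w g *\<^sub>R b g))"
    by (intro sum.cong) (auto simp: algebra_simps)
  also have "\<dots> = - 2 * \<mu> - A \<bullet> A - A \<bullet> B"
    using w(2) inner_sum_left[of "\<lambda>g. w g *\<^sub>R a g" G A, folded A_def]
      inner_sum_right[of A "\<lambda>g. w g *\<^sub>R b g" G, folded B_def]
    unfolding sum_subtractf by (simp only: sum_distrib_right[symmetric] G_def[symmetric] mult_1)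
  finally have "\<mu> \<le> 0"
    using inner_ge_zero[of A] unfolding BA by linarith
  then have "\<phi> i x \<le> 0" if "i \<in> M" for i
    using \<psi>ge[OF that, of x] by (simp add: \<mu>_def)
  moreover have "\<phi> (u, v) x = - ((x - u) \<bullet> (z - x - v))" for u v
    by (simp add: \<phi>_def algebra_simps)
  ultimately show ?thesis by (intro exI[of _ x]) fastforce
qed simp

text \<open>The solutions for a single pair form a closed set, and for (u0, v0) this set lies in a
  ball. The finite case and the finite intersection property then suffice. For a maximal monotone
  \<open>M\<close> the statement becomes surjectivity of I + M.\<close>

lemma debrunner_flor:
  fixes M :: "('a::euclidean_space \<times> 'a) set"
  assumes mono: "monotone_graph M"
  shows "\<exists>x. \<forall>(u, v)\<in>M. (x - u) \<bullet> (z - x - v) \<ge> 0"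
proof (cases "M = {}")
  case False
  then obtain u0 v0 where 0: "(u0, v0) \<in> M" by auto
  define K where "K i = {x. (x - fst i) \<bullet> (z - x - snd i) \<ge> 0}" for i
  have "closed (K i)" for i
    unfolding K_def by (intro closed_Collect_le continuous_intros)
  have K0: "K (u0, v0) \<subseteq> cball u0 (norm (z - v0 - u0))"
  proof
    fix x assume "x \<in> K (u0, v0)"
    then have "(x - u0) \<bullet> (x - u0) \<le> (x - u0) \<bullet> (z - v0 - u0)"
      by (simp add: K_def algebra_simps)
    also have "\<dots> \<le> norm (x - u0) * norm (z - v0 - u0)"
      by (rule norm_cauchy_schwarz)
    finally have "norm (x - u0) * norm (x - u0) \<le> norm (x - u0) * norm (z - v0 - u0)"
      by (simp add: power2_norm_eq_inner[symmetric] power2_eq_square)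
    then have "norm (x - u0) \<le> norm (z - v0 - u0)"
      by (cases "x = u0") auto
    then show "x \<in> cball u0 (norm (z - v0 - u0))"
      by (simp add: dist_norm norm_minus_commute)
  qed
  have "cball u0 (norm (z - v0 - u0)) \<inter> \<Inter> (K ` M) \<noteq> {}"
  proof (rule compact_imp_fip)
    fix F assume F: "finite F" "F \<subseteq> K ` M"
    then obtain N where N: "finite N" "N \<subseteq> M" "F = K ` N"
      by (meson finite_subset_image)
    have "monotone_graph (insert (u0, v0) N)"
      using mono N(2) 0 unfolding monotone_graph_def by blast
    then obtain x where "\<forall>(u, v)\<in>insert (u0, v0) N. (x - u) \<bullet> (z - x - v) \<ge> 0"
      using debrunner_flor_finite[of "insert (u0, v0) N" z] N(1) by auto
    then have "x \<in> K (u0, v0)" "x \<in> \<Inter> F"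
      unfolding N(3) K_def by auto
    then show "cball u0 (norm (z - v0 - u0)) \<inter> \<Inter> F \<noteq> {}"
      using K0 by blast
  qed (use \<open>\<And>i. closed (K i)\<close> in auto)
  then obtain x where "\<And>i. i \<in> M \<Longrightarrow> x \<in> K i" by blast
  then show ?thesis
    by (intro exI[of _ x]) (auto simp: K_def)
qed simp

subsection \<open>Orthogonal projections and adjoint subspaces\<close>

lemma orth_proj_props:
  fixes L :: "'a::euclidean_space set"
  assumes L: "subspace L"
  shows orth_proj_in: "orth_proj L z \<in> L"
    and orth_proj_diff: "z - orth_proj L z \<in> L\<^sup>\<bottom>"
    and orth_proj_unique: "p \<in> L \<Longrightarrow> z - p \<in> L\<^sup>\<bottom> \<Longrightarrow> orth_proj L z = p"
proof -
  have uniq: "p = q" if "p \<in> L" "z - p \<in> L\<^sup>\<bottom>" "q \<in> L" "z - q \<in> L\<^sup>\<bottom>" for p q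
  proof -
    have d: "p - q \<in> L" using L that by (simp add: subspace_diff)
    then have "(p - q) \<bullet> (z - p) = 0" "(p - q) \<bullet> (z - q) = 0"
      using that by (auto simp: orthogonal_comp_def orthogonal_def)
    then have "(p - q) \<bullet> (p - q) = 0" by (simp add: inner_diff_right)
    then show ?thesis by simp
  qed
  obtain p w where "p \<in> span L" "\<And>u. u \<in> span L \<Longrightarrow> orthogonal w u" "z = p + w"
    using orthogonal_subspace_decomp_exists[of L z] by blast
  then have p: "p \<in> L \<and> z - p \<in> L\<^sup>\<bottom>"
    using L by (auto simp: orthogonal_comp_def orthogonal_commute span_eq_iff[THEN iffD2])
  then have "orth_proj L z \<in> L \<and> z - orth_proj L z \<in> L\<^sup>\<bottom>"
    unfolding orth_proj_def by (rule theI) (use uniq p in blast)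
  then show "orth_proj L z \<in> L" "z - orth_proj L z \<in> L\<^sup>\<bottom>"
    "p \<in> L \<Longrightarrow> z - p \<in> L\<^sup>\<bottom> \<Longrightarrow> orth_proj L z = p" for p
    using uniq by auto
qed

lemma orth_proj_inner:
  assumes "subspace L" "w \<in> L"
  shows "(z - orth_proj L z) \<bullet> w = 0" "w \<bullet> orth_proj L z = w \<bullet> z"
  using orth_proj_diff[OF assms(1), of z] assms(2)
  by (auto simp: orthogonal_comp_def orthogonal_def inner_commute inner_diff_right)

lemma linear_orth_proj:
  assumes L: "subspace L"
  shows "linear (orth_proj L)"
proof
  note L' = subspace_orthogonal_comp[of L]
  show "orth_proj L (x + y) = orth_proj L x + orth_proj L y" for x y
  proof (rule orth_proj_unique[OF L])
    have "(x - orth_proj L x) + (y - orth_proj L y) \<in> L\<^sup>\<bottom>"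
      by (intro subspace_add[OF L'] orth_proj_diff[OF L])
    then show "x + y - (orth_proj L x + orth_proj L y) \<in> L\<^sup>\<bottom>" by (simp add: algebra_simps)
  qed (intro subspace_add[OF L] orth_proj_in[OF L])
  show "orth_proj L (c *\<^sub>R x) = c *\<^sub>R orth_proj L x" for c x
  proof (rule orth_proj_unique[OF L])
    have "c *\<^sub>R (x - orth_proj L x) \<in> L\<^sup>\<bottom>"
      by (intro subspace_scale[OF L'] orth_proj_diff[OF L])
    then show "c *\<^sub>R x - c *\<^sub>R orth_proj L x \<in> L\<^sup>\<bottom>" by (simp add: scaleR_diff_right)
  qed (intro subspace_scale[OF L] orth_proj_in[OF L])
qed

lemma norm_orth_proj_le:
  assumes L: "subspace L"
  shows "norm (orth_proj L z) \<le> norm z"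
proof -
  have "norm (orth_proj L z) * norm (orth_proj L z) = orth_proj L z \<bullet> z"
    using orth_proj_inner(2)[OF L orth_proj_in[OF L], of z z]
    by (simp add: power2_norm_eq_inner[symmetric] power2_eq_square)
  also have "\<dots> \<le> norm (orth_proj L z) * norm z" by (rule norm_cauchy_schwarz)
  finally show ?thesis by (cases "orth_proj L z = 0") auto
qed

lemma bounded_linear_orth_proj_diff:
  fixes L1 L2 :: "'a::euclidean_space set"
  assumes "subspace L1" "subspace L2"
  shows "bounded_linear (\<lambda>z. orth_proj L1 z - orth_proj L2 z)"
  using assms by (intro linear_conv_bounded_linear[THEN iffD1] linear_compose_sub linear_orth_proj)

lemma norm_orth_proj_diff_le_d_Z:
  assumes "subspace L1" "subspace L2"
  shows "norm (orth_proj L1 z - orth_proj L2 z) \<le> d_Z L1 L2 * norm z"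
  unfolding d_Z_def by (rule onorm[OF bounded_linear_orth_proj_diff[OF assms]])

lemma d_Z_le:
  assumes "subspace L1" "subspace L2" "\<And>z. norm (orth_proj L1 z - orth_proj L2 z) \<le> K * norm z"
  shows "d_Z L1 L2 \<le> K"
  unfolding d_Z_def by (rule onorm_le) (rule assms(3))

lemma d_Z_nonneg:
  assumes "subspace L1" "subspace L2"
  shows "0 \<le> d_Z L1 L2"
  unfolding d_Z_def by (rule onorm_pos_le[OF bounded_linear_orth_proj_diff[OF assms]])

lemma norm_diff_orth_proj_le:
  assumes L: "subspace L" and w': "w' \<in> L"
  shows "norm (w - orth_proj L w) \<le> norm (w - w')"
proof -
  have "orth_proj L w - w' \<in> L"
    by (intro subspace_diff[OF L] orth_proj_in[OF L] w')
  then have "(w - orth_proj L w) \<bullet> (orth_proj L w - w') = 0"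
    by (rule orth_proj_inner(1)[OF L])
  then have "(w - orth_proj L w) \<bullet> (w - orth_proj L w) = (w - orth_proj L w) \<bullet> (w - w')"
    by (simp add: inner_diff_right)
  also have "\<dots> \<le> norm (w - orth_proj L w) * norm (w - w')"
    by (rule norm_cauchy_schwarz)
  finally have "norm (w - orth_proj L w) * norm (w - orth_proj L w) \<le> norm (w - orth_proj L w) * norm (w - w')"
    by (simp add: power2_norm_eq_inner[symmetric] power2_eq_square)
  then show ?thesis by (cases "w = orth_proj L w") auto
qed

text \<open>The difference of the projections is P1 (I - P2) - (I - P1) P2. The second term is small
  by closeness of \<open>L2\<close> to \<open>L1\<close>; the first is the adjoint of (I - P2) P1
  and is estimated by testing \<open>y\<close> against itself.\<close>

lemma d_Z_le_if_close:
  fixes L1 L2 :: "'a::euclidean_space set"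
  assumes L: "subspace L1" "subspace L2" and "\<eta> \<ge> 0"
    and 12: "\<And>w. w \<in> L1 \<Longrightarrow> \<exists>w'\<in>L2. norm (w - w') \<le> \<eta> * norm w"
    and 21: "\<And>w. w \<in> L2 \<Longrightarrow> \<exists>w'\<in>L1. norm (w - w') \<le> \<eta> * norm w"
  shows "d_Z L1 L2 \<le> 2 * \<eta>"
proof (rule d_Z_le[OF L])
  fix z
  have c1: "norm (w - orth_proj L2 w) \<le> \<eta> * norm w" if "w \<in> L1" for w
    using 12[OF that] norm_diff_orth_proj_le[OF L(2), of _ w] order_trans by blast
  have c2: "norm (w - orth_proj L1 w) \<le> \<eta> * norm w" if "w \<in> L2" for w
    using 21[OF that] norm_diff_orth_proj_le[OF L(1), of _ w] order_trans by blast
  define q where "q = z - orth_proj L2 z"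
  define y where "y = orth_proj L1 q"
  have yL: "y \<in> L1" by (simp add: y_def orth_proj_in[OF L(1)])
  have "norm y * norm y = y \<bullet> orth_proj L1 q"
    by (simp add: y_def power2_norm_eq_inner[symmetric] power2_eq_square)
  also have "\<dots> = y \<bullet> q" by (rule orth_proj_inner(2)[OF L(1) yL])
  also have "\<dots> = y \<bullet> z - y \<bullet> orth_proj L2 z"
    by (simp add: q_def inner_diff_right)
  also have "y \<bullet> orth_proj L2 z = orth_proj L2 y \<bullet> z"
    using orth_proj_inner(2)[OF L(2) orth_proj_in[OF L(2)], of z y]
      orth_proj_inner(2)[OF L(2) orth_proj_in[OF L(2)], of y z]
    by (simp add: inner_commute)
  also have "y \<bullet> z - orth_proj L2 y \<bullet> z = (y - orth_proj L2 y) \<bullet> z"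
    by (simp add: inner_diff_left)
  also have "\<dots> \<le> norm (y - orth_proj L2 y) * norm z" by (rule norm_cauchy_schwarz)
  also have "\<dots> \<le> (\<eta> * norm y) * norm z"
    using c1[OF yL] by (rule mult_right_mono) simp
  finally have "norm y * norm y \<le> norm y * (\<eta> * norm z)" by (simp add: mult_ac)
  then have ny: "norm y \<le> \<eta> * norm z"
    using \<open>\<eta> \<ge> 0\<close> by (cases "y = 0") auto
  have "orth_proj L1 z - orth_proj L2 z = y - (orth_proj L2 z - orth_proj L1 (orth_proj L2 z))"
    by (simp add: y_def q_def linear_diff[OF linear_orth_proj[OF L(1)]])
  then have "norm (orth_proj L1 z - orth_proj L2 z) \<le> norm y + norm (orth_proj L2 z - orth_proj L1 (orth_proj L2 z))"
    using norm_triangle_ineq4 by metis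
  also have "\<dots> \<le> \<eta> * norm z + \<eta> * norm (orth_proj L2 z)"
    by (intro add_mono ny c2 orth_proj_in[OF L(2)])
  also have "\<dots> \<le> \<eta> * norm z + \<eta> * norm z"
    using norm_orth_proj_le[OF L(2)] \<open>\<eta> \<ge> 0\<close> by (intro add_left_mono mult_left_mono)
  finally show "norm (orth_proj L1 z - orth_proj L2 z) \<le> 2 * \<eta> * norm z" by simp
qed

section \<open>Adjoint subspaces as rotated orthogonal complements\<close>

text \<open>An isometry with square -I that carries the orthogonal complement onto the adjoint
  subspace; statements on adjoints thereby reduce to complements.\<close>

definition rot :: "'a::real_inner \<times> 'a \<Rightarrow> 'a \<times> 'a" where
  "rot p = (- snd p, fst p)"

lemma rot_simps [simp]:
  "rot (p + q) = rot p + rot q" "rot (p - q) = rot p - rot q" "rot (c *\<^sub>R p) = c *\<^sub>R rot p"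
  "rot p \<bullet> rot q = p \<bullet> q" "norm (rot p) = norm p" "rot (rot p) = - p" "rot 0 = 0" "rot (- p) = - rot p"
  by (auto simp: rot_def prod_eq_iff inner_prod_def norm_eq_sqrt_inner add.commute)

lemma linear_rot: "linear rot"
  by (rule linearI) auto

lemma inj_rot: "inj rot"
  by (rule injI) (auto simp: rot_def prod_eq_iff)

lemma adj_sub_rot: "adj_sub L = rot ` (L\<^sup>\<bottom>)"
  by (auto simp: adj_sub_def rot_def image_iff) force+

lemma subspace_adj_sub: "subspace (adj_sub L)"
  unfolding adj_sub_rot by (intro linear_subspace_image linear_rot subspace_orthogonal_comp)

lemma Z_sub_subspace: "L \<in> Z_sub \<Longrightarrow> subspace L"
  by (simp add: Z_sub_def)

lemma adj_sub_Z_sub: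
  fixes L :: "((real^'n) \<times> (real^'n)) set"
  assumes L: "L \<in> Z_sub"
  shows "adj_sub L \<in> Z_sub"
proof -
  have L': "L\<^sup>\<bottom> = {y \<in> UNIV. \<forall>x \<in> L. orthogonal x y}"
    by (simp add: orthogonal_comp_def)
  have "dim (L\<^sup>\<bottom>) + dim L = dim (UNIV :: ((real^'n) \<times> (real^'n)) set)"
    unfolding L' using L by (intro dim_subspace_orthogonal_to_vectors) (auto simp: Z_sub_def)
  then have "dim (L\<^sup>\<bottom>) = CARD('n)"
    using L by (simp add: Z_sub_def)
  moreover have "dim (adj_sub L) = dim (L\<^sup>\<bottom>)"
    unfolding adj_sub_rot by (rule dim_image_eq[OF linear_rot]) (metis inj_rot inj_on_subset subset_UNIV)
  ultimately show ?thesis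
    by (simp add: Z_sub_def subspace_adj_sub)
qed

text \<open>The projection onto the complement is I - P, conjugated here by \<open>rot\<close>. The
  signs come from the inverse of \<open>rot\<close>, which is its negative.\<close>

lemma orth_proj_adj_sub:
  assumes L: "subspace (L :: ((real^'n) \<times> (real^'n)) set)"
  shows "orth_proj (adj_sub L) z = rot (orth_proj L (rot z) - rot z)"
proof (rule orth_proj_unique[OF subspace_adj_sub])
  have "- (rot z - orth_proj L (rot z)) \<in> L\<^sup>\<bottom>"
    by (intro subspace_neg subspace_orthogonal_comp orth_proj_diff[OF L])
  then have "orth_proj L (rot z) - rot z \<in> L\<^sup>\<bottom>" by simp
  then show "rot (orth_proj L (rot z) - rot z) \<in> adj_sub L"
    unfolding adj_sub_rot by (rule imageI)
  have "z - rot (orth_proj L (rot z) - rot z) = rot (- orth_proj L (rot z))"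
    by simp
  moreover have "rot w \<bullet> rot (- orth_proj L (rot z)) = 0" if "w \<in> L\<^sup>\<bottom>" for w
  proof -
    have "orth_proj L (rot z) \<bullet> w = 0"
      using that orth_proj_in[OF L, of "rot z"] by (simp add: orthogonal_comp_def orthogonal_def)
    then show ?thesis unfolding rot_simps(4) by (simp add: inner_commute)
  qed
  ultimately show "z - rot (orth_proj L (rot z) - rot z) \<in> (adj_sub L)\<^sup>\<bottom>"
    unfolding adj_sub_rot orthogonal_comp_def orthogonal_def by auto
qed

lemma d_Z_adj_sub_le:
  assumes L: "subspace (L1 :: ((real^'n) \<times> (real^'n)) set)" "subspace L2"
  shows "d_Z (adj_sub L1) (adj_sub L2) \<le> d_Z L1 L2"
proof (rule d_Z_le[OF subspace_adj_sub subspace_adj_sub])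
  fix z
  have "orth_proj (adj_sub L1) z - orth_proj (adj_sub L2) z = rot (orth_proj L1 (rot z) - orth_proj L2 (rot z))"
    by (simp add: orth_proj_adj_sub L)
  then have "norm (orth_proj (adj_sub L1) z - orth_proj (adj_sub L2) z) = norm (orth_proj L1 (rot z) - orth_proj L2 (rot z))"
    by (simp only: rot_simps(5))
  then show "norm (orth_proj (adj_sub L1) z - orth_proj (adj_sub L2) z) \<le> d_Z L1 L2 * norm z"
    using norm_orth_proj_diff_le_d_Z[OF L, of "rot z"] by simp
qed

text \<open>\<open>rot\<close> commutes with taking complements, and its square -I maps a subspace
  onto itself.\<close>

lemma adj_sub_adj_sub:
  assumes L: "subspace (L :: ((real^'n) \<times> (real^'n)) set)"
  shows "adj_sub (adj_sub L) = L"
proof -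
  have "(rot ` M)\<^sup>\<bottom> = rot ` (M\<^sup>\<bottom>)" for M :: "((real^'n) \<times> (real^'n)) set"
  proof (intro equalityI subsetI)
    fix p assume p: "p \<in> (rot ` M)\<^sup>\<bottom>"
    have "q \<bullet> rot p = 0" if "q \<in> M" for q
    proof -
      have "rot q \<bullet> p = 0" using p that by (auto simp: orthogonal_comp_def orthogonal_def)
      then have "rot (rot q) \<bullet> rot p = 0" by (simp only: rot_simps(4))
      then show ?thesis by simp
    qed
    then have "- rot p \<in> M\<^sup>\<bottom>" by (auto simp: orthogonal_comp_def orthogonal_def)
    moreover have "p = rot (- rot p)" by simp
    ultimately show "p \<in> rot ` (M\<^sup>\<bottom>)" by blast
  qed (auto simp: orthogonal_comp_def orthogonal_def)
  then have "adj_sub (adj_sub L) = rot ` rot ` (L\<^sup>\<bottom>\<^sup>\<bottom>)"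
    by (simp add: adj_sub_rot)
  also have "L\<^sup>\<bottom>\<^sup>\<bottom> = L" by (rule orthogonal_comp_self[OF L])
  also have "rot ` rot ` L = L"
  proof -
    have "- p \<in> L" if "p \<in> L" for p using subspace_neg[OF L that] .
    then show ?thesis by (force simp: image_image image_iff)
  qed
  finally show ?thesis .
qed

section \<open>Regular subspaces as graphs over the second factor\<close>

lemma snd_image_Z_reg:
  fixes L :: "((real^'n) \<times> (real^'n)) set"
  assumes L: "L \<in> Z_reg"
  shows "inj_on snd L" "snd ` L = UNIV"
proof -
  have sub: "subspace L" and dim: "dim L = CARD('n)" and reg: "\<And>y. (y, 0) \<in> L \<Longrightarrow> y = 0"
    using L by (auto simp: Z_reg_def Z_sub_def)
  show inj: "inj_on snd L"
  proof (rule inj_onI)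
    fix p q assume "p \<in> L" "q \<in> L" "snd p = snd q"
    moreover from this have "(fst p - fst q, 0) \<in> L"
      using subspace_diff[OF sub, of p q] by (simp add: minus_prod_def)
    ultimately show "p = q" using reg[of "fst p - fst q"] by (simp add: prod_eq_iff)
  qed
  have "dim (snd ` L) = dim L"
    using inj sub by (intro dim_image_eq) (auto simp: linear_snd span_eq_iff[THEN iffD2])
  then have "span (snd ` L) = UNIV"
    using dim by (simp add: dim_eq_full[symmetric])
  moreover have "subspace (snd ` L)"
    by (intro linear_subspace_image linear_snd sub)
  ultimately show "snd ` L = UNIV" by (simp add: span_eq_iff[THEN iffD2])
qed

text \<open>If (y, 0) lies in the adjoint, then (0, -y) is orthogonal to \<open>L\<close>. Second
  components of \<open>L\<close> fill the space, so y is orthogonal to itself.\<close>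

lemma adj_sub_Z_reg:
  assumes L: "L \<in> Z_reg"
  shows "adj_sub L \<in> Z_reg"
proof -
  have "y = 0" if "(y, 0) \<in> adj_sub L" for y
  proof -
    have v: "(0, - y) \<in> L\<^sup>\<bottom>" using that by (auto simp: adj_sub_def)
    obtain p where p: "p \<in> L" "snd p = - y"
      using snd_image_Z_reg(2)[OF L] by (metis UNIV_I imageE)
    from v p have "p \<bullet> (0, - y) = 0" by (simp add: orthogonal_comp_def orthogonal_def)
    then have "y \<bullet> y = 0" using p(2) by (simp add: inner_prod_def)
    then show ?thesis by simp
  qed
  then show ?thesis
    using adj_sub_Z_sub[of L] L by (auto simp: Z_reg_def)
qed

lemma Z_reg_eq_C_mat:
  fixes L :: "((real^'n) \<times> (real^'n)) set"
  assumes L: "L \<in> Z_reg"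
  shows "L = {(C_mat L *v p, p) |p. True}"
proof -
  have sub: "subspace L" using L by (simp add: Z_reg_def Z_sub_def)
  define f where "f p = (THE x. (x, p) \<in> L)" for p
  have ex: "\<exists>!x. (x, p) \<in> L" for p
  proof -
    obtain q where "q \<in> L" "snd q = p"
      using snd_image_Z_reg(2)[OF L] by (metis UNIV_I imageE)
    then have "(fst q, p) \<in> L" by auto
    moreover have "x = y" if "(x, p) \<in> L" "(y, p) \<in> L" for x y
      using inj_onD[OF snd_image_Z_reg(1)[OF L], of "(x, p)" "(y, p)"] that by simp
    ultimately show ?thesis by blast
  qed
  have f: "(x, p) \<in> L \<longleftrightarrow> x = f p" for x p
    unfolding f_def using ex[of p] by (metis the_equality)
  have "linear f"
  proof (rule linearI)
    fix p q and c :: real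
    have "(f p, p) + (f q, q) \<in> L" "c *\<^sub>R (f p, p) \<in> L"
      by (auto intro!: subspace_add[OF sub] subspace_scale[OF sub] simp del: add_Pair scaleR_Pair simp: f)
    then show "f (p + q) = f p + f q" "f (c *\<^sub>R p) = c *\<^sub>R f p" by (auto simp: f)
  qed
  then have "f p = matrix f *v p" for p by (simp add: matrix_works)
  then have M: "L = {(matrix f *v p, p) |p. True}"
    using f by auto
  have "C_mat L = matrix f"
    unfolding C_mat_def
  proof (rule the_equality[where P = "\<lambda>C. L = {(C *v p, p) |p. True}", OF M])
    fix C assume "L = {(C *v p, p) |p. True}"
    then have "(C *v p, p) \<in> L" for p by blast
    then have "C *v p = f p" for p by (simp add: f)
    then show "C = matrix f"
      using \<open>\<And>p. f p = matrix f *v p\<close> by (metis matrix_eq)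
  qed
  then show ?thesis using M by simp
qed

lemma O_set_Z_sub: "p \<in> O_set F \<Longrightarrow> tangent_cone (gph F) p \<in> Z_sub"
  by (simp add: O_set_def)

lemma adj_sub_SF:
  assumes "L \<in> SF F z"
  shows "adj_sub L \<in> SF_adj F z"
proof -
  obtain s where L: "L \<in> Z_sub" and s: "\<And>k. s k \<in> O_set F" "s \<longlonglongrightarrow> z"
    "(\<lambda>k. d_Z L (tangent_cone (gph F) (s k))) \<longlonglongrightarrow> 0"
    using assms by (auto simp: SF_def)
  note sub = Z_sub_subspace[OF L] Z_sub_subspace[OF O_set_Z_sub[OF s(1)]]
  have "(\<lambda>k. d_Z (adj_sub L) (adj_sub (tangent_cone (gph F) (s k)))) \<longlonglongrightarrow> 0"
    by (rule tendsto_sandwich[OF _ _ tendsto_const s(3)])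
      (auto intro!: always_eventually d_Z_adj_sub_le d_Z_nonneg subspace_adj_sub sub)
  then show ?thesis
    using s adj_sub_Z_sub[OF L] by (auto simp: SF_adj_def)
qed

lemma adj_sub_SF_adj:
  assumes "L \<in> SF_adj F z"
  shows "adj_sub L \<in> SF F z"
proof -
  obtain s where L: "L \<in> Z_sub" and s: "\<And>k. s k \<in> O_set F" "s \<longlonglongrightarrow> z"
    "(\<lambda>k. d_Z L (adj_sub (tangent_cone (gph F) (s k)))) \<longlonglongrightarrow> 0"
    using assms by (auto simp: SF_adj_def)
  note sub = Z_sub_subspace[OF L] Z_sub_subspace[OF O_set_Z_sub[OF s(1)]]
  have le: "d_Z (adj_sub L) (tangent_cone (gph F) (s k)) \<le> d_Z L (adj_sub (tangent_cone (gph F) (s k)))" for k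
    using d_Z_adj_sub_le[OF sub(1) subspace_adj_sub, of "tangent_cone (gph F) (s k)"]
    by (simp add: adj_sub_adj_sub[OF sub(2)])
  have "(\<lambda>k. d_Z (adj_sub L) (tangent_cone (gph F) (s k))) \<longlonglongrightarrow> 0"
    by (rule tendsto_sandwich[OF _ _ tendsto_const s(3)])
      (auto intro!: always_eventually le d_Z_nonneg subspace_adj_sub sub)
  then show ?thesis
    using s adj_sub_Z_sub[OF L] by (auto simp: SF_def)
qed

lemma SF_adj_subset_Z_reg_iff: "SF_adj F z \<subseteq> Z_reg \<longleftrightarrow> SF F z \<subseteq> Z_reg"
proof
  assume a: "SF_adj F z \<subseteq> Z_reg"
  show "SF F z \<subseteq> Z_reg"
  proof
    fix L assume L: "L \<in> SF F z"
    then have "adj_sub (adj_sub L) \<in> Z_reg"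
      using a adj_sub_SF adj_sub_Z_reg by blast
    then show "L \<in> Z_reg" using L by (simp add: adj_sub_adj_sub SF_def Z_sub_def)
  qed
next
  assume a: "SF F z \<subseteq> Z_reg"
  show "SF_adj F z \<subseteq> Z_reg"
  proof
    fix L assume L: "L \<in> SF_adj F z"
    then have "adj_sub (adj_sub L) \<in> Z_reg"
      using a adj_sub_SF_adj adj_sub_Z_reg by blast
    then show "L \<in> Z_reg" using L by (simp add: adj_sub_adj_sub SF_adj_def Z_sub_def)
  qed
qed

subsection \<open>The local resolvent\<close>

lemma monotone_graphD:
  "monotone_graph G \<Longrightarrow> (x1, y1) \<in> G \<Longrightarrow> (x2, y2) \<in> G \<Longrightarrow> (y1 - y2) \<bullet> (x1 - x2) \<ge> 0"
  unfolding monotone_graph_def by blast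

text \<open>For \<open>M\<close>, the localised graph of \<open>\<gamma>\<close> I + F,
  Debrunner-Flor provides a point \<open>J z\<close> such that (J z, z - J z) is monotonically
  related to \<open>M\<close>. Testing with the reference point shows |J z - xb| <= |z - zb|, so for
  z near \<open>zb\<close> this pair stays inside X x Y and maximality puts it into
  \<open>M\<close>.\<close>

lemma local_resolvent:
  fixes F :: "'a::euclidean_space \<Rightarrow> 'a set"
  assumes mem: "(xb, yb) \<in> gph F" and hypo: "locally_max_hypomonotone F xb yb"
  obtains c r J W where "c \<ge> 1" "r > 0" "open W" "(xb, yb) \<in> W"
    "gph F \<inter> W = (\<lambda>z. (J z, z - c *\<^sub>R J z)) ` ball (c *\<^sub>R xb + yb) r"
    "\<And>z z'. z \<in> ball (c *\<^sub>R xb + yb) r \<Longrightarrow> z' \<in> ball (c *\<^sub>R xb + yb) r \<Longrightarrow>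
      (J z - J z') \<bullet> (J z - J z') \<le> (J z - J z') \<bullet> (z - z')"
proof -
  obtain \<gamma> :: real where \<gamma>: "\<gamma> \<ge> 0"
    and lm: "locally_max_monotone (\<lambda>u. (\<lambda>v. \<gamma> *\<^sub>R u + v) ` F u) xb (\<gamma> *\<^sub>R xb + yb)"
    using hypo unfolding locally_max_hypomonotone_def by (elim exE conjE)
  obtain X Y where op: "open X" "open Y" "xb \<in> X" "\<gamma> *\<^sub>R xb + yb \<in> Y"
    and mono: "monotone_graph (gph (\<lambda>u. (\<lambda>v. \<gamma> *\<^sub>R u + v) ` F u) \<inter> (X \<times> Y))"
    and max': "\<forall>T. monotone_graph (gph T) \<and> gph (\<lambda>u. (\<lambda>v. \<gamma> *\<^sub>R u + v) ` F u) \<inter> (X \<times> Y) \<subseteq> gph T \<longrightarrow>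
       gph (\<lambda>u. (\<lambda>v. \<gamma> *\<^sub>R u + v) ` F u) \<inter> (X \<times> Y) = gph T \<inter> (X \<times> Y)"
    using lm unfolding locally_max_monotone_def by (elim exE conjE)
  note max = max'[rule_format, OF conjI]
  define M where "M = gph (\<lambda>u. (\<lambda>v. \<gamma> *\<^sub>R u + v) ` F u) \<inter> (X \<times> Y)"
  have M_iff: "(x, h) \<in> M \<longleftrightarrow> h - \<gamma> *\<^sub>R x \<in> F x \<and> x \<in> X \<and> h \<in> Y" for x h
    by (auto simp: M_def gph_def image_iff) (metis add.commute diff_add_cancel)
  define c where "c = \<gamma> + 1"
  define hb where "hb = \<gamma> *\<^sub>R xb + yb"
  define zb where "zb = c *\<^sub>R xb + yb"
  have zb: "zb = xb + hb" by (simp add: zb_def hb_def c_def algebra_simps)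
  have bM: "(xb, hb) \<in> M"
    using op mem by (simp add: M_iff hb_def gph_def)
  obtain \<rho>1 where \<rho>1: "\<rho>1 > 0" "ball xb \<rho>1 \<subseteq> X" using op openE by metis
  obtain \<rho>2 where \<rho>2: "\<rho>2 > 0" "ball hb \<rho>2 \<subseteq> Y" using op openE unfolding hb_def by metis
  \<comment> \<open>The first component moves by at most |z - zb|, the second by at most twice that;
    hence the factor 1/2.\<close>
  define r where "r = min \<rho>1 \<rho>2 / 2"
  have "r > 0" using \<rho>1 \<rho>2 by (simp add: r_def)
  define J where "J z = (SOME x. \<forall>(u, v)\<in>M. (x - u) \<bullet> (z - x - v) \<ge> 0)" for z
  have J: "(J z - u) \<bullet> (z - J z - v) \<ge> 0" if "(u, v) \<in> M" for z u v
    using someI_ex[OF debrunner_flor[of M z]] mono that unfolding J_def M_def[symmetric] by blast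
  have JM: "(J z, z - J z) \<in> M" if z: "z \<in> ball zb r" for z
  proof -
    define x where "x = J z"
    have "(x - xb) \<bullet> (z - x - hb) \<ge> 0" using J[OF bM] by (simp add: x_def)
    then have "(x - xb) \<bullet> (x - xb) \<le> (x - xb) \<bullet> (z - zb)"
      by (simp add: zb algebra_simps)
    also have "\<dots> \<le> norm (x - xb) * norm (z - zb)"
      by (rule norm_cauchy_schwarz)
    finally have "norm (x - xb) * norm (x - xb) \<le> norm (x - xb) * norm (z - zb)"
      by (simp add: power2_norm_eq_inner[symmetric] power2_eq_square)
    then have 1: "norm (x - xb) \<le> norm (z - zb)"
      by (cases "x = xb") auto
    have "norm (z - x - hb) = norm ((z - zb) - (x - xb))" by (simp add: zb algebra_simps)
    also have "\<dots> \<le> 2 * norm (z - zb)"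
      using norm_triangle_ineq4[of "z - zb" "x - xb"] 1 by simp
    finally have 2: "norm (z - x - hb) \<le> 2 * norm (z - zb)" .
    have zr: "norm (z - zb) < r" using z by (simp add: dist_norm norm_minus_commute)
    have XY: "x \<in> X" "z - x \<in> Y"
      using 1 2 zr \<rho>1 \<rho>2 by (auto simp: r_def dist_norm norm_minus_commute intro!: subsetD[OF \<rho>1(2)] subsetD[OF \<rho>2(2)])
    \<comment> \<open>Adding one monotonically related point keeps the graph monotone, so maximality
      forces the point to be in \<open>M\<close> already.\<close>
    define T where "T u = {v. (u, v) \<in> insert (x, z - x) M}" for u
    have gT: "gph T = insert (x, z - x) M" by (auto simp: T_def gph_def)
    have "monotone_graph (gph T)"
      unfolding monotone_graph_def gT
    proof (intro ballI, clarify)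
      fix u1 v1 u2 v2
      assume 12: "(u1, v1) \<in> insert (x, z - x) M" "(u2, v2) \<in> insert (x, z - x) M"
      have a: "(z - x - v) \<bullet> (x - u) \<ge> 0" "(v - (z - x)) \<bullet> (u - x) \<ge> 0" if "(u, v) \<in> M" for u v
        using J[OF that, of z] by (simp_all add: x_def algebra_simps inner_commute)
      show "0 \<le> (v1 - v2) \<bullet> (u1 - u2)"
        using 12 a monotone_graphD[OF mono[folded M_def], of u1 v1 u2 v2] by auto
    qed
    then have "M = gph T \<inter> (X \<times> Y)"
      using max[of T] unfolding M_def[symmetric] gT by blast
    then show ?thesis using XY by (auto simp: gT x_def)
  qed
  define W where "W = {p. fst p \<in> X \<and> \<gamma> *\<^sub>R fst p + snd p \<in> Y \<and> c *\<^sub>R fst p + snd p \<in> ball zb r}"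
  have "open W"
  proof -
    have "W = fst -` X \<inter> (\<lambda>p. \<gamma> *\<^sub>R fst p + snd p) -` Y \<inter> (\<lambda>p. c *\<^sub>R fst p + snd p) -` ball zb r"
      by (auto simp: W_def)
    then show ?thesis
      using op by (simp only:) (intro open_Int open_vimage continuous_intros; simp)
  qed
  moreover have "(xb, yb) \<in> W"
    using op \<open>r > 0\<close> by (simp add: W_def zb_def)
  moreover have "gph F \<inter> W = (\<lambda>z. (J z, z - c *\<^sub>R J z)) ` ball zb r"
  proof (intro equalityI subsetI)
    fix p assume p: "p \<in> gph F \<inter> W"
    define x y z where "x = fst p" and "y = snd p" and "z = c *\<^sub>R x + y"
    have z: "z \<in> ball zb r" using p by (simp add: W_def x_def y_def z_def)
    have zx: "z - x = \<gamma> *\<^sub>R x + y" by (simp add: z_def c_def algebra_simps)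
    have "(x, z - x) \<in> M"
      using p unfolding zx M_iff by (auto simp: W_def x_def y_def gph_def)
    \<comment> \<open>The graph point and the pair of \<open>J z\<close> have the same sum z, so the
      product of their differences is -|J z - x|^2. This gives uniqueness of the resolvent.\<close>
    from J[OF this, of z] have "(J z - x) \<bullet> (J z - x) \<le> 0"
      by (simp add: algebra_simps)
    then have "x = J z"
      using inner_ge_zero[of "J z - x"] by (metis antisym inner_eq_zero_iff eq_iff_diff_eq_0)
    then have "p = (J z, z - c *\<^sub>R J z)"
      by (simp add: z_def x_def y_def)
    with z show "p \<in> (\<lambda>z. (J z, z - c *\<^sub>R J z)) ` ball zb r" by blast
  next
    fix p assume "p \<in> (\<lambda>z. (J z, z - c *\<^sub>R J z)) ` ball zb r"
    then obtain z where z: "z \<in> ball zb r" "p = (J z, z - c *\<^sub>R J z)" by blast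
    have e: "z - c *\<^sub>R J z = z - J z - \<gamma> *\<^sub>R J z" by (simp add: c_def algebra_simps)
    have 1: "\<gamma> *\<^sub>R J z + (z - c *\<^sub>R J z) = z - J z" by (simp add: e)
    have 2: "c *\<^sub>R J z + (z - c *\<^sub>R J z) = z" by simp
    have "z - c *\<^sub>R J z \<in> F (J z)" "J z \<in> X" "z - J z \<in> Y"
      using JM[OF z(1)] unfolding M_iff e[symmetric] by auto
    then show "p \<in> gph F \<inter> W"
      unfolding z(2) W_def gph_def Int_iff mem_Collect_eq fst_conv snd_conv 1 2 using z(1) by simp
  qed
  moreover have "(J z - J z') \<bullet> (J z - J z') \<le> (J z - J z') \<bullet> (z - z')"
    if "z \<in> ball zb r" "z' \<in> ball zb r" for z z'
    using monotone_graphD[OF mono[folded M_def] JM[OF that(1)] JM[OF that(2)]]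
    by (simp add: algebra_simps inner_commute)
  moreover have "c \<ge> 1" using \<gamma> by (simp add: c_def)
  ultimately show ?thesis
    using that[of c r W J] \<open>r > 0\<close> unfolding zb_def by blast
qed

subsection \<open>Tangent cones in the resolvent chart\<close>

text \<open>Directions may vary with k, as they do in the definition of the tangent cone; their
  boundedness makes the remainder uniformly small.\<close>

lemma has_derivative_seq_quotient:
  fixes f :: "'a::real_normed_vector \<Rightarrow> 'b::real_normed_vector"
  assumes f: "(f has_derivative A) (at z)" and t: "\<And>k. t k > 0" "t \<longlonglongrightarrow> 0" and w: "w \<longlonglongrightarrow> v"
  shows "(\<lambda>k. (f (z + t k *\<^sub>R w k) - f z) /\<^sub>R t k) \<longlonglongrightarrow> A v"
proof -
  define q where "q k = (f (z + t k *\<^sub>R w k) - f z) /\<^sub>R t k" for k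
  have bl: "bounded_linear A" using f by (rule has_derivative_bounded_linear)
  obtain K where K: "K > 0" "\<And>k. norm (w k) \<le> K"
    using w convergent_imp_Bseq[of w] by (auto simp: convergent_def Bseq_def)
  have tw: "(\<lambda>k. t k *\<^sub>R w k) \<longlonglongrightarrow> 0"
    using tendsto_scaleR[OF t(2) w] by simp
  have "(\<lambda>k. q k - A (w k)) \<longlonglongrightarrow> 0"
  proof (rule tendstoI)
    fix e :: real assume "e > 0"
    define e' where "e' = e / (2 * K)"
    have "e' > 0" using \<open>e > 0\<close> K by (simp add: e'_def)
    then obtain d where d: "d > 0"
      "\<And>y. norm (y - z) < d \<Longrightarrow> norm (f y - f z - A (y - z)) \<le> e' * norm (y - z)"
      using f unfolding has_derivative_at_alt by blast
    have "\<forall>\<^sub>F k in sequentially. dist (t k *\<^sub>R w k) 0 < d"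
      using tw d(1) by (rule tendstoD)
    then show "\<forall>\<^sub>F k in sequentially. dist (q k - A (w k)) 0 < e"
    proof eventually_elim
      case (elim k)
      have "norm (f (z + t k *\<^sub>R w k) - f z - A (t k *\<^sub>R w k)) \<le> e' * norm (t k *\<^sub>R w k)"
        using d(2)[of "z + t k *\<^sub>R w k"] elim by simp
      moreover have "q k - A (w k) = (f (z + t k *\<^sub>R w k) - f z - A (t k *\<^sub>R w k)) /\<^sub>R t k"
        using t(1)[of k] by (simp add: q_def linear_simps[OF bl] scaleR_diff_right)
      then have "norm (q k - A (w k)) = norm (f (z + t k *\<^sub>R w k) - f z - A (t k *\<^sub>R w k)) / t k"
        using t(1)[of k] by (simp add: divide_inverse mult.commute)
      ultimately have "norm (q k - A (w k)) \<le> e' * norm (w k)"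
        using t(1)[of k] by (simp add: pos_divide_le_eq mult_ac)
      also have "\<dots> \<le> e' * K" using K \<open>e' > 0\<close> by (intro mult_left_mono) auto
      also have "\<dots> < e" using K \<open>e > 0\<close> by (simp add: e'_def)
      finally show ?case by simp
    qed
  qed
  moreover have "(\<lambda>k. A (w k)) \<longlonglongrightarrow> A v"
    using w by (rule bounded_linear.tendsto[OF bl])
  ultimately have "(\<lambda>k. (q k - A (w k)) + A (w k)) \<longlonglongrightarrow> 0 + A v"
    by (rule tendsto_add)
  then show ?thesis by (simp add: q_def)
qed

lemma has_derivative_dir_quot_tendsto:
  fixes f :: "'a::real_normed_vector \<Rightarrow> real"
  assumes "(f has_derivative D) (at z)"
  shows "(dir_quot f z v \<longlongrightarrow> D v) (at 0)"
proof -
  have lin: "linear D" using assms by (rule has_derivative_linear)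
  have "((\<lambda>t. f (z + t *\<^sub>R v)) has_derivative (\<lambda>t. D (t *\<^sub>R v))) (at 0)"
    by (rule has_derivative_compose[of "\<lambda>t. z + t *\<^sub>R v" "\<lambda>t. t *\<^sub>R v" 0 UNIV f D, simplified])
      (use assms in \<open>auto intro!: derivative_eq_intros\<close>)
  then have "((\<lambda>t. f (z + t *\<^sub>R v)) has_field_derivative D v) (at 0)"
    unfolding has_field_derivative_def by (rule has_derivative_eq_rhs) (simp add: linear_scale[OF lin] fun_eq_iff mult.commute)
  then show ?thesis
    unfolding DERIV_def dir_quot_def by simp
qed

lemma AE_lborel_open_ex:
  fixes U :: "'a::euclidean_space set"
  assumes "AE x in lborel. x \<in> U \<longrightarrow> P x" "open U" "U \<noteq> {}"
  shows "\<exists>x\<in>U. P x"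
proof (rule ccontr)
  assume "\<not> (\<exists>x\<in>U. P x)"
  then have "AE x in lborel. x \<notin> U"
    using assms(1) by (auto elim: eventually_mono)
  moreover have "U \<in> sets lborel" using assms(2) by simp
  ultimately have "U \<in> null_sets lborel"
    using AE_iff_null_sets by blast
  then have "negligible U"
    unfolding negligible_iff_null_sets by (rule null_sets_completionI)
  then show False using open_not_negligible assms(2,3) by blast
qed

text \<open>Parametrised by the direction w of z, because neither \<open>A\<close> nor I - c A need
  be invertible. The parameter is recovered as c times the first component plus the second, so the
  dimension is always that of the parameter space.\<close>

definition graph_sub :: "real \<Rightarrow> ((real^'n) \<Rightarrow>\<^sub>L (real^'n)) \<Rightarrow> ((real^'n) \<times> (real^'n)) set" where
  "graph_sub c A = range (\<lambda>w. (blinfun_apply A w, w - c *\<^sub>R blinfun_apply A w))"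

lemma graph_sub_Z_sub: "graph_sub c (A :: (real^'n) \<Rightarrow>\<^sub>L (real^'n)) \<in> Z_sub"
proof -
  let ?f = "\<lambda>w. (blinfun_apply A w, w - c *\<^sub>R blinfun_apply A w)"
  have lin: "linear ?f"
    by (rule linearI) (simp_all add: blinfun.bilinear_simps algebra_simps)
  have inj: "inj ?f"
    by (rule injI) auto
  have "dim (range ?f) = dim (UNIV :: (real^'n) set)"
    by (rule dim_image_eq[OF lin]) (simp add: inj)
  then show ?thesis
    unfolding Z_sub_def graph_sub_def using linear_subspace_image[OF lin subspace_UNIV] by simp
qed

lemma subspace_graph_sub: "subspace (graph_sub c A)"
  using graph_sub_Z_sub Z_sub_subspace by blast

text \<open>Points with the same parameter are compared. One factor 1 + c bounds the parameter by
  the point, the other bounds the difference of the two points.\<close>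

lemma d_Z_graph_sub_le:
  assumes "c \<ge> 0"
  shows "d_Z (graph_sub c A) (graph_sub c B) \<le> 2 * ((1 + c) * (1 + c) * norm (A - B))"
proof -
  have close: "\<exists>w'\<in>graph_sub c B. norm (w - w') \<le> (1 + c) * (1 + c) * norm (A - B) * norm w"
    if wA: "w \<in> graph_sub c A" for w A B
  proof -
    obtain p where w: "w = (A p, p - c *\<^sub>R A p)" using wA by (auto simp: graph_sub_def)
    define w' where "w' = (B p, p - c *\<^sub>R B p)"
    have "p = c *\<^sub>R fst w + snd w" by (simp add: w)
    then have "norm p \<le> norm (c *\<^sub>R fst w) + norm (snd w)" using norm_triangle_ineq by metis
    also have "\<dots> \<le> c * norm w + norm w"
      using assms norm_fst_le[of "fst w" "snd w"] norm_snd_le[of "snd w" "fst w"]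
      by (intro add_mono) (auto intro: mult_left_mono)
    finally have p: "norm p \<le> (1 + c) * norm w" by (simp add: algebra_simps)
    have "w - w' = ((A - B) p, - c *\<^sub>R (A - B) p)"
      by (simp add: w w'_def blinfun.bilinear_simps algebra_simps)
    then have "norm (w - w') \<le> norm ((A - B) p) + norm (- c *\<^sub>R (A - B) p)"
      by (simp only: norm_Pair_le)
    also have "\<dots> = (1 + c) * norm ((A - B) p)" using assms by (simp add: algebra_simps)
    also have "\<dots> \<le> (1 + c) * (norm (A - B) * norm p)"
      using assms by (intro mult_left_mono norm_blinfun) auto
    also have "\<dots> \<le> (1 + c) * (norm (A - B) * ((1 + c) * norm w))"
      using assms p by (intro mult_left_mono) auto
    finally have "norm (w - w') \<le> (1 + c) * (1 + c) * norm (A - B) * norm w" by (simp add: mult_ac)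
    moreover have "w' \<in> graph_sub c B" by (auto simp: graph_sub_def w'_def)
    ultimately show ?thesis by blast
  qed
  show ?thesis
    by (rule d_Z_le_if_close[OF subspace_graph_sub subspace_graph_sub])
      (use assms close[of _ A B] close[of _ B A] in \<open>auto simp: norm_minus_commute\<close>)
qed

section \<open>The resolvent chart and its tangent spaces\<close>

locale resolvent_chart =
  fixes F :: "real^'n \<Rightarrow> (real^'n) set" and c r :: real and zb :: "real^'n"
    and J :: "real^'n \<Rightarrow> real^'n" and W :: "((real^'n) \<times> (real^'n)) set"
  assumes c: "c \<ge> 1" and r: "r > 0" and W: "open W"
    and graph: "gph F \<inter> W = (\<lambda>z. (J z, z - c *\<^sub>R J z)) ` ball zb r"
    and firm: "\<And>z z'. z \<in> ball zb r \<Longrightarrow> z' \<in> ball zb r \<Longrightarrow>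
      (J z - J z') \<bullet> (J z - J z') \<le> (J z - J z') \<bullet> (z - z')"
begin

definition chart :: "real^'n \<Rightarrow> (real^'n) \<times> (real^'n)" where
  "chart z = (J z, z - c *\<^sub>R J z)"

lemma chart_inverse: "c *\<^sub>R fst (chart z) + snd (chart z) = z"
  by (simp add: chart_def)

lemma chart_mem: "z \<in> ball zb r \<Longrightarrow> chart z \<in> gph F \<inter> W"
  unfolding graph chart_def by (rule imageI)

lemma chart_surj:
  assumes "(x, y) \<in> gph F \<inter> W"
  shows "c *\<^sub>R x + y \<in> ball zb r" "chart (c *\<^sub>R x + y) = (x, y)"
  using assms unfolding graph by (auto simp: chart_def)

lemma nonexpansive:
  assumes "z \<in> ball zb r" "z' \<in> ball zb r"
  shows "norm (J z - J z') \<le> norm (z - z')"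
proof -
  have "norm (J z - J z') * norm (J z - J z') \<le> norm (J z - J z') * norm (z - z')"
    using firm[OF assms] norm_cauchy_schwarz[of "J z - J z'" "z - z'"]
    by (simp add: power2_norm_eq_inner[symmetric] power2_eq_square)
  then show ?thesis by (cases "J z = J z'") auto
qed

lemma continuous_on_chart: "continuous_on (ball zb r) chart"
proof -
  have "1-lipschitz_on (ball zb r) J"
    using nonexpansive by (intro lipschitz_onI) (auto simp: dist_norm)
  then show ?thesis
    unfolding chart_def by (intro continuous_intros lipschitz_on_continuous_on)
qed

text \<open>One inclusion moves z along a straight line. For the other, the linear left inverse of
  the chart turns a tangent sequence into a sequence of directions at z, and differentiability of
  \<open>J\<close> determines the first component.\<close>

lemma tangent_cone_chart:
  assumes z: "z \<in> ball zb r" and A: "(J has_derivative blinfun_apply A) (at z)"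
  shows "tangent_cone (gph F) (chart z) = graph_sub c A"
proof (intro equalityI subsetI)
  fix p assume "p \<in> graph_sub c A"
  then obtain w where p: "p = (A w, w - c *\<^sub>R A w)" by (auto simp: graph_sub_def)
  \<comment> \<open>Keeps all points z + t w with 0 < t <= \<open>\<delta>\<close> inside the ball;
    the summand 1 covers w = 0.\<close>
  define \<delta> where "\<delta> = (r - dist zb z) / (norm w + 1)"
  have \<delta>: "\<delta> > 0" using z by (simp add: \<delta>_def add_nonneg_pos)
  define t where "t k = \<delta> * inverse (real (Suc k))" for k
  have t: "t k > 0" "t \<longlonglongrightarrow> 0" for k
    unfolding t_def using \<delta> tendsto_mult_left[OF LIMSEQ_inverse_real_of_nat, of \<delta>] by auto
  have zt: "z + t k *\<^sub>R w \<in> ball zb r" for k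
  proof -
    have "inverse (real (Suc k)) \<le> 1" by (simp add: inverse_le_1_iff)
    then have "t k \<le> \<delta>" using \<delta> by (simp add: t_def mult_left_le)
    then have "norm (t k *\<^sub>R w) \<le> \<delta> * norm w"
      using t(1)[of k] by (simp add: mult_right_mono)
    also have "\<dots> < \<delta> * (norm w + 1)" using \<delta> by simp
    also have "\<dots> = r - dist zb z"
      unfolding \<delta>_def using norm_ge_zero[of w] by (simp add: add_nonneg_eq_0_iff)
    finally show ?thesis
      using dist_triangle[of zb "z + t k *\<^sub>R w" z] by (simp add: dist_norm)
  qed
  define v where "v k = (chart (z + t k *\<^sub>R w) - chart z) /\<^sub>R t k" for k
  have "(\<lambda>k. (J (z + t k *\<^sub>R w) - J z) /\<^sub>R t k) \<longlonglongrightarrow> A w"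
    by (rule has_derivative_seq_quotient[OF A t]) simp
  then have "(\<lambda>k. ((J (z + t k *\<^sub>R w) - J z) /\<^sub>R t k, w - c *\<^sub>R ((J (z + t k *\<^sub>R w) - J z) /\<^sub>R t k))) \<longlonglongrightarrow> p"
    unfolding p by (intro tendsto_intros)
  moreover have "v k = ((J (z + t k *\<^sub>R w) - J z) /\<^sub>R t k, w - c *\<^sub>R ((J (z + t k *\<^sub>R w) - J z) /\<^sub>R t k))" for k
  proof -
    have "(z + t k *\<^sub>R w - c *\<^sub>R J (z + t k *\<^sub>R w) - (z - c *\<^sub>R J z)) = t k *\<^sub>R w - c *\<^sub>R (J (z + t k *\<^sub>R w) - J z)"
      by (simp add: algebra_simps)
    then show ?thesis
      using t(1)[of k] by (simp add: v_def chart_def scaleR_diff_right[of "inverse (t k)" "t k *\<^sub>R w"] mult.commute)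
  qed
  ultimately have "v \<longlonglongrightarrow> p" by presburger
  moreover have "chart z + t k *\<^sub>R v k \<in> gph F" for k
    using chart_mem[OF zt] t(1)[of k] by (simp add: v_def)
  ultimately show "p \<in> tangent_cone (gph F) (chart z)"
    using t unfolding tangent_cone_def by blast
next
  fix p assume "p \<in> tangent_cone (gph F) (chart z)"
  then obtain t v where t: "\<And>k. t k > 0" "t \<longlonglongrightarrow> 0" and v: "v \<longlonglongrightarrow> p"
    and mem: "\<And>k. chart z + t k *\<^sub>R v k \<in> gph F"
    unfolding tangent_cone_def by blast
  \<comment> \<open>The left inverse of the chart is linear, hence acts on tangent directions as on
    points.\<close>
  define w where "w k = c *\<^sub>R fst (v k) + snd (v k)" for k
  define w0 where "w0 = c *\<^sub>R fst p + snd p"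
  have w: "w \<longlonglongrightarrow> w0"
    unfolding w_def w0_def by (intro tendsto_intros v)
  have "(\<lambda>k. chart z + t k *\<^sub>R v k) \<longlonglongrightarrow> chart z + 0 *\<^sub>R p"
    by (intro tendsto_intros t v)
  then have "\<forall>\<^sub>F k in sequentially. chart z + t k *\<^sub>R v k \<in> W"
    using chart_mem[OF z] by (intro topological_tendstoD[OF _ W]) auto
  then have "\<forall>\<^sub>F k in sequentially. (J (z + t k *\<^sub>R w k) - J z) /\<^sub>R t k = fst (v k)"
  proof eventually_elim
    case (elim k)
    define q where "q = chart z + t k *\<^sub>R v k"
    have "q \<in> gph F \<inter> W" using elim mem by (simp add: q_def)
    then have "(fst q, snd q) \<in> gph F \<inter> W" by (simp only: prod.collapse)
    from arg_cong[where f = fst, OF chart_surj(2)[OF this]] have "J (c *\<^sub>R fst q + snd q) = fst q"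
      by (simp add: chart_def)
    moreover have "c *\<^sub>R fst q + snd q = z + t k *\<^sub>R w k"
      by (simp add: q_def chart_def w_def algebra_simps)
    ultimately have "J (z + t k *\<^sub>R w k) = fst q" by (simp only:)
    also have "\<dots> = J z + t k *\<^sub>R fst (v k)"
      by (simp add: q_def chart_def)
    finally have "J (z + t k *\<^sub>R w k) = J z + t k *\<^sub>R fst (v k)" .
    then show ?case using t(1)[of k] by simp
  qed
  then have "(\<lambda>k. (J (z + t k *\<^sub>R w k) - J z) /\<^sub>R t k) \<longlonglongrightarrow> fst p"
    using tendsto_fst[OF v] by (simp add: tendsto_cong)
  then have "fst p = A w0"
    using has_derivative_seq_quotient[OF A t w] LIMSEQ_unique by blast
  moreover from this have "snd p = w0 - c *\<^sub>R A w0" by (simp add: w0_def)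
  ultimately show "p \<in> graph_sub c A"
    unfolding graph_sub_def by (auto simp: image_iff prod_eq_iff)
qed

lemma norm_deriv_le:
  assumes z: "z \<in> ball zb r" and A: "(J has_derivative A) (at z)"
  shows "norm (A w) \<le> norm w"
proof -
  define t where "t k = inverse (real (Suc k))" for k
  have t: "t k > 0" "t \<longlonglongrightarrow> 0" for k
    unfolding t_def using LIMSEQ_inverse_real_of_nat by auto
  have "(\<lambda>k. norm ((J (z + t k *\<^sub>R w) - J z) /\<^sub>R t k)) \<longlonglongrightarrow> norm (A w)"
    by (intro tendsto_norm has_derivative_seq_quotient[OF A t]) simp
  moreover have "(\<lambda>k. z + t k *\<^sub>R w) \<longlonglongrightarrow> z + 0 *\<^sub>R w"
    by (intro tendsto_intros t)
  then have "\<forall>\<^sub>F k in sequentially. z + t k *\<^sub>R w \<in> ball zb r"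
    using z by (intro topological_tendstoD) auto
  then have "\<forall>\<^sub>F k in sequentially. norm ((J (z + t k *\<^sub>R w) - J z) /\<^sub>R t k) \<le> norm w"
  proof eventually_elim
    case (elim k)
    have "norm (J (z + t k *\<^sub>R w) - J z) \<le> t k * norm w"
      using nonexpansive[OF elim z] t(1)[of k] by simp
    then have "norm (J (z + t k *\<^sub>R w) - J z) / t k \<le> norm w"
      using t(1)[of k] by (simp add: pos_divide_le_eq mult_ac)
    then show ?case using t(1)[of k] by (simp add: divide_inverse mult.commute)
  qed
  ultimately show ?thesis
    by (intro tendsto_upperbound) auto
qed

text \<open>Both parts use one globally 1-Lipschitz extension of \<open>J\<close>. The mean value
  bound is tested against a fixed vector \<open>u\<close>, since the scalar inequality needs a bound
  linear in the derivative.\<close>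

lemma AE_differentiable: "AE z in lborel. z \<in> ball zb (r / 2) \<longrightarrow> J differentiable (at z)"
  and mean_value: "z1 \<in> ball zb \<delta> \<Longrightarrow> z2 \<in> ball zb \<delta> \<Longrightarrow> \<delta> \<le> r / 2 \<Longrightarrow>
    (\<And>z A. z \<in> ball zb \<delta> \<Longrightarrow> (J has_derivative blinfun_apply A) (at z) \<Longrightarrow> a \<le> A (z1 - z2) \<bullet> u) \<Longrightarrow>
    a \<le> (J z1 - J z2) \<bullet> u"
proof -
  define C where "C = cball zb (r / 2)"
  \<comment> \<open>Composition with the projection onto a smaller closed ball extends
    \<open>J\<close> without enlarging its Lipschitz constant; on the open half ball nothing
    changes.\<close>
  define K where "K z = J (closest_point C z)" for z
  have C: "convex C" "closed C" "C \<noteq> {}" using r by (auto simp: C_def)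
  have Cr: "closest_point C z \<in> ball zb r" for z
    using closest_point_in_set[OF C(2,3), of z] r by (simp add: C_def)
  have lip: "1-lipschitz_on UNIV K"
  proof (rule lipschitz_onI)
    fix x y
    have "dist (K x) (K y) \<le> dist (closest_point C x) (closest_point C y)"
      using nonexpansive[OF Cr Cr] by (simp add: K_def dist_norm)
    also have "\<dots> \<le> dist x y" by (rule closest_point_lipschitz[OF C])
    finally show "dist (K x) (K y) \<le> 1 * dist x y" by simp
  qed simp
  have KJ: "K z = J z" if "z \<in> ball zb (r / 2)" for z
    using that by (simp add: K_def closest_point_self C_def)
  have deriv: "(J has_derivative A) (at z)" if "(K has_derivative A) (at z)" "z \<in> ball zb (r / 2)" for A z
    using that KJ by (auto intro: has_derivative_transform_within_open[of K A z UNIV "ball zb (r / 2)"])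
  have AEK: "AE z in lborel. K differentiable (at z)" by (rule rademacher[OF lip])
  then show "AE z in lborel. z \<in> ball zb (r / 2) \<longrightarrow> J differentiable (at z)"
    by eventually_elim (use deriv in \<open>auto simp: differentiable_def\<close>)
  show "a \<le> (J z1 - J z2) \<bullet> u" if z12: "z1 \<in> ball zb \<delta>" "z2 \<in> ball zb \<delta>" "\<delta> \<le> r / 2"
    and ge: "\<And>z A. z \<in> ball zb \<delta> \<Longrightarrow> (J has_derivative blinfun_apply A) (at z) \<Longrightarrow> a \<le> A (z1 - z2) \<bullet> u"
  proof -
    have sub: "z \<in> ball zb (r / 2)" if "z \<in> ball zb \<delta>" for z using that z12(3) by simp
    have "(norm u)-lipschitz_on UNIV (\<lambda>z. K z \<bullet> u)"
    proof (rule lipschitz_onI)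
      fix x y
      have "\<bar>(K x - K y) \<bullet> u\<bar> \<le> norm (K x - K y) * norm u" by (rule Cauchy_Schwarz_ineq2)
      also have "\<dots> \<le> dist x y * norm u"
        using lipschitz_onD[OF lip, of x y] by (intro mult_right_mono) (auto simp: dist_norm)
      finally show "dist (K x \<bullet> u) (K y \<bullet> u) \<le> norm u * dist x y"
        by (simp add: dist_real_def inner_diff_left mult.commute)
    qed simp
    then have "a \<le> K (z2 + (z1 - z2)) \<bullet> u - K z2 \<bullet> u"
    proof (rule lipschitz_mean_value_AE[of "norm u" "\<lambda>z. K z \<bullet> u" "ball zb \<delta>"])
      show "AE x in lborel. x \<in> ball zb \<delta> \<longrightarrow> (\<forall>l. (dir_quot (\<lambda>z. K z \<bullet> u) x (z1 - z2) \<longlongrightarrow> l) (at 0) \<longrightarrow> a \<le> l)"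
        using AEK
      proof eventually_elim
        case (elim x)
        show ?case
        proof (intro impI allI)
          fix l assume x: "x \<in> ball zb \<delta>" and l: "(dir_quot (\<lambda>z. K z \<bullet> u) x (z1 - z2) \<longlongrightarrow> l) (at 0)"
          obtain D where D: "(K has_derivative D) (at x)" using elim by (auto simp: differentiable_def)
          then have app: "blinfun_apply (Blinfun D) = D"
            by (intro bounded_linear_Blinfun_apply has_derivative_bounded_linear)
          have "((\<lambda>z. K z \<bullet> u) has_derivative (\<lambda>w. D w \<bullet> u)) (at x)"
            by (rule has_derivative_inner_left[OF D])
          then have "l = D (z1 - z2) \<bullet> u"
            using has_derivative_dir_quot_tendsto l tendsto_unique[OF at_neq_bot] by blast
          then show "a \<le> l"
            using ge[OF x, of "Blinfun D"] deriv[OF D sub[OF x]] by (simp add: app)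
        qed
      qed
    qed (use z12 in auto)
    then show ?thesis
      using KJ[OF sub[OF z12(1)]] KJ[OF sub[OF z12(2)]] by (simp add: inner_diff_left)
  qed
qed

text \<open>Derivatives of \<open>J\<close> have norm at most 1 and live in a finite-dimensional
  space. A convergent subsequence therefore exists, and its tangent subspaces converge in
  \<open>d_Z\<close>.\<close>

lemma SF_subseq_limit:
  assumes zs: "\<And>k. zs k \<in> ball zb r" "zs \<longlonglongrightarrow> z" "z \<in> ball zb r"
    and A: "\<And>k. (J has_derivative blinfun_apply (A k)) (at (zs k))"
  shows "\<exists>B \<sigma>. strict_mono \<sigma> \<and> (A \<circ> \<sigma>) \<longlonglongrightarrow> B \<and> graph_sub c B \<in> SF F (chart z)"
proof -
  have "norm (A k) \<le> 1" for k
    using norm_deriv_le[OF zs(1) A] by (intro norm_blinfun_bound) auto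
  then have "bounded (range A)" by (auto simp: bounded_iff)
  then obtain B \<sigma> where B: "strict_mono (\<sigma> :: nat \<Rightarrow> nat)" "(A \<circ> \<sigma>) \<longlonglongrightarrow> B"
    using bounded_imp_convergent_subsequence by blast
  have T: "tangent_cone (gph F) (chart (zs k)) = graph_sub c (A k)" for k
    using zs(1) A by (rule tangent_cone_chart)
  have "graph_sub c B \<in> SF F (chart z)"
    unfolding SF_def
  proof (intro CollectI conjI exI[of _ "chart \<circ> zs \<circ> \<sigma>"] allI)
    show "graph_sub c B \<in> Z_sub" by (rule graph_sub_Z_sub)
    show "(chart \<circ> zs \<circ> \<sigma>) k \<in> O_set F" for k
      using chart_mem[OF zs(1)] by (auto simp: O_set_def T graph_sub_Z_sub)
    have "isCont chart z"
      using continuous_on_chart zs(3) by (simp add: continuous_on_eq_continuous_at)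
    then have "(\<lambda>k. chart (zs k)) \<longlonglongrightarrow> chart z"
      using zs(2) isCont_tendsto_compose by blast
    then show "(chart \<circ> zs \<circ> \<sigma>) \<longlonglongrightarrow> chart z"
      using LIMSEQ_subseq_LIMSEQ[OF _ B(1)] by (force simp: o_def)
    have "(\<lambda>k. 2 * ((1 + c) * (1 + c) * norm (B - (A \<circ> \<sigma>) k))) \<longlonglongrightarrow> 2 * ((1 + c) * (1 + c) * norm (B - B))"
      by (intro tendsto_intros B)
    then have lim: "(\<lambda>k. 2 * ((1 + c) * (1 + c) * norm (B - (A \<circ> \<sigma>) k))) \<longlonglongrightarrow> 0" by simp
    show "(\<lambda>k. d_Z (graph_sub c B) (tangent_cone (gph F) ((chart \<circ> zs \<circ> \<sigma>) k))) \<longlonglongrightarrow> 0"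
      by (rule tendsto_sandwich[OF _ _ tendsto_const lim])
        (use c in \<open>auto simp: T intro!: always_eventually d_Z_nonneg subspace_graph_sub d_Z_graph_sub_le\<close>)
  qed
  with B show ?thesis by blast
qed

lemma SF_nonempty:
  assumes z: "z \<in> ball zb (r / 2)"
  shows "SF F (chart z) \<noteq> {}"
proof -
  have "\<exists>z'. z' \<in> ball z (inverse (real (Suc k))) \<inter> ball zb (r / 2) \<and> J differentiable (at z')" for k
  proof -
    define U where "U = ball z (inverse (real (Suc k))) \<inter> ball zb (r / 2)"
    have "AE x in lborel. x \<in> U \<longrightarrow> J differentiable (at x)"
      using AE_differentiable by eventually_elim (auto simp: U_def)
    moreover have "z \<in> U" using z by (simp add: U_def)
    then have "U \<noteq> {}" by blast
    moreover have "open U" by (simp add: U_def open_Int)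
    ultimately have "\<exists>x\<in>U. J differentiable (at x)" by (intro AE_lborel_open_ex)
    then show ?thesis unfolding U_def[symmetric] by blast
  qed
  then have "\<forall>k. \<exists>z'. z' \<in> ball z (inverse (real (Suc k))) \<inter> ball zb (r / 2) \<and> J differentiable (at z')"
    by blast
  from choice[OF this] obtain zs where zs: "\<And>k. zs k \<in> ball z (inverse (real (Suc k))) \<inter> ball zb (r / 2)"
    "\<And>k. J differentiable (at (zs k))" by blast
  have "\<exists>A. (J has_derivative blinfun_apply A) (at (zs k))" for k
  proof -
    obtain D where D: "(J has_derivative D) (at (zs k))"
      using zs(2)[of k] unfolding differentiable_def by blast
    then have "blinfun_apply (Blinfun D) = D"
      by (intro bounded_linear_Blinfun_apply has_derivative_bounded_linear)
    with D show ?thesis by (intro exI[of _ "Blinfun D"]) simp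
  qed
  then have "\<forall>k. \<exists>A. (J has_derivative blinfun_apply A) (at (zs k))" by blast
  from choice[OF this] obtain A where A: "\<And>k. (J has_derivative blinfun_apply (A k)) (at (zs k))" by blast
  have "zs \<longlonglongrightarrow> z"
  proof (rule tendsto_dist_iff[THEN iffD2], rule tendsto_sandwich[OF _ _ tendsto_const LIMSEQ_inverse_real_of_nat])
    show "\<forall>\<^sub>F k in sequentially. dist (zs k) z \<le> inverse (real (Suc k))"
    proof (intro always_eventually allI)
      fix k
      have "dist z (zs k) < inverse (real (Suc k))" using zs(1)[of k] unfolding Int_iff mem_ball by blast
      then show "dist (zs k) z \<le> inverse (real (Suc k))"
        unfolding dist_commute[of "zs k"] by (rule less_imp_le)
    qed
  qed simp
  moreover have "ball zb (r / 2) \<subseteq> ball zb r" using r by (intro subset_ball) simp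
  then have "zs k \<in> ball zb r" "z \<in> ball zb r" for k
    using zs(1)[of k] z by blast+
  ultimately have "\<exists>B \<sigma>. strict_mono \<sigma> \<and> (A \<circ> \<sigma>) \<longlonglongrightarrow> B \<and> graph_sub c B \<in> SF F (chart z)"
    by (intro SF_subseq_limit[OF _ _ _ A])
  then show ?thesis by blast
qed

end

subsection \<open>From metric regularity to limits of tangent cones\<close>

text \<open>Clearing denominators removes the 0/0 convention, since both sides vanish there, and a
  neighbourhood of (z, z) can be shrunk to a square.\<close>

lemma liminf_quotient_nonneg_iff:
  fixes F :: "'a::real_inner \<Rightarrow> 'a set"
  shows "0 \<le> liminf_quotient F z \<longleftrightarrow> (\<forall>\<epsilon>>0. \<exists>N. open N \<and> z \<in> N \<and>
    (\<forall>p\<in>gph F \<inter> N. \<forall>q\<in>gph F \<inter> N. - \<epsilon> * (norm (fst p - fst q) * norm (snd p - snd q)) \<le> (fst p - fst q) \<bullet> (snd p - snd q)))"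
    (is "?L \<longleftrightarrow> ?R")
proof -
  define Q where "Q p q = ((fst p - fst q) \<bullet> (snd p - snd q)) / (norm (fst p - fst q) * norm (snd p - snd q))" for p q :: "'a \<times> 'a"
  have Q: "(- \<epsilon> \<le> Q p q) \<longleftrightarrow> - \<epsilon> * (norm (fst p - fst q) * norm (snd p - snd q)) \<le> (fst p - fst q) \<bullet> (snd p - snd q)"
    if "\<epsilon> > 0" for p q \<epsilon>
  proof (cases "norm (fst p - fst q) * norm (snd p - snd q) = 0")
    case False
    then have "norm (fst p - fst q) * norm (snd p - snd q) > 0" by (simp add: zero_less_mult_iff)
    then show ?thesis unfolding Q_def by (rule pos_le_divide_eq)
  next
    case True
    then show ?thesis using that by (auto simp: Q_def)
  qed
  have "?L \<longleftrightarrow> (\<forall>y<0. \<forall>\<^sub>F pq in inf (nhds (z, z)) (principal (gph F \<times> gph F)). y < ereal (Q (fst pq) (snd pq)))"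
    unfolding liminf_quotient_def le_Liminf_iff Q_def by (simp add: case_prod_unfold)
  also have "\<dots> \<longleftrightarrow> (\<forall>\<epsilon>>0. \<exists>N. open N \<and> z \<in> N \<and> (\<forall>p\<in>gph F \<inter> N. \<forall>q\<in>gph F \<inter> N. - \<epsilon> \<le> Q p q))"
  proof (intro iffI allI impI)
    fix \<epsilon> :: real assume l: "\<forall>y<0. \<forall>\<^sub>F pq in inf (nhds (z, z)) (principal (gph F \<times> gph F)). y < ereal (Q (fst pq) (snd pq))"
      and "\<epsilon> > 0"
    have "\<forall>\<^sub>F pq in inf (nhds (z, z)) (principal (gph F \<times> gph F)). ereal (- \<epsilon>) < ereal (Q (fst pq) (snd pq))"
      by (rule l[rule_format]) (use \<open>\<epsilon> > 0\<close> in simp)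
    then obtain S where S: "open S" "(z, z) \<in> S"
      "\<And>x. x \<in> S \<Longrightarrow> x \<in> gph F \<times> gph F \<Longrightarrow> - \<epsilon> < Q (fst x) (snd x)"
      unfolding eventually_inf_principal eventually_nhds by auto
    have SQ: "- \<epsilon> \<le> Q p q" if "(p, q) \<in> S" "p \<in> gph F" "q \<in> gph F" for p q
      using S(3)[of "(p, q)"] that by simp
    obtain A B where AB: "open A" "open B" "(z, z) \<in> A \<times> B" "A \<times> B \<subseteq> S"
      using open_prod_elim[OF S(1,2)] by metis
    show "\<exists>N. open N \<and> z \<in> N \<and> (\<forall>p\<in>gph F \<inter> N. \<forall>q\<in>gph F \<inter> N. - \<epsilon> \<le> Q p q)"
    proof (intro exI conjI ballI)
      show "open (A \<inter> B)" "z \<in> A \<inter> B" using AB by auto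
      show "- \<epsilon> \<le> Q p q" if "p \<in> gph F \<inter> (A \<inter> B)" "q \<in> gph F \<inter> (A \<inter> B)" for p q
        using SQ[of p q] AB(4) that by blast
    qed
  next
    fix y :: ereal
    assume r: "\<forall>\<epsilon>>0. \<exists>N. open N \<and> z \<in> N \<and> (\<forall>p\<in>gph F \<inter> N. \<forall>q\<in>gph F \<inter> N. - \<epsilon> \<le> Q p q)" and "y < 0"
    obtain \<epsilon> :: real where \<epsilon>: "\<epsilon> > 0" "y < ereal (- \<epsilon>)"
    proof -
      obtain e where e: "y < ereal e" "ereal e < 0"
        using ereal_dense2[OF \<open>y < 0\<close>] by auto
      then show ?thesis using that[of "- e"] by simp
    qed
    obtain N where N: "open N" "z \<in> N" "\<forall>p\<in>gph F \<inter> N. \<forall>q\<in>gph F \<inter> N. - \<epsilon> \<le> Q p q"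
      using r[rule_format, OF \<epsilon>(1)] by (elim exE conjE)
    have "y < ereal (Q p q)" if "p \<in> gph F \<inter> N" "q \<in> gph F \<inter> N" for p q
    proof -
      have "ereal (- \<epsilon>) \<le> ereal (Q p q)" using N(3) that by simp
      with \<epsilon>(2) show ?thesis by (rule less_le_trans)
    qed
    then show "\<forall>\<^sub>F pq in inf (nhds (z, z)) (principal (gph F \<times> gph F)). y < ereal (Q (fst pq) (snd pq))"
      unfolding eventually_inf_principal eventually_nhds
    proof (intro exI[of _ "N \<times> N"] conjI ballI impI)
      show "open (N \<times> N)" "(z, z) \<in> N \<times> N" using N(1,2) by (auto intro: open_Times)
    qed auto
  qed
  also have "\<dots> \<longleftrightarrow> ?R" using Q by simp
  finally show ?thesis .
qed

text \<open>Metric regularity at (x1, y2) yields preimages of y2 at distance almost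
  \<open>\<kappa>\<close> |y1 - y2| from x1. Such a preimage is still in the localisation, where it
  can only be x2.\<close>

lemma strongly_metrically_regular_imp_lipschitz:
  fixes F :: "'a::real_normed_vector \<Rightarrow> 'b::real_normed_vector set"
  assumes smr: "strongly_metrically_regular_around F xb yb"
  obtains \<kappa> N where "\<kappa> \<ge> 0" "open N" "(xb, yb) \<in> N"
    "\<And>p q. p \<in> gph F \<inter> N \<Longrightarrow> q \<in> gph F \<inter> N \<Longrightarrow> norm (fst p - fst q) \<le> \<kappa> * norm (snd p - snd q)"
proof -
  obtain \<kappa> X Y where \<kappa>: "\<kappa> \<ge> 0" "open X" "open Y" "xb \<in> X" "yb \<in> Y"
    and mr: "\<forall>x \<in> X. \<forall>y \<in> Y. edist_set x (inverse_map F y) \<le> ereal \<kappa> * edist_set y (F x)"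
    using smr unfolding strongly_metrically_regular_around_def metrically_regular_around_def by (elim conjE exE)
  obtain X' Y' h where h: "open X'" "open Y'" "xb \<in> X'" "yb \<in> Y'"
    "gph F \<inter> (X' \<times> Y') = {(h y, y) | y. y \<in> Y'}"
    using smr unfolding strongly_metrically_regular_around_def by (elim conjE exE)
  obtain \<rho> where \<rho>: "\<rho> > 0" "ball xb (2 * \<rho>) \<subseteq> X'"
  proof -
    obtain e where "e > 0" "ball xb e \<subseteq> X'" using h openE by metis
    then show ?thesis using that[of "e / 2"] by simp
  qed
  \<comment> \<open>Two values within \<open>e\<close> of \<open>yb\<close> are less than 2 e apart,
    and 2 e \<open>\<kappa>\<close> < \<open>\<rho>\<close>; the summand 1 covers
    \<open>\<kappa>\<close> = 0.\<close>
  define e where "e = \<rho> / (2 * (\<kappa> + 1))"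
  have "e > 0" using \<rho> \<kappa> by (simp add: e_def)
  define N where "N = (X \<inter> X' \<inter> ball xb \<rho>) \<times> (Y \<inter> Y' \<inter> ball yb e)"
  have "norm (fst p - fst q) \<le> \<kappa> * norm (snd p - snd q)" if pq: "p \<in> gph F \<inter> N" "q \<in> gph F \<inter> N" for p q
  proof -
    obtain x1 y1 x2 y2 where p: "p = (x1, y1)" and q: "q = (x2, y2)" by (metis prod.exhaust)
    have mem: "y1 \<in> F x1" "y2 \<in> F x2" "x1 \<in> X" "x1 \<in> X'" "dist xb x1 < \<rho>" "y1 \<in> Y'" "dist yb y1 < e"
      "x2 \<in> X'" "y2 \<in> Y" "y2 \<in> Y'" "dist yb y2 < e"
      using pq by (auto simp: p q gph_def N_def)
    have "edist_set y2 (F x1) \<le> ereal (dist y2 y1)"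
      unfolding edist_set_def by (rule INF_lower[OF mem(1)])
    then have "ereal \<kappa> * edist_set y2 (F x1) \<le> ereal \<kappa> * ereal (dist y2 y1)"
      using \<kappa>(1) by (intro ereal_mult_left_mono) auto
    then have le: "edist_set x1 (inverse_map F y2) \<le> ereal (\<kappa> * dist y2 y1)"
      using mr mem(3,9) by (metis order_trans times_ereal.simps(1))
    have "dist y2 y1 < 2 * e"
      using mem(7,11) dist_triangle[of y2 y1 yb] by (simp add: dist_commute)
    then have "\<kappa> * dist y2 y1 \<le> \<kappa> * (2 * e)"
      using \<kappa>(1) by (intro mult_left_mono) auto
    also have "\<dots> < \<rho>"
      using \<kappa>(1) \<rho>(1) by (simp add: e_def field_simps)
    finally have small: "\<kappa> * dist y2 y1 < \<rho>" .
    have "dist x1 x2 \<le> \<kappa> * dist y2 y1 + \<eta>" if "\<eta> > 0" for \<eta>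
    proof -
      have "edist_set x1 (inverse_map F y2) < ereal (min \<rho> (\<kappa> * dist y2 y1 + \<eta>))"
        using le small that by (intro le_less_trans[OF le]) auto
      then obtain x where x: "x \<in> inverse_map F y2" "dist x1 x < min \<rho> (\<kappa> * dist y2 y1 + \<eta>)"
        unfolding edist_set_def INF_less_iff by auto
      have "dist xb x < 2 * \<rho>"
        using x(2) mem(5) dist_triangle[of xb x x1] by simp
      then have "(x, y2) \<in> gph F \<inter> (X' \<times> Y')"
        using \<rho>(2) x(1) mem(10) by (auto simp: inverse_map_def gph_def)
      moreover have "(x2, y2) \<in> gph F \<inter> (X' \<times> Y')"
        using mem by (auto simp: gph_def)
      ultimately have "x = x2" unfolding h(5) by auto
      then show ?thesis using x(2) by simp
    qed
    then have "dist x1 x2 \<le> \<kappa> * dist y2 y1" by (rule field_le_epsilon)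
    then show ?thesis by (simp add: p q dist_norm norm_minus_commute)
  qed
  moreover have "open N" "(xb, yb) \<in> N"
    using \<kappa> h \<rho> \<open>e > 0\<close> by (auto simp: N_def intro!: open_Times)
  ultimately show ?thesis using that[of \<kappa> N] \<kappa>(1) by blast
qed

text \<open>A homogeneous closed inequality between differences of graph points survives division by
  t and the limit.\<close>

lemma tangent_cone_le:
  assumes p: "p \<in> A \<inter> N" and N: "open N"
    and le: "\<And>q. q \<in> A \<inter> N \<Longrightarrow> g (q - p) \<le> (0::real)"
    and cont: "continuous_on UNIV g"
    and hom: "\<And>t w. t > 0 \<Longrightarrow> g (t *\<^sub>R w) \<le> 0 \<Longrightarrow> g w \<le> 0"
    and w: "w \<in> tangent_cone A p"
  shows "g w \<le> 0"
proof -
  obtain t v where t: "\<And>k. t k > 0" "t \<longlonglongrightarrow> 0" and v: "v \<longlonglongrightarrow> w" and mem: "\<And>k. p + t k *\<^sub>R v k \<in> A"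
    using w unfolding tangent_cone_def by blast
  have "(\<lambda>k. p + t k *\<^sub>R v k) \<longlonglongrightarrow> p + 0 *\<^sub>R w"
    by (intro tendsto_intros t v)
  then have "\<forall>\<^sub>F k in sequentially. p + t k *\<^sub>R v k \<in> N"
    using p by (intro topological_tendstoD[OF _ N]) auto
  then have "\<forall>\<^sub>F k in sequentially. g (v k) \<le> 0"
  proof eventually_elim
    case (elim k)
    have "g (t k *\<^sub>R v k) \<le> 0" using le[of "p + t k *\<^sub>R v k"] elim mem by simp
    then show ?case using hom t(1) by blast
  qed
  moreover have "(\<lambda>k. g (v k)) \<longlonglongrightarrow> g w"
    using cont v by (rule continuous_on_tendsto_compose) auto
  ultimately show ?thesis
    using tendsto_upperbound[of "\<lambda>k. g (v k)" "g w" sequentially 0] by simp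
qed

text \<open>Convergence in \<open>d_Z\<close> makes every w in \<open>L\<close> the limit of its
  projections onto the approximating tangent spaces.\<close>

lemma SF_le:
  assumes L: "L \<in> SF F z" and N: "open N" "z \<in> N" and cont: "continuous_on UNIV g"
    and le: "\<And>p w. p \<in> gph F \<inter> N \<Longrightarrow> w \<in> tangent_cone (gph F) p \<Longrightarrow> g w \<le> (0::real)"
    and w: "w \<in> L"
  shows "g w \<le> 0"
proof -
  obtain s where LZ: "L \<in> Z_sub" and s: "\<And>k. s k \<in> O_set F" "s \<longlonglongrightarrow> z"
    "(\<lambda>k. d_Z L (tangent_cone (gph F) (s k))) \<longlonglongrightarrow> 0"
    using L by (auto simp: SF_def)
  define v where "v k = orth_proj (tangent_cone (gph F) (s k)) w" for k
  note sub = Z_sub_subspace[OF LZ] Z_sub_subspace[OF O_set_Z_sub[OF s(1)]]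
  have ww: "orth_proj L w = w"
    by (rule orth_proj_unique[OF sub(1) w]) (simp add: subspace_0[OF subspace_orthogonal_comp])
  have "(\<lambda>k. w - v k) \<longlonglongrightarrow> 0"
  proof (rule tendsto_norm_zero_cancel, rule tendsto_sandwich[OF _ _ tendsto_const])
    show "\<forall>\<^sub>F k in sequentially. norm (w - v k) \<le> d_Z L (tangent_cone (gph F) (s k)) * norm w"
      using norm_orth_proj_diff_le_d_Z[OF sub, of w] by (simp add: v_def ww)
    show "(\<lambda>k. d_Z L (tangent_cone (gph F) (s k)) * norm w) \<longlonglongrightarrow> 0"
      using tendsto_mult_right[OF s(3), of "norm w"] by simp
  qed simp
  then have "(\<lambda>k. w - (w - v k)) \<longlonglongrightarrow> w - 0"
    by (intro tendsto_intros)
  then have "v \<longlonglongrightarrow> w" by simp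
  then have "(\<lambda>k. g (v k)) \<longlonglongrightarrow> g w"
    by (intro continuous_on_tendsto_compose[OF cont]) auto
  moreover have "\<forall>\<^sub>F k in sequentially. s k \<in> N"
    using s(2) N by (rule topological_tendstoD)
  then have "\<forall>\<^sub>F k in sequentially. g (v k) \<le> 0"
  proof eventually_elim
    case (elim k)
    then have "s k \<in> gph F \<inter> N" using s(1)[of k] by (simp add: O_set_def)
    then show ?case by (rule le) (simp add: v_def orth_proj_in[OF sub(2)])
  qed
  ultimately show ?thesis
    using tendsto_upperbound[of "\<lambda>k. g (v k)" "g w" sequentially 0] by simp
qed

text \<open>Two inequalities for increments pass to \<open>L\<close>: |dx| <=
  \<open>\<kappa>\<close> |dy| gives regularity, and the bound of the inner product by -
  \<open>\<epsilon>\<close> |dx| |dy|, for every \<open>\<epsilon>\<close>, gives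
  semidefiniteness.\<close>

lemma SF_reg_psd_if_smr_liminf:
  fixes F :: "real^'n \<Rightarrow> (real^'n) set"
  assumes smr: "strongly_metrically_regular_around F xb yb" and li: "0 \<le> liminf_quotient F (xb, yb)"
    and L: "L \<in> SF F (xb, yb)"
  shows "L \<in> Z_reg" "pos_semidef (C_mat L)"
proof -
  obtain \<kappa> N where \<kappa>: "\<kappa> \<ge> 0" and N: "open N" "(xb, yb) \<in> N"
    and lip: "\<And>p q. p \<in> gph F \<inter> N \<Longrightarrow> q \<in> gph F \<inter> N \<Longrightarrow> norm (fst p - fst q) \<le> \<kappa> * norm (snd p - snd q)"
    using strongly_metrically_regular_imp_lipschitz[OF smr] by blast
  have "norm (fst w) - \<kappa> * norm (snd w) \<le> 0" if "w \<in> L" for w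
  proof (rule SF_le[OF L N _ _ that])
    show cont: "continuous_on UNIV (\<lambda>w::(real^'n)\<times>(real^'n). norm (fst w) - \<kappa> * norm (snd w))"
      by (intro continuous_intros)
    fix p w assume p: "p \<in> gph F \<inter> N" and w: "w \<in> tangent_cone (gph F) p"
    show "norm (fst w) - \<kappa> * norm (snd w) \<le> 0"
    proof (rule tangent_cone_le[OF p N(1) _ cont _ w])
      show "norm (fst (q - p)) - \<kappa> * norm (snd (q - p)) \<le> 0" if "q \<in> gph F \<inter> N" for q
        using lip[OF that p] by simp
      show "norm (fst w) - \<kappa> * norm (snd w) \<le> 0"
        if "t > 0" "norm (fst (t *\<^sub>R w)) - \<kappa> * norm (snd (t *\<^sub>R w)) \<le> 0" for t and w :: "(real^'n) \<times> (real^'n)"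
      proof -
        have "t * norm (fst w) \<le> t * (\<kappa> * norm (snd w))" using that by (simp add: mult_ac)
        then show ?thesis using \<open>t > 0\<close> by simp
      qed
    qed
  qed
  then have "y = 0" if "(y, 0) \<in> L" for y using that by fastforce
  then show reg: "L \<in> Z_reg" using L by (auto simp: Z_reg_def SF_def)
  have psd: "fst w \<bullet> snd w \<ge> - \<epsilon> * (norm (fst w) * norm (snd w))" if "\<epsilon> > 0" "w \<in> L" for w \<epsilon>
  proof -
    obtain M where M: "open M" "(xb, yb) \<in> M"
      and ge': "\<forall>p\<in>gph F \<inter> M. \<forall>q\<in>gph F \<inter> M.
        - \<epsilon> * (norm (fst p - fst q) * norm (snd p - snd q)) \<le> (fst p - fst q) \<bullet> (snd p - snd q)"
      using liminf_quotient_nonneg_iff[THEN iffD1, OF li, rule_format, OF \<open>\<epsilon> > 0\<close>]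
      by (elim exE conjE)
    note ge = bspec[OF bspec[OF ge']]
    have "- \<epsilon> * (norm (fst w) * norm (snd w)) - fst w \<bullet> snd w \<le> 0"
    proof (rule SF_le[OF L M _ _ that(2)])
      show cont: "continuous_on UNIV (\<lambda>w::(real^'n)\<times>(real^'n). - \<epsilon> * (norm (fst w) * norm (snd w)) - fst w \<bullet> snd w)"
        by (intro continuous_intros)
      fix p w assume p: "p \<in> gph F \<inter> M" and w: "w \<in> tangent_cone (gph F) p"
      show "- \<epsilon> * (norm (fst w) * norm (snd w)) - fst w \<bullet> snd w \<le> 0"
      proof (rule tangent_cone_le[OF p M(1) _ cont _ w])
        show "- \<epsilon> * (norm (fst (q - p)) * norm (snd (q - p))) - fst (q - p) \<bullet> snd (q - p) \<le> 0"
          if "q \<in> gph F \<inter> M" for q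
          using ge[OF that p] by simp
        show "- \<epsilon> * (norm (fst w) * norm (snd w)) - fst w \<bullet> snd w \<le> 0"
          if "t > 0" "- \<epsilon> * (norm (fst (t *\<^sub>R w)) * norm (snd (t *\<^sub>R w))) - fst (t *\<^sub>R w) \<bullet> snd (t *\<^sub>R w) \<le> 0"
          for t and w :: "(real^'n) \<times> (real^'n)"
        proof -
          have "t * (t * (- \<epsilon> * (norm (fst w) * norm (snd w)) - fst w \<bullet> snd w)) \<le> 0"
            using that by (simp add: algebra_simps)
          then show ?thesis using \<open>t > 0\<close> by (simp add: mult_le_0_iff)
        qed
      qed
    qed
    then show ?thesis by simp
  qed
  have "fst w \<bullet> snd w \<ge> 0" if "w \<in> L" for w
  proof -
    define m where "m = norm (fst w) * norm (snd w)"
    have "m \<ge> 0" by (simp add: m_def)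
    have "0 \<le> fst w \<bullet> snd w + e" if "e > 0" for e
    proof -
      have "- (e / (m + 1)) * m \<le> fst w \<bullet> snd w"
        unfolding m_def using \<open>e > 0\<close> \<open>w \<in> L\<close> by (intro psd) (auto simp: add_nonneg_pos)
      moreover have "e / (m + 1) * m \<le> e"
        using \<open>e > 0\<close> \<open>m \<ge> 0\<close> by (simp add: field_simps)
      ultimately show ?thesis by linarith
    qed
    then show ?thesis by (rule field_le_epsilon)
  qed
  moreover have "(C_mat L *v p, p) \<in> L" for p
    using Z_reg_eq_C_mat[OF reg] by blast
  ultimately show "pos_semidef (C_mat L)"
    unfolding pos_semidef_def by fastforce
qed

subsection \<open>From limits of tangent cones to metric regularity\<close>

lemma edist_set_le: "a \<in> A \<Longrightarrow> edist_set x A \<le> ereal (dist x a)"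
  unfolding edist_set_def by (rule INF_lower)

text \<open>A value of \<open>F x\<close> inside \<open>Y\<close> is handled by the Lipschitz bound
  on \<open>h\<close>. A value outside \<open>Y\<close> is so far from y that the inequality holds
  by the size of the neighbourhoods.\<close>

lemma strongly_metrically_regular_if_lipschitz_localization:
  fixes F :: "'a::real_normed_vector \<Rightarrow> 'b::real_normed_vector set"
  assumes op: "open X" "open Y" "h yb = xb" "xb \<in> X" "yb \<in> Y"
    and graph: "gph F \<inter> (X \<times> Y) = {(h y, y) | y. y \<in> Y}"
    and lip: "\<And>y y'. y \<in> Y \<Longrightarrow> y' \<in> Y \<Longrightarrow> norm (h y - h y') \<le> \<kappa> * norm (y - y')"
    and "\<kappa> > 0"
  shows "strongly_metrically_regular_around F xb yb"
proof -
  obtain e where e: "e > 0" "ball yb e \<subseteq> Y" using op openE by metis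
  define \<eta> where "\<eta> = e / 2"
  have \<eta>: "\<eta> > 0" "ball yb (2 * \<eta>) \<subseteq> Y" using e by (auto simp: \<eta>_def)
  \<comment> \<open>For x here and y in \<open>Y1\<close>, both x and \<open>h y\<close> lie within
    \<open>\<kappa>\<close> \<open>\<eta>\<close> of \<open>xb\<close>, while values outside
    \<open>Y\<close> are at least \<open>\<eta>\<close> away from y; this is the origin of the
    modulus 2 \<open>\<kappa>\<close>.\<close>
  define X1 where "X1 = X \<inter> ball xb (\<kappa> * \<eta>)"
  define Y1 where "Y1 = ball yb \<eta>"
  have Y1Y: "Y1 \<subseteq> Y" using \<eta> by (auto simp: Y1_def)
  have "edist_set x (inverse_map F y) \<le> ereal (2 * \<kappa>) * edist_set y (F x)"
    if x: "x \<in> X1" and y: "y \<in> Y1" for x y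
  proof -
    have yY: "y \<in> Y" using y Y1Y by blast
    then have "(h y, y) \<in> gph F" using graph by blast
    then have hy: "h y \<in> inverse_map F y" by (simp add: gph_def inverse_map_def)
    have dy: "dist yb y < \<eta>" using y by (simp add: Y1_def)
    have "dist x (h y) \<le> 2 * \<kappa> * dist y y'" if y': "y' \<in> F x" for y'
    proof (cases "y' \<in> Y")
      case True
      then have "(x, y') \<in> gph F \<inter> (X \<times> Y)" using x y' by (simp add: gph_def X1_def)
      then have "x = h y'" unfolding graph by blast
      then have "dist x (h y) \<le> \<kappa> * dist y y'"
        using lip[OF True yY] by (simp add: dist_norm norm_minus_commute)
      also have "\<dots> \<le> 2 * \<kappa> * dist y y'" using \<open>\<kappa> > 0\<close> by simp
      finally show ?thesis .
    next
      case False
      then have "y' \<notin> ball yb (2 * \<eta>)" using \<eta> by blast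
      then have far: "\<eta> \<le> dist y y'"
        using dy dist_triangle[of yb y' y] by simp
      have "norm (xb - h y) \<le> \<kappa> * norm (yb - y)"
        using lip[OF op(5) yY] by (simp add: op(3))
      also have "\<dots> \<le> \<kappa> * \<eta>" using dy \<open>\<kappa> > 0\<close> by (intro mult_left_mono) (auto simp: dist_norm)
      finally have "dist xb (h y) \<le> \<kappa> * \<eta>" by (simp add: dist_norm)
      moreover have "dist x xb < \<kappa> * \<eta>" using x by (simp add: X1_def dist_commute)
      ultimately have "dist x (h y) \<le> \<kappa> * \<eta> + \<kappa> * \<eta>"
        using dist_triangle[of x "h y" xb] by linarith
      also have "\<dots> \<le> 2 * \<kappa> * dist y y'" using far \<open>\<kappa> > 0\<close> by simp
      finally show ?thesis .
    qed
    then have "dist x (h y) / (2 * \<kappa>) \<le> dist y y'" if "y' \<in> F x" for y'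
      using that \<open>\<kappa> > 0\<close> by (simp add: field_simps)
    then have "ereal (dist x (h y) / (2 * \<kappa>)) \<le> edist_set y (F x)"
      unfolding edist_set_def by (intro INF_greatest) simp
    then have "ereal (2 * \<kappa>) * ereal (dist x (h y) / (2 * \<kappa>)) \<le> ereal (2 * \<kappa>) * edist_set y (F x)"
      using \<open>\<kappa> > 0\<close> by (intro ereal_mult_left_mono) auto
    moreover have "ereal (2 * \<kappa>) * ereal (dist x (h y) / (2 * \<kappa>)) = ereal (dist x (h y))"
      using \<open>\<kappa> > 0\<close> by simp
    ultimately show ?thesis
      using edist_set_le[OF hy, of x] by (metis order_trans)
  qed
  moreover have "open X1" "open Y1" "xb \<in> X1" "yb \<in> Y1"
    using op \<eta> \<open>\<kappa> > 0\<close> by (auto simp: X1_def Y1_def)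
  ultimately have "metrically_regular_around F xb yb"
    unfolding metrically_regular_around_def using \<open>\<kappa> > 0\<close>
    by (intro exI[of _ "2 * \<kappa>"] exI[of _ X1] exI[of _ Y1]) auto
  then show ?thesis
    unfolding strongly_metrically_regular_around_def
    by (intro conjI exI[of _ X] exI[of _ Y] exI[of _ h] op graph)
qed

context resolvent_chart
begin

definition G :: "real^'n \<Rightarrow> real^'n" where "G z = z - c *\<^sub>R J z"

lemma chart_G: "chart z = (J z, G z)"
  by (simp add: chart_def G_def)

text \<open>Without such m and \<open>\<delta>\<close>, derivatives at points tending to
  \<open>zb\<close> and unit vectors would converge to a limiting derivative and a unit vector on
  which \<open>Q\<close> is not positive. Homogeneity extends the bound from unit vectors.\<close>

lemma uniform_bound_near:
  fixes Q :: "((real^'n) \<Rightarrow>\<^sub>L (real^'n)) \<Rightarrow> real^'n \<Rightarrow> real"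
  assumes cont: "\<And>A B w v. A \<longlonglongrightarrow> B \<Longrightarrow> w \<longlonglongrightarrow> v \<Longrightarrow> (\<lambda>k. Q (A k) (w k)) \<longlonglongrightarrow> Q B v"
    and hom: "\<And>A t w. Q A (t *\<^sub>R w) = t\<^sup>2 * Q A w"
    and pos: "\<And>B w. graph_sub c B \<in> SF F (chart zb) \<Longrightarrow> norm w = 1 \<Longrightarrow> Q B w > 0"
  obtains m \<delta> where "m > 0" "0 < \<delta>" "\<delta> \<le> r / 2"
    "\<And>z A w. z \<in> ball zb \<delta> \<Longrightarrow> (J has_derivative blinfun_apply A) (at z) \<Longrightarrow> m * (w \<bullet> w) \<le> Q A w"
proof -
  define s where "s k = inverse (real (Suc k))" for k
  have s: "s k > 0" "s \<longlonglongrightarrow> 0" for k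
    unfolding s_def using LIMSEQ_inverse_real_of_nat by auto
  have "\<exists>k. \<forall>z A w. z \<in> ball zb (min (s k) (r / 2)) \<longrightarrow> (J has_derivative blinfun_apply A) (at z) \<longrightarrow>
    norm w = 1 \<longrightarrow> s k \<le> Q A w"
  proof (rule ccontr)
    assume "\<nexists>k. \<forall>z A w. z \<in> ball zb (min (s k) (r / 2)) \<longrightarrow> (J has_derivative blinfun_apply A) (at z) \<longrightarrow>
      norm w = 1 \<longrightarrow> s k \<le> Q A w"
    then have "\<forall>k. \<exists>x. fst x \<in> ball zb (min (s k) (r / 2)) \<and> (J has_derivative blinfun_apply (fst (snd x))) (at (fst x)) \<and>
      norm (snd (snd x)) = 1 \<and> Q (fst (snd x)) (snd (snd x)) < s k"
      by (simp add: not_le split_paired_Ex)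
    from choice[OF this] obtain x where x: "\<And>k. fst (x k) \<in> ball zb (min (s k) (r / 2))"
      "\<And>k. (J has_derivative blinfun_apply (fst (snd (x k)))) (at (fst (x k)))"
      "\<And>k. norm (snd (snd (x k))) = 1" "\<And>k. Q (fst (snd (x k))) (snd (snd (x k))) < s k"
      by blast
    define z A w where "z k = fst (x k)" and "A k = fst (snd (x k))" and "w k = snd (snd (x k))" for k
    have zk: "dist zb (z k) < s k" "dist zb (z k) < r / 2" for k
      using x(1)[of k] by (simp_all add: z_def)
    have "z \<longlonglongrightarrow> zb"
    proof (rule tendsto_dist_iff[THEN iffD2], rule tendsto_sandwich[OF _ _ tendsto_const s(2)])
      show "\<forall>\<^sub>F k in sequentially. dist (z k) zb \<le> s k"
        using zk(1) by (intro always_eventually allI) (simp add: dist_commute less_imp_le)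
    qed simp
    moreover have "z k \<in> ball zb r" "zb \<in> ball zb r" for k
      using zk(2)[of k] r by simp_all
    ultimately have "\<exists>B \<sigma>. strict_mono \<sigma> \<and> (A \<circ> \<sigma>) \<longlonglongrightarrow> B \<and> graph_sub c B \<in> SF F (chart zb)"
      using x(2) by (intro SF_subseq_limit[of z]) (simp_all add: z_def A_def)
    then obtain B and \<sigma> :: "nat \<Rightarrow> nat" where B: "strict_mono \<sigma>" "(A \<circ> \<sigma>) \<longlonglongrightarrow> B" "graph_sub c B \<in> SF F (chart zb)"
      by blast
    have "bounded (range (w \<circ> \<sigma>))"
      using x(3) by (auto simp: bounded_iff w_def)
    then obtain v and \<tau> :: "nat \<Rightarrow> nat" where v: "strict_mono \<tau>" "((w \<circ> \<sigma>) \<circ> \<tau>) \<longlonglongrightarrow> v"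
      using bounded_imp_convergent_subsequence by blast
    have "(\<lambda>k. norm (((w \<circ> \<sigma>) \<circ> \<tau>) k)) \<longlonglongrightarrow> norm v" by (intro tendsto_norm v)
    then have "norm v = 1"
      using x(3) by (simp add: w_def LIMSEQ_const_iff)
    have "((A \<circ> \<sigma>) \<circ> \<tau>) \<longlonglongrightarrow> B" using B(2) v(1) by (rule LIMSEQ_subseq_LIMSEQ)
    from cont[OF this v(2)] have lim: "(\<lambda>k. Q (((A \<circ> \<sigma>) \<circ> \<tau>) k) (((w \<circ> \<sigma>) \<circ> \<tau>) k)) \<longlonglongrightarrow> Q B v" .
    have slim: "((s \<circ> \<sigma>) \<circ> \<tau>) \<longlonglongrightarrow> 0"
      by (intro LIMSEQ_subseq_LIMSEQ s B v)
    have "Q B v \<le> 0"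
      by (rule LIMSEQ_le[OF lim slim]) (use x(4) in \<open>auto simp: A_def w_def intro!: less_imp_le\<close>)
    with pos[OF B(3) \<open>norm v = 1\<close>] show False by simp
  qed
  then obtain k where k: "\<And>z A w. z \<in> ball zb (min (s k) (r / 2)) \<Longrightarrow> (J has_derivative blinfun_apply A) (at z) \<Longrightarrow>
    norm w = 1 \<Longrightarrow> s k \<le> Q A w" by blast
  have "s k * (w \<bullet> w) \<le> Q A w"
    if "z \<in> ball zb (min (s k) (r / 2))" "(J has_derivative blinfun_apply A) (at z)" for z A w
  proof (cases "w = 0")
    case True
    then show ?thesis using hom[of A 0 w] by simp
  next
    case False
    have "s k \<le> Q A (w /\<^sub>R norm w)" using k[OF that] False by simp
    then have "(norm w)\<^sup>2 * s k \<le> (norm w)\<^sup>2 * Q A (w /\<^sub>R norm w)" by (intro mult_left_mono) auto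
    also have "\<dots> = Q A w" using hom[of A "norm w" "w /\<^sub>R norm w"] False by simp
    finally show ?thesis by (simp add: power2_norm_eq_inner mult.commute)
  qed
  then show ?thesis
    using s(1)[of k] r by (intro that[of "s k" "min (s k) (r / 2)"]) auto
qed

context
  assumes reg: "SF F (chart zb) \<subseteq> Z_reg" and psd: "\<And>L. L \<in> SF F (chart zb) \<Longrightarrow> pos_semidef (C_mat L)"
begin

lemma SF_limit_regular:
  assumes "graph_sub c B \<in> SF F (chart zb)" "w - c *\<^sub>R blinfun_apply B w = 0"
  shows "w = 0"
proof -
  have "(blinfun_apply B w, 0) \<in> graph_sub c B"
    using assms(2) unfolding graph_sub_def by (metis (mono_tags, lifting) rangeI)
  then have "blinfun_apply B w = 0" using assms(1) reg by (auto simp: Z_reg_def)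
  then show ?thesis using assms(2) by simp
qed

lemma SF_limit_monotone:
  assumes "graph_sub c B \<in> SF F (chart zb)"
  shows "0 \<le> blinfun_apply B w \<bullet> (w - c *\<^sub>R blinfun_apply B w)"
proof -
  have "graph_sub c B = {(C_mat (graph_sub c B) *v p, p) |p. True}"
    using assms reg by (intro Z_reg_eq_C_mat) auto
  moreover have "(blinfun_apply B w, w - c *\<^sub>R blinfun_apply B w) \<in> graph_sub c B"
    by (auto simp: graph_sub_def)
  ultimately have "blinfun_apply B w = C_mat (graph_sub c B) *v (w - c *\<^sub>R blinfun_apply B w)"
    by blast
  then show ?thesis using psd[OF assms] unfolding pos_semidef_def by metis
qed

text \<open>Semidefiniteness of the limits is not strict, so compactness is applied to the form with
  \<open>\<epsilon>\<close> |w|^2 added.\<close>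

lemma deriv_almost_monotone:
  assumes "\<epsilon> > 0"
  obtains \<delta> where "0 < \<delta>" "\<delta> \<le> r / 2"
    "\<And>z A w. z \<in> ball zb \<delta> \<Longrightarrow> (J has_derivative blinfun_apply A) (at z) \<Longrightarrow>
      - \<epsilon> * (w \<bullet> w) \<le> A w \<bullet> (w - c *\<^sub>R A w)"
proof -
  obtain m \<delta> where m: "m > 0" "0 < \<delta>" "\<delta> \<le> r / 2"
    "\<And>z A w. z \<in> ball zb \<delta> \<Longrightarrow> (J has_derivative blinfun_apply A) (at z) \<Longrightarrow>
      m * (w \<bullet> w) \<le> blinfun_apply A w \<bullet> (w - c *\<^sub>R blinfun_apply A w) + \<epsilon> * (w \<bullet> w)"
  proof (rule uniform_bound_near[of "\<lambda>A w. blinfun_apply A w \<bullet> (w - c *\<^sub>R blinfun_apply A w) + \<epsilon> * (w \<bullet> w)"])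
    show "blinfun_apply A (t *\<^sub>R w) \<bullet> (t *\<^sub>R w - c *\<^sub>R blinfun_apply A (t *\<^sub>R w)) + \<epsilon> * ((t *\<^sub>R w) \<bullet> (t *\<^sub>R w)) =
      t\<^sup>2 * (blinfun_apply A w \<bullet> (w - c *\<^sub>R blinfun_apply A w) + \<epsilon> * (w \<bullet> w))" for A t w
      by (simp add: blinfun.bilinear_simps power2_eq_square algebra_simps)
    show "0 < blinfun_apply B w \<bullet> (w - c *\<^sub>R blinfun_apply B w) + \<epsilon> * (w \<bullet> w)"
      if "graph_sub c B \<in> SF F (chart zb)" "norm w = 1" for B w
      using SF_limit_monotone[OF that(1), of w] assms that(2) by (simp add: power2_norm_eq_inner[symmetric])
  qed (auto intro!: tendsto_intros)
  have "- \<epsilon> * (w \<bullet> w) \<le> A w \<bullet> (w - c *\<^sub>R A w)"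
    if "z \<in> ball zb \<delta>" "(J has_derivative blinfun_apply A) (at z)" for z A w
  proof -
    have "0 \<le> m * (w \<bullet> w)" using m(1) by simp
    then show ?thesis using m(4)[OF that, of w] by simp
  qed
  then show ?thesis using m(2,3) that by blast
qed

text \<open>The form is concave in the derivative and so lies below its tangent at any point. The
  tangent is linear, can be averaged along segments, and is exact at the increment of
  \<open>J\<close>.\<close>

lemma almost_monotone_near:
  assumes "\<epsilon> > 0"
  obtains \<delta> where "0 < \<delta>" "\<delta> \<le> r / 2"
    "\<And>z1 z2. z1 \<in> ball zb \<delta> \<Longrightarrow> z2 \<in> ball zb \<delta> \<Longrightarrow>
      - \<epsilon> * ((z1 - z2) \<bullet> (z1 - z2)) \<le> (J z1 - J z2) \<bullet> (G z1 - G z2)"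
proof -
  obtain \<delta> where \<delta>: "0 < \<delta>" "\<delta> \<le> r / 2"
    "\<And>z A w. z \<in> ball zb \<delta> \<Longrightarrow> (J has_derivative blinfun_apply A) (at z) \<Longrightarrow>
      - \<epsilon> * (w \<bullet> w) \<le> A w \<bullet> (w - c *\<^sub>R A w)"
    using deriv_almost_monotone[OF assms] by blast
  have "- \<epsilon> * ((z1 - z2) \<bullet> (z1 - z2)) \<le> (J z1 - J z2) \<bullet> (G z1 - G z2)"
    if z: "z1 \<in> ball zb \<delta>" "z2 \<in> ball zb \<delta>" for z1 z2
  proof -
    define w where "w = z1 - z2"
    define \<xi> where "\<xi> = J z1 - J z2"
    \<comment> \<open>Tangent inequality at \<open>\<xi>\<close>: -c |A w|^2 <= -2 c (A w,
      \<open>\<xi>\<close>) + c |\<open>\<xi>\<close>|^2, where the bracket is the inner product.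
      After averaging, A w becomes \<open>\<xi>\<close> itself and the original form
      returns.\<close>
    have "- \<epsilon> * (w \<bullet> w) - c * (\<xi> \<bullet> \<xi>) \<le> (J z1 - J z2) \<bullet> (w - (2 * c) *\<^sub>R \<xi>)"
    proof (rule mean_value[OF z \<delta>(2)])
      fix z A assume "z \<in> ball zb \<delta>" "(J has_derivative blinfun_apply A) (at z)"
      then have "- \<epsilon> * (w \<bullet> w) \<le> A w \<bullet> (w - c *\<^sub>R A w)" by (rule \<delta>(3))
      moreover have "0 \<le> c * ((A w - \<xi>) \<bullet> (A w - \<xi>))" using c by simp
      ultimately show "- \<epsilon> * (w \<bullet> w) - c * (\<xi> \<bullet> \<xi>) \<le> A (z1 - z2) \<bullet> (w - (2 * c) *\<^sub>R \<xi>)"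
        unfolding w_def[symmetric] by (simp add: algebra_simps inner_commute)
    qed
    then have "- \<epsilon> * (w \<bullet> w) \<le> \<xi> \<bullet> (w - c *\<^sub>R \<xi>)"
      unfolding \<xi>_def[symmetric] by (simp add: algebra_simps)
    moreover have "G z1 - G z2 = w - c *\<^sub>R \<xi>"
      by (simp add: G_def w_def \<xi>_def algebra_simps)
    ultimately show ?thesis
      unfolding w_def[symmetric] \<xi>_def[symmetric] by (simp only:)
  qed
  then show ?thesis using \<delta>(1,2) that by blast
qed

text \<open>Writing \<open>w = c A w + B w\<close> with \<open>B = I - c A\<close>, one has \<open>\<langle>B w, w\<rangle> = |B w|\<^sup>2 + c \<langle>A w, B w\<rangle>\<close>. The right
  side is bounded below near the reference point, and the left side is linear in \<open>A\<close>, so the bound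
  survives averaging along segments; this is what replaces an invertibility condition on the
  convex hull of the limiting derivatives.\<close>

lemma strongly_monotone_near:
  obtains \<mu> \<delta> where "0 < \<mu>" "0 < \<delta>" "\<delta> \<le> r / 2"
    "\<And>z1 z2. z1 \<in> ball zb \<delta> \<Longrightarrow> z2 \<in> ball zb \<delta> \<Longrightarrow>
      \<mu> * ((z1 - z2) \<bullet> (z1 - z2)) \<le> (G z1 - G z2) \<bullet> (z1 - z2)"
proof -
  obtain m \<delta>1 where m: "m > 0" "0 < \<delta>1" "\<delta>1 \<le> r / 2"
    "\<And>z A w. z \<in> ball zb \<delta>1 \<Longrightarrow> (J has_derivative blinfun_apply A) (at z) \<Longrightarrow>
      m * (w \<bullet> w) \<le> (w - c *\<^sub>R blinfun_apply A w) \<bullet> (w - c *\<^sub>R blinfun_apply A w)"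
  proof (rule uniform_bound_near[of "\<lambda>A w. (w - c *\<^sub>R blinfun_apply A w) \<bullet> (w - c *\<^sub>R blinfun_apply A w)"])
    show "(t *\<^sub>R w - c *\<^sub>R blinfun_apply A (t *\<^sub>R w)) \<bullet> (t *\<^sub>R w - c *\<^sub>R blinfun_apply A (t *\<^sub>R w)) =
      t\<^sup>2 * ((w - c *\<^sub>R blinfun_apply A w) \<bullet> (w - c *\<^sub>R blinfun_apply A w))" for A t w
      by (simp add: blinfun.bilinear_simps power2_eq_square algebra_simps)
    show "0 < (w - c *\<^sub>R blinfun_apply B w) \<bullet> (w - c *\<^sub>R blinfun_apply B w)"
      if "graph_sub c B \<in> SF F (chart zb)" "norm w = 1" for B w
      using SF_limit_regular[OF that(1), of w] that(2) unfolding inner_gt_zero_iff by auto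
  qed (auto intro!: tendsto_intros)
  \<comment> \<open>Chosen so that c \<open>\<epsilon>\<close> uses up only half of the lower bound
    \<open>m\<close> for |B w|^2.\<close>
  define \<epsilon> where "\<epsilon> = m / (2 * c)"
  have "\<epsilon> > 0" using m(1) c by (simp add: \<epsilon>_def)
  have c\<epsilon>: "c * \<epsilon> = m / 2" using c by (simp add: \<epsilon>_def)
  obtain \<delta>2 where \<delta>2: "0 < \<delta>2" "\<delta>2 \<le> r / 2"
    "\<And>z A w. z \<in> ball zb \<delta>2 \<Longrightarrow> (J has_derivative blinfun_apply A) (at z) \<Longrightarrow>
      - \<epsilon> * (w \<bullet> w) \<le> A w \<bullet> (w - c *\<^sub>R A w)"
    using deriv_almost_monotone[OF \<open>\<epsilon> > 0\<close>] by blast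
  define \<delta> where "\<delta> = min \<delta>1 \<delta>2"
  have \<delta>r: "\<delta> \<le> r / 2" using m(3) by (simp add: \<delta>_def)
  have "m / 2 * ((z1 - z2) \<bullet> (z1 - z2)) \<le> (G z1 - G z2) \<bullet> (z1 - z2)"
    if z: "z1 \<in> ball zb \<delta>" "z2 \<in> ball zb \<delta>" for z1 z2
  proof -
    define w where "w = z1 - z2"
    have "m / 2 * (w \<bullet> w) - w \<bullet> w \<le> (J z1 - J z2) \<bullet> (- c *\<^sub>R w)"
    proof (rule mean_value[OF z \<delta>r])
      fix z A assume zA: "z \<in> ball zb \<delta>" "(J has_derivative blinfun_apply A) (at z)"
      define b where "b = w - c *\<^sub>R A w"
      have "- \<epsilon> * (w \<bullet> w) \<le> A w \<bullet> b" unfolding b_def using zA by (intro \<delta>2(3)) (auto simp: \<delta>_def)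
      then have "c * (- \<epsilon> * (w \<bullet> w)) \<le> c * (A w \<bullet> b)" using c by (intro mult_left_mono) auto
      then have 1: "- (m / 2) * (w \<bullet> w) \<le> c * (A w \<bullet> b)"
        by (simp add: mult.assoc[symmetric] c\<epsilon>)
      have 2: "m * (w \<bullet> w) \<le> b \<bullet> b" unfolding b_def using zA by (intro m(4)) (auto simp: \<delta>_def)
      have "b \<bullet> w = b \<bullet> b + c * (A w \<bullet> b)"
        by (simp add: b_def algebra_simps inner_commute)
      moreover have "b \<bullet> w = w \<bullet> w + A w \<bullet> (- c *\<^sub>R w)"
        by (simp add: b_def algebra_simps)
      ultimately show "m / 2 * (w \<bullet> w) - w \<bullet> w \<le> A (z1 - z2) \<bullet> (- c *\<^sub>R w)"
        unfolding w_def[symmetric] using 1 2 by linarith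
    qed
    moreover have "(G z1 - G z2) \<bullet> w = w \<bullet> w + (J z1 - J z2) \<bullet> (- c *\<^sub>R w)"
      by (simp add: G_def w_def algebra_simps)
    ultimately show ?thesis unfolding w_def[symmetric] by simp
  qed
  then show ?thesis using m \<delta>2 \<delta>r by (intro that[of "m / 2" \<delta>]) (auto simp: \<delta>_def)
qed

lemma expansive_near:
  obtains \<mu> \<delta> where "0 < \<mu>" "0 < \<delta>" "\<delta> \<le> r / 2"
    "\<And>z1 z2. z1 \<in> ball zb \<delta> \<Longrightarrow> z2 \<in> ball zb \<delta> \<Longrightarrow> \<mu> * norm (z1 - z2) \<le> norm (G z1 - G z2)"
proof -
  obtain \<mu> \<delta> where \<mu>: "0 < \<mu>" "0 < \<delta>" "\<delta> \<le> r / 2"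
    "\<And>z1 z2. z1 \<in> ball zb \<delta> \<Longrightarrow> z2 \<in> ball zb \<delta> \<Longrightarrow>
      \<mu> * ((z1 - z2) \<bullet> (z1 - z2)) \<le> (G z1 - G z2) \<bullet> (z1 - z2)"
    using strongly_monotone_near by blast
  have "\<mu> * norm (z1 - z2) \<le> norm (G z1 - G z2)" if "z1 \<in> ball zb \<delta>" "z2 \<in> ball zb \<delta>" for z1 z2
  proof (cases "z1 = z2")
    case False
    have "norm (z1 - z2) * (\<mu> * norm (z1 - z2)) \<le> norm (z1 - z2) * norm (G z1 - G z2)"
      using \<mu>(4)[OF that] norm_cauchy_schwarz[of "G z1 - G z2" "z1 - z2"]
      by (simp add: power2_norm_eq_inner[symmetric] power2_eq_square mult_ac)
    then show ?thesis using False by simp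
  qed simp
  then show ?thesis using \<mu> that by blast
qed

text \<open>\<open>G\<close> is continuous and injective near \<open>zb\<close>, so invariance of
  domain makes its image open. The localisation of the inverse of F is \<open>J\<close> after the
  inverse of \<open>G\<close>, which is Lipschitz by expansiveness.\<close>

lemma strongly_metrically_regular_near: "strongly_metrically_regular_around F (J zb) (G zb)"
proof -
  obtain \<mu> \<delta> where \<mu>: "0 < \<mu>" "0 < \<delta>" "\<delta> \<le> r / 2"
    and exp: "\<And>z1 z2. z1 \<in> ball zb \<delta> \<Longrightarrow> z2 \<in> ball zb \<delta> \<Longrightarrow> \<mu> * norm (z1 - z2) \<le> norm (G z1 - G z2)"
    using expansive_near by blast
  have sub: "ball zb \<delta> \<subseteq> ball zb r" using \<mu>(3) r by (intro subset_ball) simp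
  have zb: "zb \<in> ball zb \<delta>" using \<mu>(2) by simp
  have contG: "continuous_on (ball zb \<delta>) G"
    using continuous_on_subset[OF continuous_on_snd[OF continuous_on_chart] sub] by (simp add: chart_G)
  have inj: "inj_on G (ball zb \<delta>)"
  proof (rule inj_onI)
    fix z1 z2 assume "z1 \<in> ball zb \<delta>" "z2 \<in> ball zb \<delta>" "G z1 = G z2"
    with exp[of z1 z2] have "\<mu> * norm (z1 - z2) \<le> 0" by simp
    then show "z1 = z2" using \<mu>(1) by (simp add: mult_le_0_iff)
  qed
  define V where "V = G ` ball zb \<delta>"
  have openV: "open V"
    unfolding V_def by (rule invariance_of_domain[OF contG open_ball inj])
  define k where "k = inv_into (ball zb \<delta>) G"
  have k: "k y \<in> ball zb \<delta>" "G (k y) = y" if "y \<in> V" for y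
    using that unfolding k_def V_def by (auto intro: inv_into_into f_inv_into_f simp del: mem_ball)
  have kG: "k (G z) = z" if "z \<in> ball zb \<delta>" for z
    unfolding k_def using inj that by (rule inv_into_f_f)
  define h where "h y = J (k y)" for y
  have hlip: "norm (h y - h y') \<le> (1 / \<mu>) * norm (y - y')" if "y \<in> V" "y' \<in> V" for y y'
  proof -
    have "norm (h y - h y') \<le> norm (k y - k y')"
      unfolding h_def using k[OF that(1)] k[OF that(2)] sub by (intro nonexpansive) auto
    also have "\<dots> \<le> (1 / \<mu>) * norm (y - y')"
      using exp[OF k(1)[OF that(1)] k(1)[OF that(2)]] \<mu>(1) by (simp add: k(2) that field_simps)
    finally show ?thesis .
  qed
  have hb: "h (G zb) = J zb" by (simp only: h_def kG[OF zb])
  \<comment> \<open>Restricts to graph points whose chart coordinate lies where \<open>G\<close> is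
    injective; other points with the same y are thereby excluded.\<close>
  define N where "N = W \<inter> (\<lambda>p. c *\<^sub>R fst p + snd p) -` ball zb \<delta>"
  have "open N"
    unfolding N_def using W by (intro open_Int open_vimage continuous_intros) auto
  moreover have "(J zb, G zb) \<in> N"
    using chart_mem[of zb] zb r chart_inverse[of zb] by (simp add: N_def chart_G)
  ultimately obtain X Y0 where XY: "open X" "open Y0" "(J zb, G zb) \<in> X \<times> Y0" "X \<times> Y0 \<subseteq> N"
    using open_prod_elim by metis
  have "continuous_on V h"
  proof -
    have "(1 / \<mu>)-lipschitz_on V h"
      using hlip \<mu>(1) by (intro lipschitz_onI) (auto simp: dist_norm)
    then show ?thesis by (rule lipschitz_on_continuous_on)
  qed
  then have "open (h -` X \<inter> V)"
    using openV XY(1) by (simp add: continuous_on_open_vimage)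
  \<comment> \<open>\<open>Y\<close> is cut down so that \<open>h\<close> maps it into
    \<open>X\<close>; otherwise (h y, y) could leave the product neighbourhood.\<close>
  define Y where "Y = Y0 \<inter> (h -` X \<inter> V)"
  have "open Y" unfolding Y_def using XY(2) \<open>open (h -` X \<inter> V)\<close> by (rule open_Int)
  have "gph F \<inter> (X \<times> Y) = {(h y, y) |y. y \<in> Y}"
  proof (intro equalityI subsetI)
    fix p assume p: "p \<in> gph F \<inter> (X \<times> Y)"
    obtain x y where xy: "p = (x, y)" by (metis prod.exhaust)
    have pN: "(x, y) \<in> N" using p XY(4) by (auto simp: xy Y_def)
    then have "(x, y) \<in> gph F \<inter> W" using p by (auto simp: N_def xy)
    from chart_surj[OF this] have "chart (c *\<^sub>R x + y) = (x, y)" by simp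
    moreover have "c *\<^sub>R x + y \<in> ball zb \<delta>" using pN by (simp add: N_def)
    ultimately have "h y = x"
      using kG unfolding chart_G h_def by (metis Pair_inject)
    then show "p \<in> {(h y, y) |y. y \<in> Y}" using p by (auto simp: xy)
  next
    fix p assume "p \<in> {(h y, y) |y. y \<in> Y}"
    then obtain y where y: "p = (h y, y)" "y \<in> Y" by blast
    then have "y \<in> V" "h y \<in> X" by (auto simp: Y_def)
    then have "p = chart (k y)" by (simp add: y chart_G h_def k)
    moreover have "chart (k y) \<in> gph F" using chart_mem[of "k y"] k(1)[OF \<open>y \<in> V\<close>] sub by blast
    ultimately have "p \<in> gph F" by (simp only:)
    moreover have "p \<in> X \<times> Y" unfolding y(1) using y(2) \<open>h y \<in> X\<close> by blast
    ultimately show "p \<in> gph F \<inter> (X \<times> Y)" by blast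
  qed
  moreover have "G zb \<in> Y" "J zb \<in> X"
    using XY(3) zb hb by (auto simp: Y_def V_def)
  ultimately show ?thesis
    using XY(1) \<open>open Y\<close> hb \<mu>(1)
    by (intro strongly_metrically_regular_if_lipschitz_localization[of X Y h _ _ F "1 / \<mu>"] hlip)
      (auto simp: Y_def)
qed

text \<open>Substituting z = c x + y turns firm nonexpansiveness of \<open>J\<close> back into a
  lower bound on the graph of F.\<close>

lemma hypomonotone:
  assumes "z1 \<in> ball zb r" "z2 \<in> ball zb r"
  shows "- (c - 1) * ((J z1 - J z2) \<bullet> (J z1 - J z2)) \<le> (J z1 - J z2) \<bullet> (G z1 - G z2)"
proof -
  have "z1 - z2 = (G z1 - G z2) + c *\<^sub>R (J z1 - J z2)"
    by (simp add: G_def algebra_simps)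
  then have "(J z1 - J z2) \<bullet> (z1 - z2) = (J z1 - J z2) \<bullet> (G z1 - G z2) + c * ((J z1 - J z2) \<bullet> (J z1 - J z2))"
    by (simp add: inner_add_right)
  then show ?thesis using firm[OF assms] by (simp add: algebra_simps)
qed

text \<open>Almost monotonicity controls \<open>\<langle>dx, dy\<rangle>\<close> by \<open>|dy|\<^sup>2\<close>, hypomonotonicity controls it by \<open>|dx|\<^sup>2\<close>; a bound by
  \<open>|dx| |dy|\<close> follows from the latter when \<open>|dx|\<close> is small compared with \<open>|dy|\<close> and from the former otherwise.\<close>

lemma liminf_quotient_nonneg: "0 \<le> liminf_quotient F (chart zb)"
  unfolding liminf_quotient_nonneg_iff
proof (intro allI impI)
  fix \<epsilon> :: real assume "\<epsilon> > 0"
  obtain \<mu> \<delta>1 where \<mu>: "0 < \<mu>" "0 < \<delta>1" "\<delta>1 \<le> r / 2"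
    and exp: "\<And>z1 z2. z1 \<in> ball zb \<delta>1 \<Longrightarrow> z2 \<in> ball zb \<delta>1 \<Longrightarrow> \<mu> * norm (z1 - z2) \<le> norm (G z1 - G z2)"
    using expansive_near by blast
  \<comment> \<open>By expansiveness e |dz|^2 <= \<open>\<epsilon>\<close>^2 |dy|^2 / c, and this is
    at most \<open>\<epsilon>\<close> |dx| |dy| as soon as c |dx| > \<open>\<epsilon>\<close> |dy|,
    the complement of the case settled by hypomonotonicity.\<close>
  define e where "e = \<epsilon>\<^sup>2 * \<mu>\<^sup>2 / c"
  have "e > 0" using \<open>\<epsilon> > 0\<close> \<mu>(1) c by (simp add: e_def)
  obtain \<delta>2 where \<delta>2: "0 < \<delta>2" "\<delta>2 \<le> r / 2"
    and am: "\<And>z1 z2. z1 \<in> ball zb \<delta>2 \<Longrightarrow> z2 \<in> ball zb \<delta>2 \<Longrightarrow>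
      - e * ((z1 - z2) \<bullet> (z1 - z2)) \<le> (J z1 - J z2) \<bullet> (G z1 - G z2)"
    using almost_monotone_near[OF \<open>e > 0\<close>] by blast
  define \<delta> where "\<delta> = min \<delta>1 \<delta>2"
  define N where "N = W \<inter> (\<lambda>p. c *\<^sub>R fst p + snd p) -` ball zb \<delta>"
  have "open N"
    unfolding N_def using W by (intro open_Int open_vimage continuous_intros) auto
  moreover have "chart zb \<in> N"
    using chart_mem[of zb] r chart_inverse[of zb] \<mu>(2) \<delta>2(1) by (simp add: N_def \<delta>_def)
  moreover have "- \<epsilon> * (norm (fst p - fst q) * norm (snd p - snd q)) \<le> (fst p - fst q) \<bullet> (snd p - snd q)"
    if pq: "p \<in> gph F \<inter> N" "q \<in> gph F \<inter> N" for p q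
  proof -
    have ex: "\<exists>z\<in>ball zb \<delta>. p = (J z, G z)" if "p \<in> gph F \<inter> N" for p
    proof -
      have "(fst p, snd p) \<in> gph F \<inter> W" using that by (simp add: N_def)
      from chart_surj(2)[OF this] have "p = (J (c *\<^sub>R fst p + snd p), G (c *\<^sub>R fst p + snd p))"
        by (simp add: chart_G)
      moreover have "c *\<^sub>R fst p + snd p \<in> ball zb \<delta>" using that by (simp add: N_def)
      ultimately show ?thesis by blast
    qed
    obtain z1 z2 where z: "z1 \<in> ball zb \<delta>" "z2 \<in> ball zb \<delta>" "p = (J z1, G z1)" "q = (J z2, G z2)"
      using ex[OF pq(1)] ex[OF pq(2)] by blast
    define x y where "x = norm (J z1 - J z2)" and "y = norm (G z1 - G z2)"
    define i where "i = (J z1 - J z2) \<bullet> (G z1 - G z2)"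
    have xy: "x \<ge> 0" "y \<ge> 0" by (simp_all add: x_def y_def)
    have zr: "z1 \<in> ball zb r" "z2 \<in> ball zb r"
      using z(1,2) \<mu>(3) r by (auto simp: \<delta>_def)
    have 1: "- (c - 1) * (x * x) \<le> i"
      using hypomonotone[OF zr] by (simp add: x_def i_def power2_norm_eq_inner[symmetric] power2_eq_square)
    have "- \<epsilon> * (x * y) \<le> i"
    proof (cases "c * x \<le> \<epsilon> * y")
      case True
      have "(c - 1) * (x * x) \<le> (c * x) * x" using xy by (simp add: algebra_simps)
      also have "\<dots> \<le> (\<epsilon> * y) * x" using True xy by (intro mult_right_mono)
      also have "\<dots> = \<epsilon> * (x * y)" by simp
      finally show ?thesis using 1 unfolding minus_mult_left[symmetric] by linarith
    next
      case False
      have "(\<mu> * norm (z1 - z2))\<^sup>2 \<le> y\<^sup>2"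
        unfolding y_def using exp[of z1 z2] z(1,2) \<mu>(1) by (intro power_mono) (auto simp: \<delta>_def)
      then have "\<epsilon>\<^sup>2 / c * (\<mu>\<^sup>2 * ((z1 - z2) \<bullet> (z1 - z2))) \<le> \<epsilon>\<^sup>2 / c * y\<^sup>2"
        using c by (intro mult_left_mono) (auto simp: power_mult_distrib power2_norm_eq_inner)
      moreover have "\<epsilon>\<^sup>2 / c * (\<mu>\<^sup>2 * ((z1 - z2) \<bullet> (z1 - z2))) = e * ((z1 - z2) \<bullet> (z1 - z2))"
        by (simp add: e_def)
      ultimately have "- (\<epsilon>\<^sup>2 / c * y\<^sup>2) \<le> i"
        using am[of z1 z2] z(1,2) by (simp add: i_def \<delta>_def)
      moreover have "\<epsilon>\<^sup>2 / c * y\<^sup>2 \<le> \<epsilon> * (x * y)"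
      proof -
        have "(\<epsilon> * y) * (\<epsilon> * y) \<le> (c * x) * (\<epsilon> * y)"
          using False \<open>\<epsilon> > 0\<close> xy by (intro mult_right_mono) auto
        then show ?thesis using c by (simp add: field_simps power2_eq_square)
      qed
      ultimately show ?thesis by simp
    qed
    then show ?thesis by (simp add: z(3,4) x_def y_def i_def)
  qed
  ultimately show "\<exists>N. open N \<and> chart zb \<in> N \<and> (\<forall>p\<in>gph F \<inter> N. \<forall>q\<in>gph F \<inter> N.
      - \<epsilon> * (norm (fst p - fst q) * norm (snd p - snd q)) \<le> (fst p - fst q) \<bullet> (snd p - snd q))"
    by blast
qed

end

text \<open>Density of the differentiability points of \<open>J\<close> makes \<open>SF\<close>
  nonempty at all nearby graph points, and adjoints carry this over to
  \<open>SF_adj\<close>.\<close>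

lemma SCD_around_chart: "SCD_around F (chart zb)"
  unfolding SCD_around_def
proof (intro exI conjI ballI)
  define N where "N = W \<inter> (\<lambda>p. c *\<^sub>R fst p + snd p) -` ball zb (r / 2)"
  show "open N"
    unfolding N_def using W by (intro open_Int open_vimage continuous_intros) auto
  show "chart zb \<in> N"
    using chart_mem[of zb] r chart_inverse[of zb] by (simp add: N_def)
  fix p assume p: "p \<in> gph F \<inter> N"
  then have "(fst p, snd p) \<in> gph F \<inter> W" by (simp add: N_def)
  from chart_surj(2)[OF this] have "chart (c *\<^sub>R fst p + snd p) = p" by simp
  moreover have "c *\<^sub>R fst p + snd p \<in> ball zb (r / 2)" using p by (simp add: N_def)
  ultimately have "SF F p \<noteq> {}" using SF_nonempty by metis
  then show "SCD_at F p" unfolding SCD_at_def using adj_sub_SF by blast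
qed

end

theorem theorem7p5:
  fixes F :: "real^'n \<Rightarrow> (real^'n) set" and xb yb :: "real^'n"
  assumes "(xb, yb) \<in> gph F"
    and "locally_closed_around (gph F) (xb, yb)"
    and "locally_max_hypomonotone F xb yb"
  shows "(SCD_regular_around F (xb, yb) \<and> (\<forall>L \<in> SF F (xb, yb). pos_semidef (C_mat L)))
    \<longleftrightarrow> (strongly_metrically_regular_around F xb yb \<and> liminf_quotient F (xb, yb) \<ge> 0)"
proof -
  obtain c r J W where cr: "c \<ge> 1" "r > 0" "open W" "(xb, yb) \<in> W"
    "gph F \<inter> W = (\<lambda>z. (J z, z - c *\<^sub>R J z)) ` ball (c *\<^sub>R xb + yb) r"
    "\<And>z z'. z \<in> ball (c *\<^sub>R xb + yb) r \<Longrightarrow> z' \<in> ball (c *\<^sub>R xb + yb) r \<Longrightarrow>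
      (J z - J z') \<bullet> (J z - J z') \<le> (J z - J z') \<bullet> (z - z')"
    by (rule local_resolvent[OF assms(1,3)]) blast
  define zb where "zb = c *\<^sub>R xb + yb"
  interpret resolvent_chart F c r zb J W
    using cr unfolding zb_def by unfold_locales
  have chart: "chart zb = (xb, yb)"
    unfolding zb_def using assms(1) cr(4) by (intro chart_surj(2)) simp
  then have JG: "J zb = xb" "G zb = yb" by (simp_all add: chart_G)
  show ?thesis
  proof
    assume l: "SCD_regular_around F (xb, yb) \<and> (\<forall>L \<in> SF F (xb, yb). pos_semidef (C_mat L))"
    then have reg: "SF F (chart zb) \<subseteq> Z_reg"
      unfolding SCD_regular_around_def SF_adj_subset_Z_reg_iff chart by blast
    have psd: "pos_semidef (C_mat L)" if "L \<in> SF F (chart zb)" for L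
      using l that unfolding chart by blast
    show "strongly_metrically_regular_around F xb yb \<and> liminf_quotient F (xb, yb) \<ge> 0"
      using strongly_metrically_regular_near[OF reg psd] liminf_quotient_nonneg[OF reg psd]
      unfolding JG chart by blast
  next
    assume r: "strongly_metrically_regular_around F xb yb \<and> liminf_quotient F (xb, yb) \<ge> 0"
    show "SCD_regular_around F (xb, yb) \<and> (\<forall>L \<in> SF F (xb, yb). pos_semidef (C_mat L))"
      unfolding SCD_regular_around_def SF_adj_subset_Z_reg_iff
      using SF_reg_psd_if_smr_liminf r SCD_around_chart[unfolded chart] by blast
  qed
qed

end
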